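(* Let $d\ge3$ and let $Q$ be the external field on $\mathbb{S}^{d-1}$ given by $Q(x)=(1+x_1)^2$, $x=(x_1,\dots,x_d)\in\mathbb{S}^{d-1}$. Then the support $S_Q$ of the extremal measure $\mu_Q$ is a spherical cap $C_{S,\alpha}$ centered at the South Pole, with $\alpha=\alpha_0\in(0,\pi)$, where the angle $\alpha_0$ is defined as the unique solution in $(0,\pi)$ of the equation $$\frac{\sqrt\pi\,d(d-2)\,\Gamma(d/2-1)}{2^d(d^2-1)\,\Gamma((d-1)/2)}=\cos^4\Big(\frac\alpha2\Big)\,\mathrm{B}\Big(\cos^2\Big(\frac\alpha2\Big);\frac d2-1,\frac d2\Big)-\mathrm{B}\Big(\cos^2\Big(\frac\alpha2\Big);\frac d2+1,\frac d2\Big).$$ Let $$\begin{aligned}F(\eta)=-\frac{2\,\Gamma((d+3)/2)}{d(d-2)\pi^{(d+1)/2}}\Big\{&\Big(\frac{1-\cos\alpha_0}{1-\cos\eta}\Big)^{d/2}\sqrt{\frac{1-\cos\eta}{\cos\alpha_0-\cos\eta}}\,(1+\cos\alpha_0)^2\\&+2(d-1)\,\mathrm{B}\Big(\frac{\cos\alpha_0-\cos\eta}{1-\cos\eta};\frac12,\frac d2\Big)\\&-2(d+1)(1-\cos\eta)\,\mathrm{B}\Big(\frac{\cos\alpha_0-\cos\eta}{1-\cos\eta};\frac12,\frac d2+1\Big)\\&+\frac{d+3}{2}(1-\cos\eta)^2\,\mathrm{B}\Big(\frac{\cos\alpha_0-\cos\eta}{1-\cos\eta};\frac12,\frac d2+2\Big)\Big\},\qquad\alpha_0\le\eta\le\pi,\end{aligned}$$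 and $$C_Q=\frac{\Gamma(d/2-1)}{2^{d-1}\pi^{d/2}}\Big(\mathrm{B}\Big(\cos^2\Big(\frac{\alpha_0}{2}\Big);\frac{d-2}{2},\frac d2\Big)\Big)^{-1}\Big\{1+\frac{2^d\,\Gamma((d+3)/2)}{\sqrt\pi\,\Gamma(d/2+1)}\,\mathrm{B}\Big(\cos^2\Big(\frac{\alpha_0}{2}\Big);\frac d2+1,\frac d2\Big)\Big\}.$$ The density $f$ of the equilibrium measure $\mu_Q$ (that is, $d\mu_Q=f\,d\sigma_d$ with $f$ a function of the polar angle $\eta$) is given by $$f(\eta)=C_Q\Big(\frac{1-\cos\alpha_0}{1-\cos\eta}\Big)^{(d-1)/2}\sqrt{\frac{1-\cos\alpha_0}{\cos\alpha_0-\cos\eta}}\;{}_2F_1\Big(1,\frac{d-1}{2};\frac12;\frac{\cos\alpha_0-\cos\eta}{1-\cos\eta}\Big)+F(\eta),\qquad\alpha_0\le\eta\le\pi.$$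
   Context: $\mathbb{S}^{d-1}=\{x\in\mathbb{R}^d:|x|=1\}$, $d\ge3$, with Lebesgue surface measure $\sigma_d$. For $x=(x_1,\dots,x_d)\in\mathbb{S}^{d-1}$ the polar angle $\eta\in[0,\pi]$ is defined by $x_1=\cos\eta$; the South Pole is $(-1,0,\dots,0)$. $C_{S,\alpha}$ is the set of points of $\mathbb{S}^{d-1}$ with polar angle in $[\alpha,\pi]$. For a unit positive Borel measure $\mu$ on $\mathbb{S}^{d-1}$ put $$I(\mu)=\iint\frac{1}{|x-y|^{d-2}}\,d\mu(x)\,d\mu(y),\qquad I_Q(\mu)=I(\mu)+2\int Q\,d\mu,$$ and $V_Q=\inf\{I_Q(\mu)\}$ over all unit positive Borel measures $\mu$ on $\mathbb{S}^{d-1}$. The extremal (or equilibrium) measure $\mu_Q$ is the unit positive Borel measure on $\mathbb{S}^{d-1}$ with $I_Q(\mu_Q)=V_Q$, and $S_Q=\operatorname{supp}\mu_Q$. Incomplete Beta function: $\mathrm{B}(z;a,b)=\int_0^z t^{a-1}(1-t)^{b-1}\,dt$. Gauss hypergeometric function: ${}_2F_1(a,b;c;z)=\sum_{n\ge0}\frac{(a)_n(b)_n}{(c)_n}\frac{z^n}{n!}$ for $|z|<1$, with $(a)_0=1$, $(a)_n=a(a+1)\cdots(a+n-1)$. As usual, formulas for densities are understood almost everywhere. *)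

theory Defs
  imports "HOL-Probability.Probability"
begin

text \<open>The unnormalized surface measure: \<open>\<sigma>(A) = d * \<lambda>{x. 0 < |x| \<le> 1 \<and> x/|x| \<in> A}\<close>, the measure
  for which integration in polar coordinates reads \<open>dx = r^(d-1) dr d\<sigma>\<close>. Here \<open>sgn x = x/|x|\<close>.\<close>

definition sphere_measure :: "'a::euclidean_space measure" where
  "sphere_measure =
     scale_measure (of_nat DIM('a))
       (distr (restrict_space lborel (cball 0 1 - {0})) (restrict_space borel (sphere 0 1)) sgn)"

definition unit_measures :: "'a::euclidean_space measure set" where
  "unit_measures = {\<mu>. prob_space \<mu> \<and> sets \<mu> = sets (restrict_space borel (sphere 0 1))}"

text \<open>The kernel is taken in \<open>ennreal\<close>, so it is infinite on the diagonal (\<open>inverse 0 = \<infinity>\<close>, unlike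
  for \<open>real\<close>); in particular measures with atoms have infinite energy.\<close>

definition energy :: "'a::euclidean_space measure \<Rightarrow> ennreal" where
  "energy \<mu> = (\<integral>\<^sup>+ x. (\<integral>\<^sup>+ y. inverse (ennreal (norm (x - y) ^ (DIM('a) - 2))) \<partial>\<mu>) \<partial>\<mu>)"

definition weighted_energy :: "('a::euclidean_space \<Rightarrow> real) \<Rightarrow> 'a measure \<Rightarrow> ereal" where
  "weighted_energy Q \<mu> = enn2ereal (energy \<mu>) + ereal (2 * (\<integral> x. Q x \<partial>\<mu>))"

definition min_energy :: "('a::euclidean_space \<Rightarrow> real) \<Rightarrow> ereal" where
  "min_energy Q = (INF \<mu>\<in>unit_measures. weighted_energy Q \<mu>)"

definition is_extremal :: "('a::euclidean_space \<Rightarrow> real) \<Rightarrow> 'a measure \<Rightarrow> bool" where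
  "is_extremal Q \<mu> \<longleftrightarrow> \<mu> \<in> unit_measures \<and> weighted_energy Q \<mu> = min_energy Q"

definition extremal_measure :: "('a::euclidean_space \<Rightarrow> real) \<Rightarrow> 'a measure" where
  "extremal_measure Q = (THE \<mu>. is_extremal Q \<mu>)"

definition supp :: "'a::topological_space measure \<Rightarrow> 'a set" where
  "supp \<mu> = {x \<in> space \<mu>. \<forall>U. open U \<and> x \<in> U \<longrightarrow> emeasure \<mu> (U \<inter> space \<mu>) > 0}"

text \<open>\<open>d\<mu> = f d\<nu>\<close> for real-valued \<open>f\<close>. Nonnegativity is demanded separately because \<open>ennreal\<close>
  truncates negative values to \<open>0\<close>.\<close>

definition has_density :: "'a measure \<Rightarrow> 'a measure \<Rightarrow> ('a \<Rightarrow> real) \<Rightarrow> bool" where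
  "has_density \<mu> \<nu> f \<longleftrightarrow>
     f \<in> borel_measurable \<nu> \<and> (AE x in \<nu>. 0 \<le> f x) \<and> \<mu> = density \<nu> (\<lambda>x. ennreal (f x))"

text \<open>The coordinate \<open>k\<close> plays the role of \<open>x\<^sub>1\<close>.\<close>

definition polar_angle :: "'n::finite \<Rightarrow> real ^ 'n \<Rightarrow> real" where
  "polar_angle k x = arccos (x $ k)"

definition south_cap :: "'n::finite \<Rightarrow> real \<Rightarrow> (real ^ 'n) set" where
  "south_cap k \<alpha> = {x \<in> sphere 0 1. polar_angle k x \<in> {\<alpha>..pi}}"

definition inc_beta :: "real \<Rightarrow> real \<Rightarrow> real \<Rightarrow> real" where
  "inc_beta z a b = integral {0..z} (\<lambda>t. t powr (a - 1) * (1 - t) powr (b - 1))"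

definition hyp2F1 :: "real \<Rightarrow> real \<Rightarrow> real \<Rightarrow> real \<Rightarrow> real" where
  "hyp2F1 a b c z = (\<Sum>n. pochhammer a n * pochhammer b n / pochhammer c n * z ^ n / fact n)"

definition angle_equation :: "nat \<Rightarrow> real \<Rightarrow> bool" where
  "angle_equation d \<alpha> \<longleftrightarrow>
     sqrt pi * d * (real d - 2) * Gamma (d / 2 - 1)
       / (2 ^ d * ((real d)\<^sup>2 - 1) * Gamma ((real d - 1) / 2))
     = cos (\<alpha> / 2) ^ 4 * inc_beta ((cos (\<alpha> / 2))\<^sup>2) (d / 2 - 1) (d / 2)
       - inc_beta ((cos (\<alpha> / 2))\<^sup>2) (d / 2 + 1) (d / 2)"

definition alpha0 :: "nat \<Rightarrow> real" where
  "alpha0 d = (THE \<alpha>. \<alpha> \<in> {0<..<pi} \<and> angle_equation d \<alpha>)"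

definition F_term :: "nat \<Rightarrow> real \<Rightarrow> real" where
  "F_term d \<eta> =
     (let \<alpha> = alpha0 d; z = (cos \<alpha> - cos \<eta>) / (1 - cos \<eta>)
      in - (2 * Gamma ((real d + 3) / 2) / (d * (real d - 2) * pi powr ((real d + 1) / 2))) *
         (((1 - cos \<alpha>) / (1 - cos \<eta>)) powr (d / 2)
            * sqrt ((1 - cos \<eta>) / (cos \<alpha> - cos \<eta>)) * (1 + cos \<alpha>)\<^sup>2
          + 2 * (real d - 1) * inc_beta z (1 / 2) (d / 2)
          - 2 * (real d + 1) * (1 - cos \<eta>) * inc_beta z (1 / 2) (d / 2 + 1)
          + (real d + 3) / 2 * (1 - cos \<eta>)\<^sup>2 * inc_beta z (1 / 2) (d / 2 + 2)))"

definition C_const :: "nat \<Rightarrow> real" where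
  "C_const d =
     (let c = (cos (alpha0 d / 2))\<^sup>2
      in Gamma (d / 2 - 1) / (2 ^ (d - 1) * pi powr (d / 2))
         * inverse (inc_beta c ((real d - 2) / 2) (d / 2))
         * (1 + 2 ^ d * Gamma ((real d + 3) / 2) / (sqrt pi * Gamma (d / 2 + 1))
                * inc_beta c (d / 2 + 1) (d / 2)))"

definition eq_density :: "nat \<Rightarrow> real \<Rightarrow> real" where
  "eq_density d \<eta> =
     (let \<alpha> = alpha0 d
      in C_const d * ((1 - cos \<alpha>) / (1 - cos \<eta>)) powr ((real d - 1) / 2)
           * sqrt ((1 - cos \<alpha>) / (cos \<alpha> - cos \<eta>))
           * hyp2F1 1 ((real d - 1) / 2) (1 / 2) ((cos \<alpha> - cos \<eta>) / (1 - cos \<eta>))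
         + F_term d \<eta>)"

end

theory Submission
  imports Defs
begin

text \<open>Write \<open>q = (1 + x $ k) / 2\<close> for the height of a point. Copson's substitution turns the average
  of the Newtonian kernel over the rotations about the axis, for points of heights \<open>p\<close> and \<open>q\<close>, into
  an integral over \<open>0 < t < min p q\<close> of \<open>1 / (sqrt (p - t) * sqrt (q - t))\<close> times powers of \<open>t\<close> and \<open>1 - t\<close>,
  so that the potential of a zonal density is a composition of two Abel transforms. For the field
  \<open>4 * q\<^sup>2\<close> on a cap \<open>q \<le> z\<close> the intermediate function is a constant multiple of
  \<open>(1 - t) powr (d / 2 - 1) * (z\<^sup>2 - t\<^sup>2)\<close>; its Abel inverse is positive and expressed by incomplete
  Beta functions, and unit total mass is the equation for the angle.
  The weighted potential is then constant on the cap and at least as large outside.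
  The kernel is a power series with nonnegative coefficients in \<open>(1 + x \<bullet> y) / 2\<close>, whose powers
  are sums of products of monomials: this gives positive definiteness, and thereby minimality and,
  since moments determine measures on the sphere, uniqueness.\<close>

section \<open>Integration over the sphere\<close>

text \<open>With k = d/2 - 2 and the powers of 1 - t cancelled, the outer Abel transform is diagonal
  on powers: integrating t powr (k + j) / sqrt (p - t) over 0 < t < p gives Beta (k + j + 1) (1/2)
  times p powr (k + 1/2 + j), and the averaged kernel carries the factor p powr (-(k + 1/2)). So a
  quadratic field calls for a quadratic polynomial in t. Its leading coefficient is forced by the
  field and fixes \<open>density_const\<close>; the constant term is free, and making the polynomial
  vanish at t = z does two things. The Abel inverse gets no boundary term, so the density has no
  inverse square root singularity at the rim of the cap; and cutting the polynomial off at 0 beyond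
  z can only raise the potential, which is the inequality off the cap. In the stated formula both
  summands are singular at the rim, and \<open>C_const\<close> is exactly the value for which the
  singular parts cancel. Finite energy excludes atoms, so the two poles, where the substitution
  degenerates, can be discarded. Working in \<open>ennreal\<close> lets integrals be exchanged
  without integrability and admits the infinite diagonal of the kernel.\<close>

text \<open>Change of variables for absolute integrals transfers absolute integrability both ways
  along \<open>g\<close>. If it holds, the two integrals are real and equal; if it fails, a
  nonnegative integrand has infinite integral on both sides.\<close>

lemma nn_integral_subst_real:
  fixes g g' f :: "real \<Rightarrow> real"
  assumes [measurable]: "S \<in> sets borel" "g \<in> borel_measurable borel" "g' \<in> borel_measurable borel"
    "f \<in> borel_measurable borel" "T \<in> sets borel"
    and f0: "\<And>y. 0 \<le> f y"
    and der: "\<And>x. x \<in> S \<Longrightarrow> (g has_field_derivative g' x) (at x within S)"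
    and bij: "bij_betw g S T"
  shows "(\<integral>\<^sup>+y\<in>T. ennreal (f y) \<partial>lborel) = (\<integral>\<^sup>+x\<in>S. ennreal (f (g x)) * ennreal \<bar>g' x\<bar> \<partial>lborel)"
proof -
  have inj: "inj_on g S" and im: "g ` S = T"
    using bij by (auto simp: bij_betw_def)
  have *: "S \<in> sets lebesgue" by simp
  note cv = has_absolute_integral_change_of_variables_1'[OF * der inj, unfolded im, where f=f]
  have eq: "ennreal (f (g x)) * ennreal \<bar>g' x\<bar> = ennreal (\<bar>g' x\<bar> * f (g x))" for x
    using f0 by (simp add: ennreal_mult mult.commute)
  have A: "(\<integral>\<^sup>+x\<in>A. ennreal (h x) \<partial>lborel) = ennreal (integral A h)"
    if "h absolutely_integrable_on A" "\<And>x. 0 \<le> h x" for h :: "real \<Rightarrow> real" and A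
  proof -
    have "(h has_integral integral A h) A"
      using that(1) set_lebesgue_integral_eq_integral(1) by blast
    moreover have "ennreal (h x) * indicator A x = ennreal (h x * indicat_real A x)" for x
      by (simp add: indicator_def)
    ultimately show ?thesis
      using nn_integral_has_integral_lebesgue[of A h] that(2) by (simp add: mult.commute)
  qed
  have B: "h absolutely_integrable_on A" if "(\<integral>\<^sup>+x\<in>A. ennreal (h x) \<partial>lborel) < \<infinity>" "\<And>x. 0 \<le> h x"
    and [measurable]: "A \<in> sets borel" "h \<in> borel_measurable borel" for h :: "real \<Rightarrow> real" and A
  proof -
    have "set_integrable lborel A h"
      unfolding set_integrable_def
    proof (rule integrableI_bounded)
      show "(\<integral>\<^sup>+ x. ennreal (norm (indicat_real A x *\<^sub>R h x)) \<partial>lborel) < \<infinity>"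
        using that(1) by (simp add: that(2) abs_mult ennreal_mult ennreal_indicator mult.commute)
    qed simp
    then show ?thesis by (simp add: integrable_completion set_integrable_def)
  qed
  show ?thesis
  proof (cases "f absolutely_integrable_on T")
    case True
    with cv[of "integral T f"] have "(\<lambda>x. \<bar>g' x\<bar> * f (g x)) absolutely_integrable_on S"
      "integral S (\<lambda>x. \<bar>g' x\<bar> * f (g x)) = integral T f" by auto
    with True show ?thesis
      by (simp add: eq A f0)
  next
    case False
    with cv have "\<not> (\<lambda>x. \<bar>g' x\<bar> * f (g x)) absolutely_integrable_on S" by auto
    with B[where A=S and h="\<lambda>x. \<bar>g' x\<bar> * f (g x)"] B[where A=T and h=f] False f0
    have "\<not> (\<integral>\<^sup>+x\<in>T. ennreal (f x) \<partial>lborel) < \<infinity>"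
      "\<not> (\<integral>\<^sup>+x\<in>S. ennreal (\<bar>g' x\<bar> * f (g x)) \<partial>lborel) < \<infinity>" by auto
    then show ?thesis by (simp add: eq less_top[symmetric])
  qed
qed

text \<open>Monotone approximation starting from indicator functions. Values in
  \<open>ennreal\<close> matter because the integrands met on the sphere contain the kernel and
  extended-valued weights.\<close>

lemma nn_integral_subst:
  fixes g g' :: "real \<Rightarrow> real" and f :: "real \<Rightarrow> ennreal"
  assumes [measurable]: "S \<in> sets borel" "g \<in> borel_measurable borel" "g' \<in> borel_measurable borel"
    "f \<in> borel_measurable borel" "T \<in> sets borel"
    and der: "\<And>x. x \<in> S \<Longrightarrow> (g has_field_derivative g' x) (at x within S)"
    and bij: "bij_betw g S T"
  shows "(\<integral>\<^sup>+y\<in>T. f y \<partial>lborel) = (\<integral>\<^sup>+x\<in>S. f (g x) * ennreal \<bar>g' x\<bar> \<partial>lborel)"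
  using \<open>f \<in> borel_measurable borel\<close>
proof (induction f rule: borel_measurable_induct)
  case (cong f g)
  then show ?case by simp
next
  case (set A)
  then have [measurable]: "A \<in> sets borel" by simp
  show ?case
    using nn_integral_subst_real[where f="indicator A", OF assms(1,2,3) _ assms(5) _ der bij]
    by (simp add: ennreal_indicator)
next
  case (mult u c)
  then have [measurable]: "u \<in> borel_measurable borel" by simp
  show ?case using mult by (simp add: mult.assoc nn_integral_cmult)
next
  case (add u v)
  then have [measurable]: "u \<in> borel_measurable borel" "v \<in> borel_measurable borel" by simp_all
  show ?case using add by (simp add: distrib_right nn_integral_add)
next
  case (seq U)
  have [measurable]: "\<And>i. U i \<in> borel_measurable borel" using seq by simp
  have i1: "incseq (\<lambda>i x. U i x * indicator T x)"
    using seq(3) by (auto simp: incseq_def le_fun_def intro!: mult_right_mono)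
  have i2: "incseq (\<lambda>i x. U i (g x) * ennreal \<bar>g' x\<bar> * indicator S x)"
    using seq(3) by (auto simp: incseq_def le_fun_def intro!: mult_right_mono)
  have "(\<integral>\<^sup>+y\<in>T. (SUP i. U i) y \<partial>lborel) = (\<integral>\<^sup>+y. (SUP i. U i y * indicator T y) \<partial>lborel)"
    by (simp add: image_comp SUP_mult_right_ennreal)
  also have "\<dots> = (SUP i. \<integral>\<^sup>+y\<in>T. U i y \<partial>lborel)"
    by (rule nn_integral_monotone_convergence_SUP[OF i1]) simp
  also have "\<dots> = (SUP i. \<integral>\<^sup>+x\<in>S. U i (g x) * ennreal \<bar>g' x\<bar> \<partial>lborel)"
    using seq.IH by simp
  also have "\<dots> = (\<integral>\<^sup>+x. (SUP i. U i (g x) * ennreal \<bar>g' x\<bar> * indicator S x) \<partial>lborel)"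
    by (rule nn_integral_monotone_convergence_SUP[OF i2, symmetric]) simp
  also have "\<dots> = (\<integral>\<^sup>+x\<in>S. (SUP i. U i) (g x) * ennreal \<bar>g' x\<bar> \<partial>lborel)"
    by (simp add: image_comp SUP_mult_right_ennreal)
  finally show ?case by (simp add: image_comp)
qed

section \<open>Rotation invariance of Lebesgue measure\<close>

text \<open>Uniqueness of translation invariant measures: for the image \<open>M\<close> of Lebesgue
  measure, the double integral of 1_A(x) 1_B(x + y) over dM(x) dy is evaluated in both orders,
  giving M(A) |B| = |A| M(B). For B the unit ball, M(B) = |B|.\<close>

lemma distr_lborel_orthogonal:
  fixes R :: "'a::euclidean_space \<Rightarrow> 'a"
  assumes lin: "linear R" and nR: "\<And>x. norm (R x) = norm x"
  shows "distr lborel borel R = lborel"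
proof -
  have R_eq: "orthogonal_transformation R"
    using assms by (simp add: orthogonal_transformation)
  have [measurable]: "R \<in> borel_measurable borel"
    using lin linear_continuous_on linear_conv_bounded_linear borel_measurable_continuous_onI by blast
  define M where "M = distr lborel borel R"
  have sM[measurable_cong, simp]: "sets M = sets borel" by (simp add: M_def)
  have tr: "distr M borel (\<lambda>x. x + t) = M" for t
  proof -
    obtain s where s: "R s = t"
      using orthogonal_transformation_surj[OF R_eq] by (metis surjD)
    have "distr M borel (\<lambda>x. x + t) = distr lborel borel (\<lambda>x. R (x + s))"
      unfolding M_def by (subst distr_distr) (auto simp: o_def linear_add[OF lin] s)
    also have "\<dots> = distr (distr lborel borel (\<lambda>x. s + x)) borel R"
      by (subst distr_distr) (auto simp: o_def add.commute)
    also have "\<dots> = M"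
      by (simp add: lborel_distr_plus M_def)
    finally show ?thesis .
  qed
  have neg: "(\<integral>\<^sup>+ y. f (x - y) \<partial>lborel) = (\<integral>\<^sup>+ y. f y \<partial>lborel)"
    if [measurable]: "f \<in> borel_measurable borel" for f :: "'a \<Rightarrow> ennreal" and x
    by (subst (2) lborel_affine[of "-1" x]) (simp_all add: nn_integral_density nn_integral_distr)
  have trl: "(\<integral>\<^sup>+ y. f (x + y) \<partial>lborel) = (\<integral>\<^sup>+ y. f y \<partial>lborel)"
    if [measurable]: "f \<in> borel_measurable borel" for f :: "'a \<Rightarrow> ennreal" and x
    by (subst (2) lborel_distr_plus[of x, symmetric]) (simp_all add: nn_integral_distr)
  have trM: "(\<integral>\<^sup>+ y. f (y + x) \<partial>M) = (\<integral>\<^sup>+ y. f y \<partial>M)"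
    if [measurable]: "f \<in> borel_measurable borel" for f :: "'a \<Rightarrow> ennreal" and x
    by (subst (2) tr[of x, symmetric]) (simp_all add: nn_integral_distr)
  \<comment> \<open>Balls about the origin are preserved by a linear isometry. They also exhaust the
    space, which makes \<open>M\<close> sigma-finite and the exchange of integrals
    legitimate.\<close>
  have MB: "emeasure M (cball 0 r) = emeasure lborel (cball (0::'a) r)" for r
  proof -
    have "R -` cball 0 r = cball 0 r" by (auto simp: nR)
    then show ?thesis by (simp add: M_def emeasure_distr)
  qed
  have sf: "sigma_finite_measure M"
  proof
    show "\<exists>A. countable A \<and> A \<subseteq> sets M \<and> \<Union> A = space M \<and> (\<forall>a\<in>A. emeasure M a \<noteq> \<infinity>)"
    proof (intro exI conjI)
      show "countable (range (\<lambda>n::nat. cball (0::'a) n))" by simp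
      show "\<Union> (range (\<lambda>n::nat. cball (0::'a) n)) = space M"
        by (auto simp: M_def real_arch_simple)
      show "\<forall>a\<in>range (\<lambda>n::nat. cball (0::'a) n). emeasure M a \<noteq> \<infinity>"
        using emeasure_lborel_cball_finite by (auto simp: MB less_top)
    qed auto
  qed
  interpret pair_sigma_finite lborel M
    using sf by (simp add: pair_sigma_finite_def lborel.sigma_finite_measure_axioms)
  have "emeasure M A = emeasure lborel A" if A[measurable]: "A \<in> sets borel" for A
  proof -
    let ?B = "cball (0::'a) 1"
    have [measurable]: "?B \<in> sets borel" by simp
    have "emeasure M A * emeasure lborel ?B = (\<integral>\<^sup>+x. \<integral>\<^sup>+y. indicator A x * indicator ?B y \<partial>lborel \<partial>M)"
      by (simp add: nn_integral_cmult nn_integral_multc)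
    also have "\<dots> = (\<integral>\<^sup>+x. \<integral>\<^sup>+y. indicator A x * indicator ?B (x + y) \<partial>lborel \<partial>M)"
      by (rule nn_integral_cong) (subst (1 2) nn_integral_cmult, simp_all add: trl[of "indicator ?B"])
    also have "\<dots> = (\<integral>\<^sup>+y. \<integral>\<^sup>+x. indicator A x * indicator ?B (x + y) \<partial>M \<partial>lborel)"
      by (rule Fubini') measurable
    also have "\<dots> = (\<integral>\<^sup>+y. \<integral>\<^sup>+x. indicator A (x - y) * indicator ?B x \<partial>M \<partial>lborel)"
    proof (rule nn_integral_cong)
      fix y :: 'a
      show "(\<integral>\<^sup>+ x. indicator A x * indicator ?B (x + y) \<partial>M) = (\<integral>\<^sup>+ x. indicator A (x - y) * indicator ?B x \<partial>M)"
        using trM[of "\<lambda>x. indicator A (x - y) * indicator ?B x" y] by simp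
    qed
    also have "\<dots> = (\<integral>\<^sup>+x. \<integral>\<^sup>+y. indicator A (x - y) * indicator ?B x \<partial>lborel \<partial>M)"
      by (rule Fubini'[symmetric]) measurable
    also have "\<dots> = (\<integral>\<^sup>+x. \<integral>\<^sup>+y. indicator A y * indicator ?B x \<partial>lborel \<partial>M)"
      by (rule nn_integral_cong) (subst (1 2) nn_integral_multc, simp_all add: neg[of "indicator A"])
    also have "\<dots> = emeasure lborel A * emeasure lborel ?B"
      by (simp add: nn_integral_multc nn_integral_cmult MB)
    finally have "emeasure M A * emeasure lborel ?B = emeasure lborel A * emeasure lborel ?B" .
    moreover have "emeasure lborel ?B < \<infinity>" by (rule emeasure_lborel_cball_finite)
    moreover have "emeasure lborel ?B > 0"
      by (simp add: emeasure_cball)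
    ultimately show ?thesis
      by (metis ennreal_mult_cancel_left less_irrefl infinity_ennreal_def mult.commute)
  qed
  then show ?thesis unfolding M_def[symmetric] by (intro measure_eqI) auto
qed

section \<open>Polar coordinates and the joint law of two coordinates\<close>

lemma nn_integral_power_Ioc:
  assumes "0 \<le> (a::real)"
  shows "(\<integral>\<^sup>+r\<in>{0<..a}. ennreal (real (Suc n) * r ^ n) \<partial>lborel) = ennreal (a ^ Suc n)"
proof -
  have "((\<lambda>r. real (Suc n) * r ^ n) has_integral a ^ Suc n - 0 ^ Suc n) {0..a}"
    by (rule fundamental_theorem_of_calculus)
       (use assms in \<open>auto simp del: power_Suc of_nat_Suc simp flip: has_real_derivative_iff_has_vector_derivative intro!: derivative_eq_intros\<close>)
  from nn_integral_has_integral_lebesgue[OF _ this]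
  have "(\<integral>\<^sup>+r. ennreal (indicator {0..a} r * (real (Suc n) * r ^ n)) \<partial>lborel) = ennreal (a ^ Suc n)"
    by (simp add: mult.commute)
  also have "(\<integral>\<^sup>+r. ennreal (indicator {0..a} r * (real (Suc n) * r ^ n)) \<partial>lborel)
     = (\<integral>\<^sup>+r\<in>{0<..a}. ennreal (real (Suc n) * r ^ n) \<partial>lborel)"
    by (rule nn_integral_cong_AE, rule AE_mp[OF AE_lborel_singleton[of 0]])
       (auto simp: indicator_def)
  finally show ?thesis .
qed

text \<open>The law of the Euclidean norm in dimension m + 1 is determined by its values on
  half-lines, which are ball volumes; the density is the derivative of the volume of the ball of
  radius r. The index set is arbitrary because it will be the basis without two of its
  vectors.\<close>

lemma nn_integral_PiM_radial:
  fixes \<phi> :: "real \<Rightarrow> ennreal"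
  assumes I: "finite I" "card I = Suc m" and [measurable]: "\<phi> \<in> borel_measurable borel"
  shows "(\<integral>\<^sup>+x. \<phi> (sqrt (\<Sum>i\<in>I. (x i)\<^sup>2)) \<partial>Pi\<^sub>M I (\<lambda>_. lborel)) =
    ennreal (unit_ball_vol (Suc m)) * (\<integral>\<^sup>+r\<in>{0<..}. \<phi> r * ennreal (real (Suc m) * r ^ m) \<partial>lborel)"
proof -
  let ?P = "Pi\<^sub>M I (\<lambda>_. lborel :: real measure)"
  let ?v = "unit_ball_vol (Suc m)"
  define M1 where "M1 = distr ?P borel (\<lambda>x. sqrt (\<Sum>i\<in>I. (x i)\<^sup>2))"
  define M2 where "M2 = density lborel (\<lambda>r. ennreal (?v * (real (Suc m) * r ^ m)) * indicator {0<..} r)"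
  have v0: "?v \<ge> 0" by simp
  have s1[simp, measurable_cong]: "sets M1 = sets borel" "sets M2 = sets borel"
    by (simp_all add: M1_def M2_def)
  have e1: "emeasure M1 {..a} = ennreal (?v * max 0 a ^ Suc m)" for a
  proof -
    have pos: "emeasure M1 {..a} = ennreal (?v * a ^ Suc m)" if "a > 0" for a
    proof -
      have "emeasure M1 {..a} = emeasure ?P ({f. sqrt (\<Sum>i\<in>I. (f i)\<^sup>2) \<le> a} \<inter> space ?P)"
        unfolding M1_def by (subst emeasure_distr) (auto simp: vimage_def)
      also have "\<dots> = ennreal (?v * a ^ Suc m)"
        using emeasure_cball_aux[OF I(1) that] by (simp add: I(2))
      finally show ?thesis .
    qed
    show ?thesis
    proof (cases "a > 0")
      case True then show ?thesis by (simp add: pos)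
    next
      case False
      \<comment> \<open>Ball volumes enter for positive radius only; for a \<le> 0 the value 0 comes
        from letting the radius tend to 0.\<close>
      have "((\<lambda>x. ennreal (?v * x ^ Suc m)) \<longlongrightarrow> ennreal (?v * 0 ^ Suc m)) (at_right 0)"
        by (intro tendsto_intros)
      moreover have "eventually (\<lambda>x. emeasure M1 {..a} \<le> ennreal (?v * x ^ Suc m)) (at_right 0)"
        unfolding eventually_at_right_field
        by (rule exI[of _ 1])
           (use False in \<open>auto simp: pos[symmetric] simp del: power_Suc of_nat_Suc intro!: emeasure_mono\<close>)
      ultimately have "emeasure M1 {..a} \<le> 0"
        by (intro tendsto_lowerbound[where F="at_right 0"]) (auto simp: )
      with False show ?thesis by (simp add: max_def)
    qed
  qed
  have e2: "emeasure M2 {..a} = ennreal (?v * max 0 a ^ Suc m)" for a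
  proof -
    have "emeasure M2 {..a} = (\<integral>\<^sup>+r. ennreal ?v * (ennreal (real (Suc m) * r ^ m) * indicator {0<..max 0 a} r) \<partial>lborel)"
      unfolding M2_def by (subst emeasure_density)
        (auto intro!: nn_integral_cong simp: indicator_def ennreal_mult split: if_splits)
    also have "\<dots> = ennreal (?v * max 0 a ^ Suc m)"
      by (subst nn_integral_cmult)
         (simp_all add: nn_integral_power_Ioc ennreal_mult del: power_Suc of_nat_Suc)
    finally show ?thesis .
  qed
  have "M1 = M2"
  proof (rule measure_eqI_generator_eq[where \<Omega>=UNIV and E="range atMost" and A="\<lambda>n::nat. {..real n}"])
    show "Int_stable (range atMost :: real set set)"
      by (auto simp: Int_stable_def)
    show "\<And>X. X \<in> range atMost \<Longrightarrow> emeasure M1 X = emeasure M2 X"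
      by (auto simp: e1 e2)
    show "sets M1 = sigma_sets UNIV (range atMost)" "sets M2 = sigma_sets UNIV (range atMost)"
      by (simp_all add: borel_eq_atMost)
    show "(\<Union>n::nat. {..real n}) = UNIV" using real_arch_simple by auto
  qed (auto simp: e1)
  have "(\<integral>\<^sup>+x. \<phi> (sqrt (\<Sum>i\<in>I. (x i)\<^sup>2)) \<partial>?P) = (\<integral>\<^sup>+r. \<phi> r \<partial>M1)"
    by (simp add: M1_def nn_integral_distr)
  also have "\<dots> = (\<integral>\<^sup>+r. ennreal ?v * (\<phi> r * ennreal (real (Suc m) * r ^ m) * indicator {0<..} r) \<partial>lborel)"
    unfolding \<open>M1 = M2\<close> M2_def
    by (subst nn_integral_density) (auto intro!: nn_integral_cong simp: indicator_def ennreal_mult ac_simps)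
  finally show ?thesis by (simp add: nn_integral_cmult)
qed

lemma nn_integral_sphere_measure:
  fixes g :: "'a::euclidean_space \<Rightarrow> ennreal"
  assumes [measurable]: "g \<in> borel_measurable borel"
  shows "(\<integral>\<^sup>+x. g x \<partial>sphere_measure) = of_nat DIM('a) * (\<integral>\<^sup>+x\<in>cball 0 1 - {0}. g (sgn x) \<partial>lborel)"
proof -
  have [measurable]: "sgn \<in> restrict_space lborel (cball 0 1 - {0::'a}) \<rightarrow>\<^sub>M restrict_space borel (sphere 0 1)"
  proof (rule measurable_restrict_space2)
    show "sgn \<in> space (restrict_space lborel (cball 0 1 - {0::'a})) \<rightarrow> sphere 0 1"
      by (auto simp: space_restrict_space norm_sgn)
    have "(\<lambda>x::'a. inverse (norm x) *\<^sub>R x) \<in> borel_measurable borel" by measurable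
    then show "sgn \<in> borel_measurable (restrict_space lborel (cball 0 1 - {0::'a}))"
      by (simp add: sgn_div_norm[abs_def] measurable_restrict_space1)
  qed
  have "g \<in> borel_measurable (restrict_space borel (sphere 0 1))"
    by (simp add: measurable_restrict_space1)
  then show ?thesis
    unfolding sphere_measure_def
    by (simp add: nn_integral_scale_measure nn_integral_distr nn_integral_restrict_space)
qed

lemma measurable_compose3:
  assumes "(\<lambda>(a,b,c). H a b c) \<in> A \<Otimes>\<^sub>M B \<Otimes>\<^sub>M C \<rightarrow>\<^sub>M D"
    and "f \<in> M \<rightarrow>\<^sub>M A" "g \<in> M \<rightarrow>\<^sub>M B" "h \<in> M \<rightarrow>\<^sub>M C"
  shows "(\<lambda>x. H (f x) (g x) (h x)) \<in> M \<rightarrow>\<^sub>M D"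
  using measurable_compose[of "\<lambda>x. (f x, g x, h x)", OF _ assms(1)] assms(2-4) by simp

text \<open>The third argument of \<open>H\<close> is the distance from the plane of the two axes,
  so the other m + 1 coordinates enter only through their norm and Fubini reduces them to a radial
  integral.\<close>

lemma nn_integral_lborel_two_axes:
  fixes e w :: "'a::euclidean_space" and H :: "real \<Rightarrow> real \<Rightarrow> real \<Rightarrow> ennreal"
  assumes ew: "e \<in> Basis" "w \<in> Basis" "e \<noteq> w" and d: "DIM('a) = m + 3"
    and H: "(\<lambda>(a,b,r). H a b r) \<in> borel_measurable (borel \<Otimes>\<^sub>M borel \<Otimes>\<^sub>M borel)"
  shows "(\<integral>\<^sup>+x. H (x \<bullet> e) (x \<bullet> w) (sqrt ((norm x)\<^sup>2 - (x \<bullet> e)\<^sup>2 - (x \<bullet> w)\<^sup>2)) \<partial>(lborel :: 'a measure)) =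
    ennreal (unit_ball_vol (Suc m)) * (\<integral>\<^sup>+r\<in>{0<..}. (\<integral>\<^sup>+b. \<integral>\<^sup>+a. H a b r \<partial>lborel \<partial>lborel)
       * ennreal (real (Suc m) * r ^ m) \<partial>lborel)"
proof -
  note [measurable (raw)] = measurable_compose3[OF H]
  define I where "I = (Basis :: 'a set) - {e, w}"
  have B: "Basis = insert e (insert w I)" and I: "finite I" "e \<notin> I" "w \<notin> I" "e \<notin> insert w I" "w \<noteq> e"
    using ew by (auto simp: I_def)
  have cI: "card I = Suc m"
  proof -
    have "DIM('a) = card (insert e (insert w I))" by (subst B) simp
    then show ?thesis using I d by simp
  qed
  interpret product_sigma_finite "\<lambda>_. lborel :: real measure"
    by standard
  have norm2: "(norm (\<Sum>b\<in>Basis. f b *\<^sub>R b :: 'a))\<^sup>2 = (f e)\<^sup>2 + (f w)\<^sup>2 + (\<Sum>i\<in>I. (f i)\<^sup>2)" for f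
  proof -
    have "(norm (\<Sum>b\<in>Basis. f b *\<^sub>R b :: 'a))\<^sup>2 = (\<Sum>b\<in>Basis. (f b)\<^sup>2)"
      unfolding norm_eq_sqrt_inner
      by (subst euclidean_inner) (simp add: power2_eq_square sum_nonneg)
    also have "\<dots> = (f e)\<^sup>2 + (f w)\<^sup>2 + (\<Sum>i\<in>I. (f i)\<^sup>2)"
      unfolding B using I by simp
    finally show ?thesis .
  qed
  have "(\<integral>\<^sup>+x. H (x \<bullet> e) (x \<bullet> w) (sqrt ((norm x)\<^sup>2 - (x \<bullet> e)\<^sup>2 - (x \<bullet> w)\<^sup>2)) \<partial>(lborel :: 'a measure))
    = (\<integral>\<^sup>+f. H (f e) (f w) (sqrt (\<Sum>i\<in>I. (f i)\<^sup>2)) \<partial>Pi\<^sub>M Basis (\<lambda>_. lborel))"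
  proof -
    have [measurable]: "(\<lambda>x. H (x \<bullet> e) (x \<bullet> w) (sqrt ((norm x)\<^sup>2 - (x \<bullet> e)\<^sup>2 - (x \<bullet> w)\<^sup>2))) \<in> borel_measurable (borel :: 'a measure)"
      by measurable
    show ?thesis
      by (subst lborel_eq, subst nn_integral_distr) (auto simp: norm2 ew)
  qed
  also have "\<dots> = (\<integral>\<^sup>+x. \<integral>\<^sup>+b. \<integral>\<^sup>+a. H a b (sqrt (\<Sum>i\<in>I. (x i)\<^sup>2)) \<partial>lborel \<partial>lborel \<partial>Pi\<^sub>M I (\<lambda>_. lborel))"
  proof -
    have s: "(\<Sum>i\<in>I. ((x(w := b, e := a)) i)\<^sup>2) = (\<Sum>i\<in>I. (x i)\<^sup>2)" for x :: "'a \<Rightarrow> real" and a b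
      using I by (intro sum.cong) auto
    have s': "(\<Sum>i\<in>I. ((x(e := a)) i)\<^sup>2) = (\<Sum>i\<in>I. (x i)\<^sup>2)" for x :: "'a \<Rightarrow> real" and a
      using I by (intro sum.cong) auto
    have [measurable]: "(\<lambda>x. \<integral>\<^sup>+ a. H a (x w) (sqrt (\<Sum>i\<in>I. (x i)\<^sup>2)) \<partial>lborel)
       \<in> borel_measurable (Pi\<^sub>M (insert w I) (\<lambda>_. lborel))"
      by measurable
    show ?thesis
      unfolding B using I
      apply (subst product_nn_integral_insert)
         apply (simp_all add: s' del: sum.insert fun_upd_apply)
      apply (simp add: fun_upd_def)
      apply (subst product_nn_integral_insert)
         apply (simp_all add: )
      apply (intro nn_integral_cong arg_cong[where f="H _ _"] arg_cong[where f=sqrt] sum.cong)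
       apply auto
      done
  qed
  also have "\<dots> = ennreal (unit_ball_vol (Suc m)) * (\<integral>\<^sup>+r\<in>{0<..}. (\<integral>\<^sup>+b. \<integral>\<^sup>+a. H a b r \<partial>lborel \<partial>lborel)
       * ennreal (real (Suc m) * r ^ m) \<partial>lborel)"
    by (rule nn_integral_PiM_radial[OF I(1) cI]) measurable
  finally show ?thesis .
qed

text \<open>The substitution is b = tan (arcsin v), with inverse v = b / sqrt (1 + b^2) and
  derivative (1 - v^2) powr (-3/2). It turns slopes into sines, that is, into coordinates on the
  unit sphere.\<close>

lemma nn_integral_arctan_type_subst:
  fixes f :: "real \<Rightarrow> ennreal"
  assumes [measurable]: "f \<in> borel_measurable borel"
  shows "(\<integral>\<^sup>+b. f b \<partial>lborel) =
    (\<integral>\<^sup>+v\<in>{-1<..<1}. f (v / sqrt (1 - v\<^sup>2)) * ennreal ((1 - v\<^sup>2) powr (-3/2)) \<partial>lborel)"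
proof -
  have p: "1 - v\<^sup>2 > 0" if "v \<in> {-1<..<1}" for v :: real
    using that by (simp add: abs_square_less_1 abs_less_iff)
  have "(\<integral>\<^sup>+b\<in>UNIV. f b \<partial>lborel) =
    (\<integral>\<^sup>+v\<in>{-1<..<1}. f (v / sqrt (1 - v\<^sup>2)) * ennreal \<bar>(1 - v\<^sup>2) powr (-3/2)\<bar> \<partial>lborel)"
  proof (rule nn_integral_subst)
    fix v :: real assume v: "v \<in> {-1<..<1}"
    have s: "sqrt (1 - v\<^sup>2) = (1 - v\<^sup>2) powr (1/2)" using p[OF v] by (simp add: powr_half_sqrt)
    have "(1 - v\<^sup>2) powr (-3/2) = inverse ((1 - v\<^sup>2) * sqrt (1 - v\<^sup>2))"
    proof -
      have "(1 - v\<^sup>2) powr (-3/2) = (1 - v\<^sup>2) powr - (1 + 1/2)" by simp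
      also have "\<dots> = inverse ((1 - v\<^sup>2) powr 1 * (1 - v\<^sup>2) powr (1/2))"
        by (simp only: powr_minus powr_add)
      finally show ?thesis using p[OF v] by (simp add: s)
    qed
    also have "\<dots> = (sqrt (1 - v\<^sup>2) - v * (- v / sqrt (1 - v\<^sup>2))) / (sqrt (1 - v\<^sup>2))\<^sup>2"
    proof -
      have "sqrt (1 - v\<^sup>2) * sqrt (1 - v\<^sup>2) = 1 - v\<^sup>2" using p[OF v] by simp
      then show ?thesis using p[OF v] by (simp add: field_simps power2_eq_square)
    qed
    finally have e: "(1 - v\<^sup>2) powr (-3/2) = \<dots>" .
    show "((\<lambda>v. v / sqrt (1 - v\<^sup>2)) has_real_derivative (1 - v\<^sup>2) powr (-3/2)) (at v within {-1<..<1})"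
      unfolding e using p[OF v]
      by (auto intro!: derivative_eq_intros simp: field_simps power2_eq_square)
  next
    show "bij_betw (\<lambda>v::real. v / sqrt (1 - v\<^sup>2)) {-1<..<1} UNIV"
    proof (rule bij_betw_byWitness[where f'="\<lambda>b. b / sqrt (1 + b\<^sup>2)"])
      show "\<forall>v\<in>{-1<..<1}. v / sqrt (1 - v\<^sup>2) / sqrt (1 + (v / sqrt (1 - v\<^sup>2))\<^sup>2) = v"
      proof
        fix v :: real assume v: "v \<in> {-1<..<1}"
        have "1 + (v / sqrt (1 - v\<^sup>2))\<^sup>2 = 1 / (1 - v\<^sup>2)" using p[OF v] by (simp add: power_divide field_simps)
        then show "v / sqrt (1 - v\<^sup>2) / sqrt (1 + (v / sqrt (1 - v\<^sup>2))\<^sup>2) = v"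
          using p[OF v] by (simp add: real_sqrt_divide)
      qed
      have q: "1 + b\<^sup>2 > 0" for b :: real by (simp add: add_pos_nonneg)
      show "\<forall>b\<in>UNIV. b / sqrt (1 + b\<^sup>2) / sqrt (1 - (b / sqrt (1 + b\<^sup>2))\<^sup>2) = (b::real)"
      proof
        fix b :: real
        have "1 - (b / sqrt (1 + b\<^sup>2))\<^sup>2 = 1 / (1 + b\<^sup>2)" using q[of b] by (simp add: power_divide field_simps)
        then show "b / sqrt (1 + b\<^sup>2) / sqrt (1 - (b / sqrt (1 + b\<^sup>2))\<^sup>2) = b"
          using q[of b] by (simp add: real_sqrt_divide)
      qed
      show "(\<lambda>b::real. b / sqrt (1 + b\<^sup>2)) ` UNIV \<subseteq> {-1<..<1}"
      proof safe
        fix b :: real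
        have "\<bar>b\<bar> < sqrt (1 + b\<^sup>2)" by (rule real_less_rsqrt) simp
        then show "b / sqrt (1 + b\<^sup>2) \<in> {-1<..<1}"
          using q[of b] by (simp add: field_simps abs_less_iff)
      qed
    qed auto
  qed measurable
  then show ?thesis by simp
qed

lemma nn_integral_scale_subst:
  fixes f :: "real \<Rightarrow> ennreal"
  assumes "f \<in> borel_measurable borel" "c > 0"
  shows "(\<integral>\<^sup>+x. f x \<partial>lborel) = ennreal c * (\<integral>\<^sup>+x. f (c * x) \<partial>lborel)"
  using nn_integral_real_affine[OF assms(1), of c 0] assms(2) by simp

text \<open>In the coordinates y \<bullet> e = u and y \<bullet> w = v * sqrt (1 - u^2) the surface
  measure is a product; the remaining directions contribute the area of the unit sphere of dimension
  m. The integrand is extended to the ball as a function of direction only, the two axis coordinates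
  are scaled by the distance r from their plane, and the integral over r is explicit.\<close>

lemma nn_integral_sphere_axes:
  fixes e w :: "'a::euclidean_space" and G :: "real \<Rightarrow> real \<Rightarrow> ennreal"
  assumes ew: "e \<in> Basis" "w \<in> Basis" "e \<noteq> w" and d: "DIM('a) = m + 3"
    and G: "(\<lambda>(u,s). G u s) \<in> borel_measurable (borel \<Otimes>\<^sub>M borel)"
  shows "(\<integral>\<^sup>+y. G (y \<bullet> e) (y \<bullet> w) \<partial>sphere_measure) =
    ennreal (real (Suc m) * unit_ball_vol (Suc m)) *
     (\<integral>\<^sup>+v\<in>{-1<..<1}. (\<integral>\<^sup>+u\<in>{-1<..<1}. ennreal ((1 - v\<^sup>2) powr ((real m - 1) / 2)) *
        ennreal ((1 - u\<^sup>2) powr (real m / 2)) * G u (v * sqrt (1 - u\<^sup>2)) \<partial>lborel) \<partial>lborel)"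
proof -
  have Gm [measurable (raw)]: "(\<lambda>x. G (f x) (g x)) \<in> borel_measurable M"
    if "f \<in> borel_measurable M" "g \<in> borel_measurable M" for f g and M :: "'c measure"
    using measurable_compose[of "\<lambda>x. (f x, g x)", OF _ G] that by simp
  have [measurable (raw)]: "Measurable.pred M (\<lambda>x. f x \<in> {0<..g x})"
    if "f \<in> borel_measurable M" "g \<in> borel_measurable M" for f g :: "'c \<Rightarrow> real" and M :: "'c measure"
    using that unfolding greaterThanAtMost_iff by measurable
  define R where "R a b r = sqrt (a\<^sup>2 + b\<^sup>2 + r\<^sup>2)" for a b r :: real
  define H where "H a b r = G (a / R a b r) (b / R a b r) * indicator {0<..1} (R a b r)" for a b r
  have Hm: "(\<lambda>(a,b,r). H a b r) \<in> borel_measurable (borel \<Otimes>\<^sub>M borel \<Otimes>\<^sub>M borel)"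
    unfolding H_def R_def by measurable
  note [measurable (raw)] = measurable_compose3[OF Hm]
  let ?c = "unit_ball_vol (Suc m)"
  define A B where "A a = sqrt (1 + a\<^sup>2)" and "B b = sqrt (1 + b\<^sup>2)" for a b :: real
  have [measurable]: "A \<in> borel_measurable borel" "B \<in> borel_measurable borel"
    unfolding A_def[abs_def] B_def[abs_def] by measurable
  have A0: "A a > 0" and B0: "B a > 0" for a by (simp_all add: A_def B_def add_pos_nonneg)
  have "(\<integral>\<^sup>+y. G (y \<bullet> e) (y \<bullet> w) \<partial>(sphere_measure :: 'a measure)) = ennreal (m + 3) *
    (\<integral>\<^sup>+x\<in>cball 0 1 - {0}. G (sgn x \<bullet> e) (sgn x \<bullet> w) \<partial>(lborel :: 'a measure))"
    using d by (subst nn_integral_sphere_measure) (auto simp flip: ennreal_of_nat_eq_real_of_nat)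
  also have "(\<integral>\<^sup>+x\<in>cball 0 1 - {0}. G (sgn x \<bullet> e) (sgn x \<bullet> w) \<partial>(lborel :: 'a measure)) =
     (\<integral>\<^sup>+x. H (x \<bullet> e) (x \<bullet> w) (sqrt ((norm x)\<^sup>2 - (x \<bullet> e)\<^sup>2 - (x \<bullet> w)\<^sup>2)) \<partial>(lborel :: 'a measure))"
  proof (rule nn_integral_cong)
    fix x :: 'a
    have "(x \<bullet> e)\<^sup>2 + (x \<bullet> w)\<^sup>2 = (\<Sum>b\<in>{e,w}. (x \<bullet> b)\<^sup>2)" using ew by simp
    also have "\<dots> \<le> (\<Sum>b\<in>Basis. (x \<bullet> b)\<^sup>2)"
      using ew by (intro sum_mono2) auto
    also have "\<dots> = (norm x)\<^sup>2"
      by (metis (no_types, lifting) euclidean_inner power2_eq_square power2_norm_eq_inner sum.cong)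
    finally have "R (x \<bullet> e) (x \<bullet> w) (sqrt ((norm x)\<^sup>2 - (x \<bullet> e)\<^sup>2 - (x \<bullet> w)\<^sup>2)) = norm x"
      by (simp add: R_def)
    then show "G (sgn x \<bullet> e) (sgn x \<bullet> w) * indicator (cball 0 1 - {0}) x =
      H (x \<bullet> e) (x \<bullet> w) (sqrt ((norm x)\<^sup>2 - (x \<bullet> e)\<^sup>2 - (x \<bullet> w)\<^sup>2))"
      by (simp add: H_def sgn_div_norm divide_inverse mult.commute indicator_def)
  qed
  also have "\<dots> = ennreal ?c * (\<integral>\<^sup>+r\<in>{0<..}. (\<integral>\<^sup>+b. \<integral>\<^sup>+a. H a b r \<partial>lborel \<partial>lborel)
       * ennreal (real (Suc m) * r ^ m) \<partial>lborel)"
    by (rule nn_integral_lborel_two_axes[OF ew d Hm])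
  also have "(\<integral>\<^sup>+r\<in>{0<..}. (\<integral>\<^sup>+b. \<integral>\<^sup>+a. H a b r \<partial>lborel \<partial>lborel) * ennreal (real (Suc m) * r ^ m) \<partial>lborel)
    = (\<integral>\<^sup>+r. \<integral>\<^sup>+b. \<integral>\<^sup>+a. (ennreal (B b) * G (a / A a) (b / (A a * B b)) * ennreal (Suc m)) *
         (ennreal (r ^ (m + 2)) * indicator {0<..1 / (A a * B b)} r) \<partial>lborel \<partial>lborel \<partial>lborel)"
  proof (rule nn_integral_cong)
    fix r :: real
    show "(\<integral>\<^sup>+b. \<integral>\<^sup>+a. H a b r \<partial>lborel \<partial>lborel) * ennreal (real (Suc m) * r ^ m) * indicator {0<..} r
      = (\<integral>\<^sup>+b. \<integral>\<^sup>+a. (ennreal (B b) * G (a / A a) (b / (A a * B b)) * ennreal (Suc m)) *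
         (ennreal (r ^ (m + 2)) * indicator {0<..1 / (A a * B b)} r) \<partial>lborel \<partial>lborel)"
    proof (cases "r > 0")
      case True
      have "(\<integral>\<^sup>+b. \<integral>\<^sup>+a. H a b r \<partial>lborel \<partial>lborel) = ennreal r * (\<integral>\<^sup>+b. \<integral>\<^sup>+a. H a (r * b) r \<partial>lborel \<partial>lborel)"
        by (rule nn_integral_scale_subst[OF _ True]) measurable
      also have "(\<integral>\<^sup>+b. \<integral>\<^sup>+a. H a (r * b) r \<partial>lborel \<partial>lborel) =
        (\<integral>\<^sup>+b. ennreal (r * B b) * (\<integral>\<^sup>+a. H (r * B b * a) (r * b) r \<partial>lborel) \<partial>lborel)"
        by (intro nn_integral_cong nn_integral_scale_subst) (use True B0 in \<open>auto\<close>)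
      also have "\<dots> = (\<integral>\<^sup>+b. \<integral>\<^sup>+a. ennreal (r * B b) * G (a / A a) (b / (A a * B b)) * indicator {0<..1 / (A a * B b)} r \<partial>lborel \<partial>lborel)"
      proof (intro nn_integral_cong)
        fix b :: real
        \<comment> \<open>After b := r * b and a := r * B b * a the distance to the origin factors,
          so membership in the unit ball becomes a bound on r alone.\<close>
        have RR: "R (r * B b * a) (r * b) r = r * B b * A a" for a
        proof -
          have "(r * B b * a)\<^sup>2 + (r * b)\<^sup>2 + r\<^sup>2 = (r * B b * A a)\<^sup>2"
            by (simp add: A_def B_def power_mult_distrib algebra_simps)
          then show ?thesis unfolding R_def using True A0[of a] B0[of b] by simp
        qed
        have "H (r * B b * a) (r * b) r = G (a / A a) (b / (A a * B b)) * indicator {0<..1 / (A a * B b)} r" for a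
        proof -
          have "(r * B b * a) / (r * B b * A a) = a / A a" "(r * b) / (r * B b * A a) = b / (A a * B b)"
            using True B0[of b] A0[of a] by (simp_all add: field_simps)
          moreover have "r * B b * A a \<le> 1 \<longleftrightarrow> r \<le> 1 / (A a * B b)"
            using A0[of a] B0[of b] by (simp add: pos_le_divide_eq mult_ac)
          ultimately show ?thesis
            using True A0[of a] B0[of b] by (simp add: H_def RR indicator_def mult.commute[of "B b" "A a"])
        qed
        then show "ennreal (r * B b) * (\<integral>\<^sup>+a. H (r * B b * a) (r * b) r \<partial>lborel) =
          (\<integral>\<^sup>+a. ennreal (r * B b) * G (a / A a) (b / (A a * B b)) * indicator {0<..1 / (A a * B b)} r \<partial>lborel)"
          by (subst nn_integral_cmult[symmetric], measurable) (simp add: mult.assoc)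
      qed
      finally have 1: "(\<integral>\<^sup>+b. \<integral>\<^sup>+a. H a b r \<partial>lborel \<partial>lborel) = ennreal r * \<dots>" .
      have 2: "ennreal r * (ennreal (r * B b) * G (a / A a) (b / (A a * B b)) * indicator {0<..1 / (A a * B b)} r) *
           ennreal (real (Suc m) * r ^ m) =
          (ennreal (B b) * G (a / A a) (b / (A a * B b)) * ennreal (Suc m)) *
            (ennreal (r ^ (m + 2)) * indicator {0<..1 / (A a * B b)} r)" for a b
      proof -
        have "ennreal r * ennreal (r * B b) * ennreal (real (Suc m) * r ^ m) =
          ennreal (B b) * ennreal (Suc m) * ennreal (r ^ (m + 2))"
          using True B0[of b] by (simp add: ennreal_mult[symmetric] power2_eq_square power_add mult_ac del: of_nat_Suc)
        then have "ennreal r * ennreal (r * B b) * ennreal (real (Suc m) * r ^ m) * x =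
          ennreal (B b) * ennreal (Suc m) * ennreal (r ^ (m + 2)) * x" for x by (simp only: )
        from this[of "G (a / A a) (b / (A a * B b)) * indicator {0<..1 / (A a * B b)} r"]
        show ?thesis by (simp only: mult_ac)
      qed
      have "(\<integral>\<^sup>+b. \<integral>\<^sup>+a. (ennreal (B b) * G (a / A a) (b / (A a * B b)) * ennreal (Suc m)) *
         (ennreal (r ^ (m + 2)) * indicator {0<..1 / (A a * B b)} r) \<partial>lborel \<partial>lborel) =
        (\<integral>\<^sup>+b. ennreal r * (\<integral>\<^sup>+a. ennreal (r * B b) * G (a / A a) (b / (A a * B b)) * indicator {0<..1 / (A a * B b)} r \<partial>lborel)
          * ennreal (real (Suc m) * r ^ m) \<partial>lborel)"
        unfolding 2[symmetric]
      proof (rule nn_integral_cong)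
        fix b
        have "(\<integral>\<^sup>+a. ennreal r * (ennreal (r * B b) * G (a / A a) (b / (A a * B b)) * indicator {0<..1 / (A a * B b)} r)
            * ennreal (real (Suc m) * r ^ m) \<partial>lborel) =
          (\<integral>\<^sup>+a. ennreal r * (ennreal (r * B b) * G (a / A a) (b / (A a * B b)) * indicator {0<..1 / (A a * B b)} r) \<partial>lborel)
            * ennreal (real (Suc m) * r ^ m)"
          by (rule nn_integral_multc) measurable
        also have "(\<integral>\<^sup>+a. ennreal r * (ennreal (r * B b) * G (a / A a) (b / (A a * B b)) * indicator {0<..1 / (A a * B b)} r) \<partial>lborel) =
          ennreal r * (\<integral>\<^sup>+a. ennreal (r * B b) * G (a / A a) (b / (A a * B b)) * indicator {0<..1 / (A a * B b)} r \<partial>lborel)"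
          by (rule nn_integral_cmult) measurable
        finally show "(\<integral>\<^sup>+a. ennreal r * (ennreal (r * B b) * G (a / A a) (b / (A a * B b)) * indicator {0<..1 / (A a * B b)} r)
            * ennreal (real (Suc m) * r ^ m) \<partial>lborel) = \<dots> * ennreal (real (Suc m) * r ^ m)" .
      qed
      also have "\<dots> = ennreal r * (\<integral>\<^sup>+b. \<integral>\<^sup>+a. ennreal (r * B b) * G (a / A a) (b / (A a * B b)) * indicator {0<..1 / (A a * B b)} r \<partial>lborel \<partial>lborel)
          * ennreal (real (Suc m) * r ^ m)"
      proof -
        have "(\<integral>\<^sup>+b. ennreal r * (\<integral>\<^sup>+a. ennreal (r * B b) * G (a / A a) (b / (A a * B b)) * indicator {0<..1 / (A a * B b)} r \<partial>lborel)
          * ennreal (real (Suc m) * r ^ m) \<partial>lborel) =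
          (\<integral>\<^sup>+b. ennreal r * (\<integral>\<^sup>+a. ennreal (r * B b) * G (a / A a) (b / (A a * B b)) * indicator {0<..1 / (A a * B b)} r \<partial>lborel) \<partial>lborel)
          * ennreal (real (Suc m) * r ^ m)"
          by (rule nn_integral_multc) measurable
        then show ?thesis by (subst (asm) nn_integral_cmult) measurable
      qed
      finally show ?thesis
        unfolding 1 using True by simp
    next
      case False
      then have "\<And>a b. indicator {0<..1 / (A a * B b)} r = (0::ennreal)" by simp
      with False show ?thesis by simp
    qed
  qed
  also have "\<dots> = (\<integral>\<^sup>+b. \<integral>\<^sup>+r. \<integral>\<^sup>+a. (ennreal (B b) * G (a / A a) (b / (A a * B b)) * ennreal (Suc m)) *
         (ennreal (r ^ (m + 2)) * indicator {0<..1 / (A a * B b)} r) \<partial>lborel \<partial>lborel \<partial>lborel)"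
    by (rule lborel_pair.Fubini') measurable
  also have "\<dots> = (\<integral>\<^sup>+b. \<integral>\<^sup>+a. \<integral>\<^sup>+r. (ennreal (B b) * G (a / A a) (b / (A a * B b)) * ennreal (Suc m)) *
         (ennreal (r ^ (m + 2)) * indicator {0<..1 / (A a * B b)} r) \<partial>lborel \<partial>lborel \<partial>lborel)"
    by (intro nn_integral_cong lborel_pair.Fubini') measurable
  \<comment> \<open>The integral of r ^ (m + 2) up to 1 / (A a * B b) produces 1 / (m + 3), which
    cancels the dimension factor in the definition of \<open>sphere_measure\<close>.\<close>
  also have "ennreal (m + 3) * (ennreal ?c * \<dots>) = ennreal (real (Suc m) * ?c) * (\<integral>\<^sup>+b. \<integral>\<^sup>+a. ennreal (B b) * G (a / A a) (b / (A a * B b)) *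
      ennreal ((1 / (A a * B b)) ^ (m + 3)) \<partial>lborel \<partial>lborel)"
  proof -
    have "(\<integral>\<^sup>+r. (ennreal (B b) * G (a / A a) (b / (A a * B b)) * ennreal (Suc m)) *
         (ennreal (r ^ (m + 2)) * indicator {0<..1 / (A a * B b)} r) \<partial>lborel) =
       ennreal (Suc m / (m + 3)) * (ennreal (B b) * G (a / A a) (b / (A a * B b)) *
      ennreal ((1 / (A a * B b)) ^ (m + 3)))" for a b
    proof -
      have 0: "0 \<le> 1 / (A a * B b)" using A0[of a] B0[of b] by simp
      have "(\<integral>\<^sup>+r. ennreal (r ^ (m + 2)) * indicator {0<..1 / (A a * B b)} r \<partial>lborel) =
        (\<integral>\<^sup>+r. ennreal (1 / real (Suc (m + 2))) * (ennreal (real (Suc (m + 2)) * r ^ (m + 2)) * indicator {0<..1 / (A a * B b)} r) \<partial>lborel)"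
        by (rule nn_integral_cong) (auto simp: indicator_def ennreal_mult'[symmetric] simp del: of_nat_Suc power_Suc)
      also have "\<dots> = ennreal (1 / (m + 3)) * ennreal ((1 / (A a * B b)) ^ (m + 3))"
        using nn_integral_power_Ioc[OF 0, of "m + 2"]
        by (subst nn_integral_cmult) (simp_all add: numeral_3_eq_3)
      finally have "(\<integral>\<^sup>+r. ennreal (r ^ (m + 2)) * indicator {0<..1 / (A a * B b)} r \<partial>lborel) = \<dots>" .
      moreover have "ennreal (Suc m) * ennreal (1 / (m + 3)) = ennreal (Suc m / (m + 3))"
        by (subst ennreal_mult[symmetric]) simp_all
      then have "x * ennreal (Suc m) * (ennreal (1 / (m + 3)) * y) = ennreal (Suc m / (m + 3)) * (x * y)" for x y
        by (metis mult.assoc mult.commute)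
      moreover have "(\<integral>\<^sup>+r. (ennreal (B b) * G (a / A a) (b / (A a * B b)) * ennreal (Suc m)) *
         (ennreal (r ^ (m + 2)) * indicator {0<..1 / (A a * B b)} r) \<partial>lborel) =
         (ennreal (B b) * G (a / A a) (b / (A a * B b)) * ennreal (Suc m)) * (\<integral>\<^sup>+r.
         (ennreal (r ^ (m + 2)) * indicator {0<..1 / (A a * B b)} r) \<partial>lborel)"
        by (rule nn_integral_cmult) measurable
      ultimately show ?thesis by (simp only:)
    qed
    then have "(\<integral>\<^sup>+b. \<integral>\<^sup>+a. \<integral>\<^sup>+r. (ennreal (B b) * G (a / A a) (b / (A a * B b)) * ennreal (Suc m)) *
         (ennreal (r ^ (m + 2)) * indicator {0<..1 / (A a * B b)} r) \<partial>lborel \<partial>lborel \<partial>lborel) =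
       (\<integral>\<^sup>+b. \<integral>\<^sup>+a. ennreal (Suc m / (m + 3)) * (ennreal (B b) * G (a / A a) (b / (A a * B b)) *
      ennreal ((1 / (A a * B b)) ^ (m + 3))) \<partial>lborel \<partial>lborel)" by (simp only:)
    also have "\<dots> = (\<integral>\<^sup>+b. ennreal (Suc m / (m + 3)) * (\<integral>\<^sup>+a. ennreal (B b) * G (a / A a) (b / (A a * B b)) *
      ennreal ((1 / (A a * B b)) ^ (m + 3)) \<partial>lborel) \<partial>lborel)"
      by (intro nn_integral_cong nn_integral_cmult) measurable
    also have "\<dots> = ennreal (Suc m / (m + 3)) * (\<integral>\<^sup>+b. \<integral>\<^sup>+a. ennreal (B b) * G (a / A a) (b / (A a * B b)) *
      ennreal ((1 / (A a * B b)) ^ (m + 3)) \<partial>lborel \<partial>lborel)"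
      by (intro nn_integral_cmult) measurable
    moreover have "ennreal (m + 3) * ennreal ?c * ennreal (Suc m / (m + 3)) = ennreal (real (Suc m) * ?c)"
    proof -
      have "real (Suc m) * ?c = real (m + 3) * ?c * (real (Suc m) / real (m + 3))" by simp
      then show ?thesis by (simp only: ennreal_mult of_nat_0_le_iff unit_ball_vol_nonneg mult_nonneg_nonneg divide_nonneg_nonneg)
    qed
    ultimately show ?thesis by (metis (no_types, lifting) mult.assoc)
  qed
  also have "(\<integral>\<^sup>+b. \<integral>\<^sup>+a. ennreal (B b) * G (a / A a) (b / (A a * B b)) * ennreal ((1 / (A a * B b)) ^ (m + 3)) \<partial>lborel \<partial>lborel) =
    (\<integral>\<^sup>+v\<in>{-1<..<1}. (\<integral>\<^sup>+u\<in>{-1<..<1}. ennreal ((1 - v\<^sup>2) powr ((real m - 1) / 2)) *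
        ennreal ((1 - u\<^sup>2) powr (real m / 2)) * G u (v * sqrt (1 - u\<^sup>2)) \<partial>lborel) \<partial>lborel)"
  proof -
    have p: "1 - v\<^sup>2 > 0" if "v \<in> {-1<..<1}" for v :: real
      using that by (simp add: abs_square_less_1 abs_less_iff)
    have AA: "A (u / sqrt (1 - u\<^sup>2)) = (1 - u\<^sup>2) powr (- 1/2)" if "u \<in> {-1<..<1}" for u
    proof -
      have "1 + (u / sqrt (1 - u\<^sup>2))\<^sup>2 = 1 / (1 - u\<^sup>2)" using p[OF that] by (simp add: power_divide field_simps)
      then show ?thesis using p[OF that] by (simp add: A_def powr_minus powr_half_sqrt real_sqrt_divide inverse_eq_divide)
    qed
    have BA: "B = A" by (simp add: fun_eq_iff A_def B_def)
        have *: "ennreal (B (v / sqrt (1 - v\<^sup>2))) * G (u / sqrt (1 - u\<^sup>2) / A (u / sqrt (1 - u\<^sup>2)))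
           (v / sqrt (1 - v\<^sup>2) / (A (u / sqrt (1 - u\<^sup>2)) * B (v / sqrt (1 - v\<^sup>2)))) *
            ennreal ((1 / (A (u / sqrt (1 - u\<^sup>2)) * B (v / sqrt (1 - v\<^sup>2)))) ^ (m + 3)) *
            ennreal ((1 - u\<^sup>2) powr (-3/2)) * ennreal ((1 - v\<^sup>2) powr (-3/2)) =
           ennreal ((1 - v\<^sup>2) powr ((real m - 1) / 2)) *
             ennreal ((1 - u\<^sup>2) powr (real m / 2)) * G u (v * sqrt (1 - u\<^sup>2))"
          if u: "u \<in> {-1<..<1}" and v: "v \<in> {-1<..<1}" for u v
        proof -
          have sA: "sqrt (1 - x\<^sup>2) * A (x / sqrt (1 - x\<^sup>2)) = 1" if "x \<in> {-1<..<1}" for x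
            unfolding AA[OF that] using p[OF that] by (simp add: powr_half_sqrt[symmetric] powr_add[symmetric])
          have Ai: "1 / A (x / sqrt (1 - x\<^sup>2)) = sqrt (1 - x\<^sup>2)" if "x \<in> {-1<..<1}" for x
            using sA[OF that] A0[of "x / sqrt (1 - x\<^sup>2)"] by (simp add: field_simps)
          have 1: "u / sqrt (1 - u\<^sup>2) / A (u / sqrt (1 - u\<^sup>2)) = u"
            using sA[OF u] by simp
          have 2: "v / sqrt (1 - v\<^sup>2) / (A (u / sqrt (1 - u\<^sup>2)) * B (v / sqrt (1 - v\<^sup>2))) = v * sqrt (1 - u\<^sup>2)"
          proof -
            have "v / sqrt (1 - v\<^sup>2) / (A (u / sqrt (1 - u\<^sup>2)) * B (v / sqrt (1 - v\<^sup>2))) =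
              v / (sqrt (1 - v\<^sup>2) * A (v / sqrt (1 - v\<^sup>2))) / A (u / sqrt (1 - u\<^sup>2))"
              by (simp add: BA mult_ac)
            also have "\<dots> = v * (1 / A (u / sqrt (1 - u\<^sup>2)))" by (simp only: sA[OF v]) simp
            also note Ai[OF u]
            finally show ?thesis .
          qed
          have 3: "(1 / (A (u / sqrt (1 - u\<^sup>2)) * B (v / sqrt (1 - v\<^sup>2)))) ^ (m + 3) =
            (1 - u\<^sup>2) powr ((m + 3) / 2) * (1 - v\<^sup>2) powr ((m + 3) / 2)"
          proof -
            have "1 / (A (u / sqrt (1 - u\<^sup>2)) * B (v / sqrt (1 - v\<^sup>2))) = (1 - u\<^sup>2) powr (1/2) * (1 - v\<^sup>2) powr (1/2)"
            proof -
              have "1 / (A (u / sqrt (1 - u\<^sup>2)) * B (v / sqrt (1 - v\<^sup>2))) =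
                (1 / A (u / sqrt (1 - u\<^sup>2))) * (1 / A (v / sqrt (1 - v\<^sup>2)))"
                by (simp add: BA)
              then show ?thesis
                unfolding Ai[OF u] Ai[OF v] using p[OF u] p[OF v] by (simp only: powr_half_sqrt less_imp_le)
            qed
            moreover have "(x powr (1/2)) ^ (m + 3) = x powr ((m + 3) / 2)" if "x > 0" for x :: real
              using that by (subst powr_realpow[symmetric]) (simp_all add: powr_powr)
            ultimately show ?thesis using p[OF u] p[OF v] by (simp only: power_mult_distrib)
          qed
          have 4: "(1 - v\<^sup>2) powr (-1/2) * ((1 - u\<^sup>2) powr ((m + 3) / 2) * (1 - v\<^sup>2) powr ((m + 3) / 2)) *
             (1 - u\<^sup>2) powr (-3/2) * (1 - v\<^sup>2) powr (-3/2) =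
             (1 - v\<^sup>2) powr ((real m - 1) / 2) * (1 - u\<^sup>2) powr (real m / 2)"
          proof -
            have "(1 - v\<^sup>2) powr (-1/2) * (1 - v\<^sup>2) powr ((m + 3) / 2) * (1 - v\<^sup>2) powr (-3/2) = (1 - v\<^sup>2) powr ((real m - 1) / 2)"
              unfolding powr_add[symmetric] by (rule arg_cong2[where f="(powr)", OF refl]) (simp add: field_simps)
            moreover have "(1 - u\<^sup>2) powr ((m + 3) / 2) * (1 - u\<^sup>2) powr (-3/2) = (1 - u\<^sup>2) powr (real m / 2)"
              unfolding powr_add[symmetric] by (rule arg_cong2[where f="(powr)", OF refl]) (simp add: field_simps)
            moreover have "a * (b * c) * d * e = (a * c * e) * (b * d)" for a b c d e :: real by simp
            ultimately show ?thesis by (simp only:)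
          qed
          show ?thesis
            unfolding 1 2 3 unfolding BA AA[OF v]
            using arg_cong[OF 4, of "\<lambda>x. ennreal x * G u (v * sqrt (1 - u\<^sup>2))"]
            by (simp only: ennreal_mult powr_ge_zero mult_nonneg_nonneg) (simp only: mult_ac)
        qed
    define K where "K b a = ennreal (B b) * G (a / A a) (b / (A a * B b)) * ennreal ((1 / (A a * B b)) ^ (m + 3))" for a b
    have Km: "(\<lambda>(b,a). K b a) \<in> borel_measurable (borel \<Otimes>\<^sub>M borel)"
      unfolding K_def by measurable
    have [measurable (raw)]: "(\<lambda>x. K (f x) (g x)) \<in> borel_measurable M"
      if "f \<in> borel_measurable M" "g \<in> borel_measurable M" for f g and M :: "'c measure"
      using measurable_compose[of "\<lambda>x. (f x, g x)", OF _ Km] that by simp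
    have "(\<integral>\<^sup>+b. \<integral>\<^sup>+a. K b a \<partial>lborel \<partial>lborel) =
      (\<integral>\<^sup>+b. (\<integral>\<^sup>+u\<in>{-1<..<1}. K b (u / sqrt (1 - u\<^sup>2)) * ennreal ((1 - u\<^sup>2) powr (-3/2)) \<partial>lborel) \<partial>lborel)"
      by (rule nn_integral_cong, rule nn_integral_arctan_type_subst) measurable
    also have "\<dots> = (\<integral>\<^sup>+v\<in>{-1<..<1}. (\<integral>\<^sup>+u\<in>{-1<..<1}. K (v / sqrt (1 - v\<^sup>2)) (u / sqrt (1 - u\<^sup>2)) * ennreal ((1 - u\<^sup>2) powr (-3/2)) \<partial>lborel) *
        ennreal ((1 - v\<^sup>2) powr (-3/2)) \<partial>lborel)"
      by (rule nn_integral_arctan_type_subst) measurable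
    also have "\<dots> = (\<integral>\<^sup>+v\<in>{-1<..<1}. (\<integral>\<^sup>+u\<in>{-1<..<1}. ennreal ((1 - v\<^sup>2) powr ((real m - 1) / 2)) *
        ennreal ((1 - u\<^sup>2) powr (real m / 2)) * G u (v * sqrt (1 - u\<^sup>2)) \<partial>lborel) \<partial>lborel)"
    proof (rule nn_integral_cong)
      fix v :: real
      have "(\<integral>\<^sup>+u\<in>{-1<..<1}. K (v / sqrt (1 - v\<^sup>2)) (u / sqrt (1 - u\<^sup>2)) * ennreal ((1 - u\<^sup>2) powr (-3/2)) \<partial>lborel) *
          ennreal ((1 - v\<^sup>2) powr (-3/2)) =
        (\<integral>\<^sup>+u. K (v / sqrt (1 - v\<^sup>2)) (u / sqrt (1 - u\<^sup>2)) * ennreal ((1 - u\<^sup>2) powr (-3/2)) * indicator {-1<..<1} u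
          * ennreal ((1 - v\<^sup>2) powr (-3/2)) \<partial>lborel)"
        by (rule nn_integral_multc[symmetric]) measurable
      also have "\<dots> = (\<integral>\<^sup>+u\<in>{-1<..<1}. ennreal ((1 - v\<^sup>2) powr ((real m - 1) / 2)) *
        ennreal ((1 - u\<^sup>2) powr (real m / 2)) * G u (v * sqrt (1 - u\<^sup>2)) \<partial>lborel)" if v: "v \<in> {-1<..<1}"
      proof (rule nn_integral_cong)
        fix u :: real
        show "K (v / sqrt (1 - v\<^sup>2)) (u / sqrt (1 - u\<^sup>2)) * ennreal ((1 - u\<^sup>2) powr (-3/2)) * indicator {-1<..<1} u
          * ennreal ((1 - v\<^sup>2) powr (-3/2)) =
          ennreal ((1 - v\<^sup>2) powr ((real m - 1) / 2)) *
        ennreal ((1 - u\<^sup>2) powr (real m / 2)) * G u (v * sqrt (1 - u\<^sup>2)) * indicator {-1<..<1} u"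
        proof (cases "u \<in> {-1<..<1}")
          case True
          then show ?thesis using *[OF True v] unfolding K_def by (simp only: indicator_simps mult_1_right)
        next
          case False
          then have "indicator {-1<..<1} u = (0::ennreal)" by simp
          then show ?thesis by (simp only: mult_zero_left mult_zero_right)
        qed
      qed
      finally show "(\<integral>\<^sup>+u\<in>{-1<..<1}. K (v / sqrt (1 - v\<^sup>2)) (u / sqrt (1 - u\<^sup>2)) * ennreal ((1 - u\<^sup>2) powr (-3/2)) \<partial>lborel) *
          ennreal ((1 - v\<^sup>2) powr (-3/2)) * indicator {-1<..<1} v = (\<integral>\<^sup>+u\<in>{-1<..<1}. ennreal ((1 - v\<^sup>2) powr ((real m - 1) / 2)) *
        ennreal ((1 - u\<^sup>2) powr (real m / 2)) * G u (v * sqrt (1 - u\<^sup>2)) \<partial>lborel) * indicator {-1<..<1} v"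
        by (auto simp: indicator_def)
    qed
    finally show ?thesis unfolding K_def .
  qed
  finally show ?thesis .
qed

text \<open>\<open>sgn\<close> commutes with a linear isometry and the punctured ball is invariant,
  so rotation invariance is inherited from Lebesgue measure.\<close>

lemma nn_integral_sphere_orthogonal:
  fixes R :: "'a::euclidean_space \<Rightarrow> 'a" and g :: "'a \<Rightarrow> ennreal"
  assumes lin: "linear R" and nR: "\<And>x. norm (R x) = norm x"
    and [measurable]: "g \<in> borel_measurable borel"
  shows "(\<integral>\<^sup>+y. g (R y) \<partial>sphere_measure) = (\<integral>\<^sup>+y. g y \<partial>sphere_measure)"
proof -
  have [measurable]: "R \<in> borel_measurable borel"
    using lin linear_continuous_on linear_conv_bounded_linear borel_measurable_continuous_onI by blast
  have [measurable]: "(sgn :: 'a \<Rightarrow> 'a) \<in> borel_measurable borel"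
    unfolding sgn_div_norm[abs_def] by measurable
  have s: "R (sgn x) = sgn (R x)" for x
    by (simp add: sgn_div_norm linear_scale[OF lin] nR)
  have "(\<integral>\<^sup>+x\<in>cball 0 1 - {0}. g (sgn x) \<partial>lborel) =
    (\<integral>\<^sup>+x\<in>cball 0 1 - {0}. g (sgn x) \<partial>distr lborel borel R)"
    by (simp add: distr_lborel_orthogonal[OF lin nR])
  also have "\<dots> = (\<integral>\<^sup>+x\<in>cball 0 1 - {0}. g (R (sgn x)) \<partial>lborel)"
  proof -
    have "indicator (cball 0 1 - {0}) (R x) = (indicator (cball 0 1 - {0}) x :: ennreal)" for x
      using nR[of x] norm_eq_zero[of "R x"] norm_eq_zero[of x] by (simp add: indicator_def)
    moreover have [measurable]: "cball 0 1 - {0::'a} \<in> sets borel" by (intro sets.Diff) auto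
    have "(\<lambda>x. g (sgn x) * indicator (cball 0 1 - {0}) x) \<in> borel_measurable borel"
by measurable
    ultimately show ?thesis by (simp add: s nn_integral_distr)
  qed
  finally show ?thesis by (simp add: nn_integral_sphere_measure)
qed

text \<open>A reflection that fixes \<open>e\<close> carries \<open>w\<close> to a basis vector,
  which reduces the claim to coordinate axes. The general \<open>w\<close> is needed because it will
  be the horizontal direction of a given point of the sphere.\<close>

lemma nn_integral_sphere:
  fixes e w :: "'a::euclidean_space" and G :: "real \<Rightarrow> real \<Rightarrow> ennreal"
  assumes e: "e \<in> Basis" and w: "norm w = 1" "e \<bullet> w = 0" and d: "DIM('a) = m + 3"
    and G: "(\<lambda>(u,s). G u s) \<in> borel_measurable (borel \<Otimes>\<^sub>M borel)"
  shows "(\<integral>\<^sup>+y. G (y \<bullet> e) (y \<bullet> w) \<partial>sphere_measure) =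
    ennreal (real (Suc m) * unit_ball_vol (Suc m)) *
     (\<integral>\<^sup>+v\<in>{-1<..<1}. (\<integral>\<^sup>+u\<in>{-1<..<1}. ennreal ((1 - v\<^sup>2) powr ((real m - 1) / 2)) *
        ennreal ((1 - u\<^sup>2) powr (real m / 2)) * G u (v * sqrt (1 - u\<^sup>2)) \<partial>lborel) \<partial>lborel)"
proof -
  have Gm [measurable (raw)]: "(\<lambda>x. G (f x) (g x)) \<in> borel_measurable M"
    if "f \<in> borel_measurable M" "g \<in> borel_measurable M" for f g and M :: "'c measure"
    using measurable_compose[of "\<lambda>x. (f x, g x)", OF _ G] that by simp
  have "card (Basis - {e}) \<noteq> 0" using e d by simp
  then obtain w' where w': "w' \<in> Basis" "e \<noteq> w'"
    by (metis Diff_iff card.empty ex_in_conv insertI1)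
  define v where "v = w - w'"
  \<comment> \<open>Reflection in the hyperplane orthogonal to w - w'. If w = w' the correction
    vanishes and \<open>R\<close> is the identity, so one definition serves both cases.\<close>
  define R where "R x = x - (2 * (x \<bullet> v) / (v \<bullet> v)) *\<^sub>R v" for x
  have lin: "linear R"
    by (rule linearI) (simp_all add: R_def inner_add_left distrib_left add_divide_distrib scaleR_add_left scaleR_diff_right)
  have ww: "w \<bullet> w = 1" "w' \<bullet> w' = 1" "w' \<bullet> e = 0" "e \<bullet> w' = 0"
    using w w' e by (simp_all add: norm_eq_1 inner_Basis)
  have vv: "v \<bullet> v = 2 - 2 * (w \<bullet> w')" and ev: "e \<bullet> v = 0"
    using w inner_commute[of w w'] by (simp_all add: v_def inner_diff_left inner_diff_right ww)
  have sym: "R x \<bullet> y = x \<bullet> R y" for x y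
    by (simp add: R_def inner_diff_left inner_diff_right inner_commute[of v y])
  have RR: "R (R x) = x" for x
  proof (cases "v = 0")
    case False
    then have "R x \<bullet> v = - (x \<bullet> v)" by (simp add: R_def inner_diff_left)
    then have "R (R x) = R x + (2 * (x \<bullet> v) / (v \<bullet> v)) *\<^sub>R v"
      unfolding R_def[of "R x"] by simp
    then show ?thesis unfolding R_def[of x] by simp
  qed (simp add: R_def)
  have nR: "norm (R x) = norm x" for x
    by (simp add: norm_eq_sqrt_inner sym RR)
  have Re: "R e = e" by (simp add: R_def ev)
  have Rw: "R w' = w"
  proof (cases "v = 0")
    case True then show ?thesis by (simp add: R_def v_def)
  next
    case False
    have "2 * (w' \<bullet> v) = - (v \<bullet> v)"
      unfolding vv using inner_commute[of w w'] by (simp add: v_def inner_diff_right ww)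
    then have "2 * (w' \<bullet> v) / (v \<bullet> v) = -1" using False by simp
    then show ?thesis by (simp add: R_def v_def)
  qed
  have "(\<integral>\<^sup>+y. G (y \<bullet> e) (y \<bullet> w) \<partial>sphere_measure) = (\<integral>\<^sup>+y. G (R y \<bullet> e) (R y \<bullet> w') \<partial>sphere_measure)"
    by (simp add: sym Re Rw)
  also have "\<dots> = (\<integral>\<^sup>+y. G (y \<bullet> e) (y \<bullet> w') \<partial>sphere_measure)"
    by (rule nn_integral_sphere_orthogonal[OF lin nR]) measurable
  also note nn_integral_sphere_axes[OF e w'(1,2) d G]
  finally show ?thesis .
qed

lemma bij_betw_open_interval_increasing:
  fixes f :: "real \<Rightarrow> real"
  assumes ab: "a < b" and cont: "continuous_on {a..b} f"
    and der: "\<And>x. a < x \<Longrightarrow> x < b \<Longrightarrow> (f has_real_derivative f' x) (at x)"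
    and pos: "\<And>x. a < x \<Longrightarrow> x < b \<Longrightarrow> f' x > 0"
  shows "bij_betw f {a<..<b} {f a<..<f b}"
proof -
  have mono: "f x < f y" if "a \<le> x" "x < y" "y \<le> b" for x y
  proof (rule DERIV_pos_imp_increasing_open[OF \<open>x < y\<close>])
    show "continuous_on {x..y} f" using cont that by (auto intro: continuous_on_subset)
    show "\<And>z. x < z \<Longrightarrow> z < y \<Longrightarrow> \<exists>w. DERIV f z :> w \<and> 0 < w"
      using der pos that by (meson dual_order.strict_trans1 dual_order.strict_trans2)
  qed
  show ?thesis unfolding bij_betw_def
  proof
    show "inj_on f {a<..<b}"
    proof (rule inj_onI)
      fix x y assume "x \<in> {a<..<b}" "y \<in> {a<..<b}" "f x = f y"
      then show "x = y" using mono[of x y] mono[of y x] by (cases x y rule: linorder_cases) auto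
    qed
    show "f ` {a<..<b} = {f a<..<f b}"
    proof (intro equalityI subsetI)
      fix y assume y: "y \<in> {f a<..<f b}"
      then obtain x where x: "x \<ge> a" "x \<le> b" "f x = y"
        using IVT'[of f a y b] ab cont by auto
      with y have "x \<noteq> a" "x \<noteq> b" by auto
      with x show "y \<in> f ` {a<..<b}" by auto
    qed (use mono in auto)
  qed
qed

lemma bij_betw_open_interval_decreasing:
  fixes f :: "real \<Rightarrow> real"
  assumes ab: "a < b" and cont: "continuous_on {a..b} f"
    and der: "\<And>x. a < x \<Longrightarrow> x < b \<Longrightarrow> (f has_real_derivative f' x) (at x)"
    and neg: "\<And>x. a < x \<Longrightarrow> x < b \<Longrightarrow> f' x < 0"
  shows "bij_betw f {a<..<b} {f b<..<f a}"
proof -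
  have "bij_betw (\<lambda>x. - f x) {a<..<b} {- f a<..<- f b}"
    by (rule bij_betw_open_interval_increasing[where f'="\<lambda>x. - f' x"])
       (use ab neg in \<open>auto intro!: continuous_intros cont derivative_eq_intros der\<close>)
  moreover have "bij_betw uminus {- f a<..<- f b} {f b<..<f a}"
    by (rule bij_betw_byWitness[where f'=uminus]) auto
  ultimately have "bij_betw (uminus \<circ> (\<lambda>x. - f x)) {a<..<b} {f b<..<f a}"
    by (rule bij_betw_trans)
  then show ?thesis by (simp add: o_def)
qed

section \<open>Copson factorization of the averaged kernel\<close>

text \<open>The substitution \<open>y\<close> is the squared distance from the origin to the line through two
  points at distances \<open>r\<close> and \<open>\<rho>\<close> from it that are seen under an angle with cosine \<open>v\<close>; every value
  occurs for two angles.\<close>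

lemma nn_integral_copson_less:
  fixes r \<rho> k :: real
  assumes \<rho>: "0 < \<rho>" and r: "\<rho> < r"
  shows "(\<integral>\<^sup>+v\<in>{-1<..<1}. ennreal ((1 - v\<^sup>2) powr k * (r\<^sup>2 + \<rho>\<^sup>2 - 2 * r * \<rho> * v) powr (- k - 1)) \<partial>lborel) =
    ennreal ((r * \<rho>) powr (- 2 * k - 1)) *
      (\<integral>\<^sup>+y\<in>{0<..<\<rho>\<^sup>2}. ennreal (y powr k / sqrt ((r\<^sup>2 - y) * (\<rho>\<^sup>2 - y))) \<partial>lborel)"
proof -
  define D where "D v = r\<^sup>2 + \<rho>\<^sup>2 - 2 * r * \<rho> * v" for v
  define \<psi> where "\<psi> v = r\<^sup>2 * \<rho>\<^sup>2 * (1 - v\<^sup>2) / D v" for v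
  define \<psi>' where "\<psi>' v = 2 * r\<^sup>2 * \<rho>\<^sup>2 * (r * v - \<rho>) * (\<rho> * v - r) / (D v)\<^sup>2" for v
  define f where "f y = y powr k / sqrt ((r\<^sup>2 - y) * (\<rho>\<^sup>2 - y))" for y
  have r0: "r > 0" using assms by simp
  have D: "D v > 0" if "v \<le> 1" for v
  proof -
    have "0 < (r - \<rho>)\<^sup>2" using r by simp
    also have "\<dots> = D 1" by (simp add: D_def power2_eq_square algebra_simps)
    also have "\<dots> \<le> D v" using that \<rho> r0 by (simp add: D_def)
    finally show ?thesis .
  qed
  have p: "1 - v\<^sup>2 > 0" if "-1 < v" "v < 1" for v :: real
    using that by (simp add: abs_square_less_1 abs_less_iff)
  have [measurable]: "D \<in> borel_measurable borel" "\<psi> \<in> borel_measurable borel" "\<psi>' \<in> borel_measurable borel"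
    "f \<in> borel_measurable borel"
    unfolding D_def[abs_def] \<psi>_def[abs_def] \<psi>'_def[abs_def] f_def[abs_def] by measurable
  have der: "(\<psi> has_real_derivative \<psi>' v) (at v)" if "-1 < v" "v < 1" for v
  proof -
    have "(\<psi> has_real_derivative ((r\<^sup>2 * \<rho>\<^sup>2 * (- 2 * v)) * D v - (r\<^sup>2 * \<rho>\<^sup>2 * (1 - v\<^sup>2)) * (- 2 * r * \<rho>)) / (D v * D v)) (at v)"
      unfolding \<psi>_def[abs_def] using D[of v] that unfolding D_def
      by (auto intro!: derivative_eq_intros)
    moreover have "((r\<^sup>2 * \<rho>\<^sup>2 * (- 2 * v)) * D v - (r\<^sup>2 * \<rho>\<^sup>2 * (1 - v\<^sup>2)) * (- 2 * r * \<rho>)) =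
       2 * r\<^sup>2 * \<rho>\<^sup>2 * (r * v - \<rho>) * (\<rho> * v - r)"
      unfolding D_def by algebra
    ultimately show ?thesis by (simp add: \<psi>'_def power2_eq_square)
  qed
  have cont: "continuous_on {a..b} \<psi>" if "b \<le> 1" for a b
    unfolding \<psi>_def[abs_def] D_def
    by (intro continuous_intros) (use D[unfolded D_def] that in \<open>auto intro!: less_imp_neq[THEN not_sym]\<close>)
  \<comment> \<open>The critical point of \<open>\<psi>\<close>: for this cosine the foot of the
    perpendicular from the origin is the nearer point itself, and \<open>\<psi>\<close> attains its
    maximum \<rho>^2.\<close>
  define c where "c = \<rho> / r"
  have c: "0 < c" "c < 1" using assms r0 by (simp_all add: c_def)
  have ends: "\<psi> (-1) = 0" "\<psi> 1 = 0" "\<psi> c = \<rho>\<^sup>2"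
  proof -
    have "D c = r\<^sup>2 - \<rho>\<^sup>2" using r0 by (simp add: D_def c_def power2_eq_square)
    moreover have "r\<^sup>2 - \<rho>\<^sup>2 > 0" using assms by (simp add: power_strict_mono)
    moreover have "r\<^sup>2 * \<rho>\<^sup>2 * (1 - c\<^sup>2) = \<rho>\<^sup>2 * (r\<^sup>2 - \<rho>\<^sup>2)"
      using r0 by (simp add: c_def power_divide field_simps)
    ultimately show "\<psi> c = \<rho>\<^sup>2" unfolding \<psi>_def by (simp only:) simp
  qed (simp_all add: \<psi>_def)
  have b1: "bij_betw \<psi> {-1<..<c} {0<..<\<rho>\<^sup>2}"
  proof -
    have "bij_betw \<psi> {-1<..<c} {\<psi> (-1)<..<\<psi> c}"
    proof (rule bij_betw_open_interval_increasing[where f'=\<psi>'])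
      fix v assume v: "-1 < v" "v < c"
      then have "r * v - \<rho> < 0" using r0 by (simp add: c_def field_simps)
      moreover have "\<rho> * v - r < 0" using v c \<rho> r
        by (smt (verit) mult_left_le)
      ultimately have "(r * v - \<rho>) * (\<rho> * v - r) > 0" by (rule mult_neg_neg)
      then have "2 * r\<^sup>2 * \<rho>\<^sup>2 * ((r * v - \<rho>) * (\<rho> * v - r)) > 0" using r0 \<rho> by simp
      then show "\<psi>' v > 0"
        unfolding \<psi>'_def mult.assoc using D[of v] v c by (simp add: mult.assoc)
    qed (use c der cont in auto)
    then show ?thesis by (simp add: ends)
  qed
  have b2: "bij_betw \<psi> {c<..<1} {0<..<\<rho>\<^sup>2}"
  proof -
    have "bij_betw \<psi> {c<..<1} {\<psi> 1<..<\<psi> c}"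
    proof (rule bij_betw_open_interval_decreasing[where f'=\<psi>'])
      fix v assume v: "c < v" "v < 1"
      then have "r * v - \<rho> > 0" using r0 by (simp add: c_def field_simps)
      moreover have "\<rho> * v - r < 0" using v c \<rho> r
        by (smt (verit) mult_left_le)
      ultimately show "\<psi>' v < 0"
        unfolding \<psi>'_def using r0 \<rho> D[of v] v c
        by (auto intro!: divide_neg_pos simp: mult_less_0_iff zero_less_mult_iff)
    qed (use c der cont in auto)
    then show ?thesis by (simp add: ends)
  qed
  let ?K = "\<lambda>v. (1 - v\<^sup>2) powr k * D v powr (- k - 1)"
  have key: "f (\<psi> v) * \<bar>\<psi>' v\<bar> = 2 * (r * \<rho>) powr (2 * k + 1) * ?K v"
    if v: "-1 < v" "v < 1" "v \<noteq> c" for v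
  proof -
    have Dv: "D v > 0" using D v by simp
    have rv: "r * v - \<rho> \<noteq> 0" using v r0 by (auto simp: c_def field_simps)
    have pv: "\<rho> * v - r \<noteq> 0" using v \<rho> r by (smt (verit) mult_left_le)
    \<comment> \<open>Both differences are perfect squares divided by D v. Their square root cancels
      against the two linear factors of the derivative, so only powers of 1 - v^2 and of D v
      survive.\<close>
    have "(r\<^sup>2 - \<psi> v) = r\<^sup>2 * (r - \<rho> * v)\<^sup>2 / D v"
    proof -
      have "r\<^sup>2 * D v - r\<^sup>2 * \<rho>\<^sup>2 * (1 - v\<^sup>2) = r\<^sup>2 * (r - \<rho> * v)\<^sup>2" unfolding D_def by algebra
      then show ?thesis using Dv by (simp add: \<psi>_def field_simps)
    qed
    moreover have "(\<rho>\<^sup>2 - \<psi> v) = \<rho>\<^sup>2 * (\<rho> - r * v)\<^sup>2 / D v"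
    proof -
      have "\<rho>\<^sup>2 * D v - r\<^sup>2 * \<rho>\<^sup>2 * (1 - v\<^sup>2) = \<rho>\<^sup>2 * (\<rho> - r * v)\<^sup>2" unfolding D_def by algebra
      then show ?thesis using Dv by (simp add: \<psi>_def field_simps)
    qed
    ultimately have "(r\<^sup>2 - \<psi> v) * (\<rho>\<^sup>2 - \<psi> v) = (r * \<rho> * ((r - \<rho> * v) * (\<rho> - r * v)) / D v)\<^sup>2"
      by (simp add: power2_eq_square)
    then have s: "sqrt ((r\<^sup>2 - \<psi> v) * (\<rho>\<^sup>2 - \<psi> v)) = r * \<rho> * \<bar>(r - \<rho> * v) * (\<rho> - r * v)\<bar> / D v"
      using Dv r0 \<rho> by (simp add: abs_mult)
    have s': "\<bar>\<psi>' v\<bar> = 2 * r\<^sup>2 * \<rho>\<^sup>2 * \<bar>(r - \<rho> * v) * (\<rho> - r * v)\<bar> / (D v)\<^sup>2"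
      by (simp add: \<psi>'_def abs_mult abs_minus_commute mult_ac)
    define X where "X = \<bar>(r - \<rho> * v) * (\<rho> - r * v)\<bar>"
    have X: "X > 0" using rv pv by (simp add: X_def abs_mult)
    have e: "\<psi> v powr k = (r * \<rho>) powr (2 * k) * ((1 - v\<^sup>2) powr k * D v powr (- k))"
    proof -
      have "\<psi> v = (r * \<rho>) powr 2 * ((1 - v\<^sup>2) * D v powr (- 1))"
        using Dv r0 \<rho> by (simp add: \<psi>_def powr_minus divide_inverse power_mult_distrib)
      moreover have "((r * \<rho>) powr 2 * ((1 - v\<^sup>2) * D v powr (- 1))) powr k =
          ((r * \<rho>) powr 2) powr k * ((1 - v\<^sup>2) powr k * (D v powr (- 1)) powr k)"
        using p[OF v(1,2)] by (simp only: powr_mult powr_ge_zero mult_nonneg_nonneg less_imp_le)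
      ultimately show ?thesis by (simp only: powr_powr) simp
    qed
    have "f (\<psi> v) * \<bar>\<psi>' v\<bar> = \<psi> v powr k * (2 * (r * \<rho>) / D v)"
      unfolding f_def s s' X_def[symmetric] using X Dv r0 \<rho> by (simp add: power2_eq_square field_simps)
    also have "\<dots> = 2 * ((r * \<rho>) powr (2 * k) * (r * \<rho>) powr 1) * ((1 - v\<^sup>2) powr k * (D v powr (- k) * D v powr (- 1)))"
      unfolding e using Dv r0 \<rho> by (simp add: powr_minus divide_inverse)
    finally have "f (\<psi> v) * \<bar>\<psi>' v\<bar> = \<dots>" .
    moreover have "(r * \<rho>) powr (2 * k) * (r * \<rho>) powr 1 = (r * \<rho>) powr (2 * k + 1)"
      by (simp only: powr_add)
    moreover have "D v powr (- k) * D v powr (- 1) = D v powr (- k - 1)"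
      by (simp only: powr_add[symmetric]) simp
    ultimately show ?thesis by (simp only: mult.assoc)
  qed
  define I where "I = (\<integral>\<^sup>+y\<in>{0<..<\<rho>\<^sup>2}. ennreal (f y) \<partial>lborel)"
  define C where "C = ennreal (2 * (r * \<rho>) powr (2 * k + 1))"
  have part: "I = C * (\<integral>\<^sup>+v\<in>S. ennreal (?K v) \<partial>lborel)"
    if S: "S \<in> sets borel" "S \<subseteq> {-1<..<1} - {c}" "bij_betw \<psi> S {0<..<\<rho>\<^sup>2}" for S
  proof -
    have [measurable]: "S \<in> sets borel" by fact
    have "I = (\<integral>\<^sup>+v\<in>S. ennreal (f (\<psi> v)) * ennreal \<bar>\<psi>' v\<bar> \<partial>lborel)"
      unfolding I_def
      by (rule nn_integral_subst) (use S in \<open>auto intro!: DERIV_subset[OF der]\<close>)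
    also have "\<dots> = (\<integral>\<^sup>+v. C * (ennreal (?K v) * indicator S v) \<partial>lborel)"
    proof (rule nn_integral_cong)
      fix v
      have "ennreal (f (\<psi> v)) * ennreal \<bar>\<psi>' v\<bar> = C * ennreal (?K v)" if "v \<in> S"
      proof -
        have "ennreal (f (\<psi> v)) * ennreal \<bar>\<psi>' v\<bar> = ennreal (f (\<psi> v) * \<bar>\<psi>' v\<bar>)"
          by (simp add: ennreal_mult'')
        also have "\<dots> = C * ennreal (?K v)"
          using that S by (subst key) (auto simp: C_def ennreal_mult'')
        finally show ?thesis .
      qed
      then show "ennreal (f (\<psi> v)) * ennreal \<bar>\<psi>' v\<bar> * indicator S v = C * (ennreal (?K v) * indicator S v)"
        by (auto simp: indicator_def)
    qed
    finally show ?thesis by (simp add: nn_integral_cmult)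
  qed
  have "(\<integral>\<^sup>+v\<in>{-1<..<1}. ennreal (?K v) \<partial>lborel) =
    (\<integral>\<^sup>+v. ennreal (?K v) * indicator {-1<..<c} v + ennreal (?K v) * indicator {c<..<1} v \<partial>lborel)"
    by (rule nn_integral_cong_AE, rule AE_mp[OF AE_lborel_singleton[of c]])
       (use c in \<open>auto simp: indicator_def\<close>)
  also have "\<dots> = (\<integral>\<^sup>+v\<in>{-1<..<c}. ennreal (?K v) \<partial>lborel) + (\<integral>\<^sup>+v\<in>{c<..<1}. ennreal (?K v) \<partial>lborel)"
    by (rule nn_integral_add) measurable
  finally have "(\<integral>\<^sup>+v\<in>{-1<..<1}. ennreal (?K v) \<partial>lborel) =
    (\<integral>\<^sup>+v\<in>{-1<..<c}. ennreal (?K v) \<partial>lborel) + (\<integral>\<^sup>+v\<in>{c<..<1}. ennreal (?K v) \<partial>lborel)" .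
  \<comment> \<open>The branches to the left and to the right of \<open>c\<close> sweep the same
    interval and contribute equally.\<close>
  then have "C * (\<integral>\<^sup>+v\<in>{-1<..<1}. ennreal (?K v) \<partial>lborel) = I + I"
  proof -
    assume *: "(\<integral>\<^sup>+v\<in>{-1<..<1}. ennreal (?K v) \<partial>lborel) =
      (\<integral>\<^sup>+v\<in>{-1<..<c}. ennreal (?K v) \<partial>lborel) + (\<integral>\<^sup>+v\<in>{c<..<1}. ennreal (?K v) \<partial>lborel)"
    have i1: "I = C * (\<integral>\<^sup>+v\<in>{-1<..<c}. ennreal (?K v) \<partial>lborel)"
    proof (rule part[OF _ _ b1])
      show "{-1<..<c} \<subseteq> {-1<..<1} - {c}" using c by auto
    qed simp
    have i2: "I = C * (\<integral>\<^sup>+v\<in>{c<..<1}. ennreal (?K v) \<partial>lborel)"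
    proof (rule part[OF _ _ b2])
      show "{c<..<1} \<subseteq> {-1<..<1} - {c}" using c by auto
    qed simp
    show ?thesis unfolding * distrib_left i1[symmetric] i2[symmetric] ..
  qed
  then have e1: "C * (\<integral>\<^sup>+v\<in>{-1<..<1}. ennreal (?K v) \<partial>lborel) = 2 * I" by (simp only: mult_2)
  define a where "a = (r * \<rho>) powr (- 2 * k - 1)"
  have a0: "a \<ge> 0" by (simp add: a_def)
  have e2: "ennreal (a / 2) * C = 1"
  proof -
    have "a * (r * \<rho>) powr (2 * k + 1) = 1"
      unfolding a_def powr_add[symmetric] using r0 \<rho> by simp
    then have "a / 2 * (2 * (r * \<rho>) powr (2 * k + 1)) = 1" by simp
    moreover have "ennreal (a / 2) * C = ennreal (a / 2 * (2 * (r * \<rho>) powr (2 * k + 1)))"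
      unfolding C_def by (rule ennreal_mult[symmetric]) (use a0 in simp_all)
    ultimately show ?thesis by (simp only: ennreal_1)
  qed
  have e3: "ennreal (a / 2) * 2 = ennreal a"
  proof -
    have "ennreal (a / 2) * ennreal 2 = ennreal (a / 2 * 2)"
      by (rule ennreal_mult[symmetric]) (use a0 in simp_all)
    then show ?thesis by simp
  qed
  have "(\<integral>\<^sup>+v\<in>{-1<..<1}. ennreal (?K v) \<partial>lborel) = (ennreal (a / 2) * C) * (\<integral>\<^sup>+v\<in>{-1<..<1}. ennreal (?K v) \<partial>lborel)"
    unfolding e2 by (rule mult_1[symmetric])
  also have "\<dots> = ennreal (a / 2) * (2 * I)"
    by (simp only: mult.assoc e1)
  also have "\<dots> = ennreal a * I"
    by (simp only: mult.assoc[symmetric] e3)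
  finally have "(\<integral>\<^sup>+v\<in>{-1<..<1}. ennreal (?K v) \<partial>lborel) = ennreal ((r * \<rho>) powr (- 2 * k - 1)) * I"
    unfolding a_def .
  then show ?thesis unfolding D_def I_def f_def .
qed

lemma nn_integral_copson:
  fixes r \<rho> k :: real
  assumes "0 < \<rho>" "0 < r" "r \<noteq> \<rho>"
  shows "(\<integral>\<^sup>+v\<in>{-1<..<1}. ennreal ((1 - v\<^sup>2) powr k * (r\<^sup>2 + \<rho>\<^sup>2 - 2 * r * \<rho> * v) powr (- k - 1)) \<partial>lborel) =
    ennreal ((r * \<rho>) powr (- 2 * k - 1)) *
      (\<integral>\<^sup>+y\<in>{0<..<min (r\<^sup>2) (\<rho>\<^sup>2)}. ennreal (y powr k / sqrt ((r\<^sup>2 - y) * (\<rho>\<^sup>2 - y))) \<partial>lborel)"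
proof (cases "\<rho> < r")
  case True
  then have "min (r\<^sup>2) (\<rho>\<^sup>2) = \<rho>\<^sup>2" using assms by (simp add: min_absorb2 power_mono)
  with nn_integral_copson_less[OF assms(1) True, of k] show ?thesis by simp
next
  case False
  then have "r < \<rho>" using assms by simp
  have *: "min (r\<^sup>2) (\<rho>\<^sup>2) = r\<^sup>2" using False assms by (simp add: min_absorb1 power_mono)
  have "\<rho>\<^sup>2 + r\<^sup>2 - 2 * \<rho> * r * v = r\<^sup>2 + \<rho>\<^sup>2 - 2 * r * \<rho> * v" "\<rho> * r = r * \<rho>"
    "(\<rho>\<^sup>2 - y) * (r\<^sup>2 - y) = (r\<^sup>2 - y) * (\<rho>\<^sup>2 - y)" for v y by simp_all
  then show ?thesis
    unfolding * using nn_integral_copson_less[OF assms(2) \<open>r < \<rho>\<close>, of k] by (simp only:)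
qed

text \<open>Stereographic projection from the North Pole onto the equatorial hyperplane sends height
  p to radius sqrt (p / (1 - p)), and |x - y|^2 = 4 * (1 - p) * (1 - q) * |X - Y|^2 for the images
  X, Y. The bracket on the left is |x - y|^2 / 4, so the average becomes the flat one; y = t / (1 -
  t) turns squared radii back into heights.\<close>

lemma nn_integral_copson_cap:
  fixes p q k :: real
  assumes p: "0 < p" "p < 1" and q: "0 < q" "q < 1" and pq: "p \<noteq> q"
  shows "(\<integral>\<^sup>+v\<in>{-1<..<1}. ennreal ((1 - v\<^sup>2) powr k *
        (p + q - 2 * p * q - 2 * sqrt (p * (1 - p) * (q * (1 - q))) * v) powr (- k - 1)) \<partial>lborel) =
    ennreal ((p * q) powr (- k - 1/2)) *
      (\<integral>\<^sup>+t\<in>{0<..<min p q}. ennreal (t powr k * (1 - t) powr (- k - 1) / sqrt ((p - t) * (q - t))) \<partial>lborel)"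
proof -
  define r \<rho> where "r = sqrt (p / (1 - p))" and "\<rho> = sqrt (q / (1 - q))"
  define m where "m = (1 - p) * (1 - q)"
  have m: "m > 0" using p q by (simp add: m_def)
  have r2: "r\<^sup>2 = p / (1 - p)" "\<rho>\<^sup>2 = q / (1 - q)" using p q by (simp_all add: r_def \<rho>_def)
  have pos: "r > 0" "\<rho> > 0" using p q by (simp_all add: r_def \<rho>_def)
  have "r\<^sup>2 \<noteq> \<rho>\<^sup>2" unfolding r2 using p q pq by (simp add: field_simps)
  then have ne: "r \<noteq> \<rho>" by auto
  have rr: "r * \<rho> = sqrt (p * q) / sqrt m" by (simp add: r_def \<rho>_def m_def real_sqrt_divide real_sqrt_mult)
  have E: "p + q - 2 * p * q - 2 * sqrt (p * (1 - p) * (q * (1 - q))) * v = m * (r\<^sup>2 + \<rho>\<^sup>2 - 2 * r * \<rho> * v)" for v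
  proof -
    have "m * (r * \<rho>) = sqrt (p * (1 - p) * (q * (1 - q)))"
    proof -
      have "m * (r * \<rho>) = sqrt m * sqrt m * (sqrt (p * q) / sqrt m)" using m rr by simp
      also have "\<dots> = sqrt m * sqrt (p * q)" using m by (simp del: real_sqrt_mult_self)
      also have "\<dots> = sqrt (p * (1 - p) * (q * (1 - q)))" by (simp add: m_def real_sqrt_mult)
      finally show ?thesis .
    qed
    moreover have "m * r\<^sup>2 = p * (1 - q)" "m * \<rho>\<^sup>2 = q * (1 - p)" using p q by (simp_all add: r2 m_def)
    moreover have "m * (r\<^sup>2 + \<rho>\<^sup>2 - 2 * r * \<rho> * v) = m * r\<^sup>2 + m * \<rho>\<^sup>2 - 2 * (m * (r * \<rho>)) * v"
      by (simp add: algebra_simps)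
    ultimately have "m * (r\<^sup>2 + \<rho>\<^sup>2 - 2 * r * \<rho> * v) = p * (1 - q) + q * (1 - p) - 2 * sqrt (p * (1 - p) * (q * (1 - q))) * v"
      by (simp only:)
    then show ?thesis by (simp add: algebra_simps)
  qed
  have D0: "r\<^sup>2 + \<rho>\<^sup>2 - 2 * r * \<rho> * v > 0" if "v < 1" for v
  proof -
    have "0 < (r - \<rho>)\<^sup>2" using ne by simp
    also have "\<dots> \<le> r\<^sup>2 + \<rho>\<^sup>2 - 2 * r * \<rho> * v"
      using that pos by (simp add: power2_diff)
    finally show ?thesis .
  qed
  have "(\<integral>\<^sup>+v\<in>{-1<..<1}. ennreal ((1 - v\<^sup>2) powr k *
        (p + q - 2 * p * q - 2 * sqrt (p * (1 - p) * (q * (1 - q))) * v) powr (- k - 1)) \<partial>lborel) =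
    (\<integral>\<^sup>+v. ennreal (m powr (- k - 1)) * (ennreal ((1 - v\<^sup>2) powr k * (r\<^sup>2 + \<rho>\<^sup>2 - 2 * r * \<rho> * v) powr (- k - 1)) * indicator {-1<..<1} v) \<partial>lborel)"
    unfolding E
    by (rule nn_integral_cong)
       (use m D0 in \<open>auto simp: indicator_def powr_mult ennreal_mult'[symmetric] mult_ac less_imp_le\<close>)
  also have "\<dots> = ennreal (m powr (- k - 1)) * (ennreal ((r * \<rho>) powr (- 2 * k - 1)) *
      (\<integral>\<^sup>+y\<in>{0<..<min (r\<^sup>2) (\<rho>\<^sup>2)}. ennreal (y powr k / sqrt ((r\<^sup>2 - y) * (\<rho>\<^sup>2 - y))) \<partial>lborel))"
    using nn_integral_copson[OF pos(2,1) ne, of k] by (subst nn_integral_cmult) simp_all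
  also have "(\<integral>\<^sup>+y\<in>{0<..<min (r\<^sup>2) (\<rho>\<^sup>2)}. ennreal (y powr k / sqrt ((r\<^sup>2 - y) * (\<rho>\<^sup>2 - y))) \<partial>lborel) =
    (\<integral>\<^sup>+t\<in>{0<..<min p q}. ennreal ((t / (1 - t)) powr k / sqrt ((r\<^sup>2 - t / (1 - t)) * (\<rho>\<^sup>2 - t / (1 - t)))) * ennreal \<bar>1 / (1 - t)\<^sup>2\<bar> \<partial>lborel)"
  proof (rule nn_integral_subst)
    fix t assume "t \<in> {0<..<min p q}"
    then show "((\<lambda>t. t / (1 - t)) has_real_derivative 1 / (1 - t)\<^sup>2) (at t within {0<..<min p q})"
      using p q by (auto intro!: derivative_eq_intros simp: power2_eq_square field_simps)
  next
    show "bij_betw (\<lambda>t. t / (1 - t)) {0<..<min p q} {0<..<min (r\<^sup>2) (\<rho>\<^sup>2)}"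
    proof -
      have "bij_betw (\<lambda>t. t / (1 - t)) {0<..<min p q} {0 / (1 - 0) <..<min p q / (1 - min p q)}"
        by (rule bij_betw_open_interval_increasing[where f'="\<lambda>t. 1 / (1 - t)\<^sup>2"])
           (use p q in \<open>auto intro!: continuous_intros derivative_eq_intros simp: power2_eq_square[symmetric] divide_simps\<close>)
      moreover have "min p q / (1 - min p q) = min (r\<^sup>2) (\<rho>\<^sup>2)"
        unfolding r2 using p q by (auto simp: min_def field_simps)
      ultimately show ?thesis by simp
    qed
  qed measurable
  also have "\<dots> = (\<integral>\<^sup>+t. ennreal (sqrt m) * (ennreal (t powr k * (1 - t) powr (- k - 1) / sqrt ((p - t) * (q - t))) * indicator {0<..<min p q} t) \<partial>lborel)"
  proof (rule nn_integral_cong)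
    fix t
    have "(t / (1 - t)) powr k / sqrt ((r\<^sup>2 - t / (1 - t)) * (\<rho>\<^sup>2 - t / (1 - t))) * (1 / (1 - t)\<^sup>2) =
      sqrt m * (t powr k * (1 - t) powr (- k - 1) / sqrt ((p - t) * (q - t)))" if t: "0 < t" "t < p" "t < q"
    proof -
      have t1: "1 - t > 0" using t p by simp
      have a: "r\<^sup>2 - t / (1 - t) = (p - t) / ((1 - p) * (1 - t))" "\<rho>\<^sup>2 - t / (1 - t) = (q - t) / ((1 - q) * (1 - t))"
        unfolding r2 using p q t1 by (simp_all add: field_simps)
      have "(r\<^sup>2 - t / (1 - t)) * (\<rho>\<^sup>2 - t / (1 - t)) = ((p - t) * (q - t)) / (m * (1 - t)\<^sup>2)"
        unfolding a m_def by (simp add: power2_eq_square)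
      then have b: "sqrt ((r\<^sup>2 - t / (1 - t)) * (\<rho>\<^sup>2 - t / (1 - t))) = sqrt ((p - t) * (q - t)) / (sqrt m * (1 - t))"
        using t1 by (simp add: real_sqrt_divide real_sqrt_mult)
      have c: "(t / (1 - t)) powr k = t powr k * (1 - t) powr (- k)"
        using t t1 by (simp add: powr_divide powr_minus_divide)
      have d: "(1 - t) powr (- k - 1) = (1 - t) powr (- k) / (1 - t)"
        using t1 by (simp add: powr_diff)
      have "x * y / (S / (M * c)) * (1 / c\<^sup>2) = M * (x * (y / c) / S)" if "M \<noteq> 0" "c \<noteq> 0" for x y S M c :: real
        using that by (cases "S = 0") (simp_all add: power2_eq_square field_simps)
      then show ?thesis unfolding b c d using t1 m by simp
    qed
    then show "ennreal ((t / (1 - t)) powr k / sqrt ((r\<^sup>2 - t / (1 - t)) * (\<rho>\<^sup>2 - t / (1 - t)))) * ennreal \<bar>1 / (1 - t)\<^sup>2\<bar> * indicator {0<..<min p q} t =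
      ennreal (sqrt m) * (ennreal (t powr k * (1 - t) powr (- k - 1) / sqrt ((p - t) * (q - t))) * indicator {0<..<min p q} t)"
      using m by (auto simp: indicator_def ennreal_mult''[symmetric] ennreal_mult'[symmetric])
  qed
  also have "\<dots> = ennreal (sqrt m) * (\<integral>\<^sup>+t\<in>{0<..<min p q}. ennreal (t powr k * (1 - t) powr (- k - 1) / sqrt ((p - t) * (q - t))) \<partial>lborel)"
    by (subst nn_integral_cmult) simp_all
  also have "ennreal (m powr (- k - 1)) * (ennreal ((r * \<rho>) powr (- 2 * k - 1)) * (ennreal (sqrt m) * x)) =
    ennreal ((p * q) powr (- k - 1/2)) * x" for x
  proof -
    have "(r * \<rho>) powr (- 2 * k - 1) = (p * q) powr (- k - 1/2) * m powr (k + 1/2)"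
    proof -
      have "r * \<rho> = ((p * q) * m powr (-1)) powr (1/2)"
      proof -
        have "r * \<rho> = sqrt (p * q / m)" by (simp add: rr real_sqrt_divide)
        also have "p * q / m = p * q * m powr (-1)" using m by (simp add: powr_minus_divide)
        also have "sqrt \<dots> = \<dots> powr (1/2)" by (rule powr_half_sqrt[symmetric]) (use p q in simp)
        finally show ?thesis .
      qed
      then have "(r * \<rho>) powr (- 2 * k - 1) = (p * q * m powr (-1)) powr (1/2 * (- 2 * k - 1))"
        by (simp only: powr_powr)
      also have "1/2 * (- 2 * k - 1) = - k - 1/2" by simp
      also have "(p * q * m powr (-1)) powr (- k - 1/2) = (p * q) powr (- k - 1/2) * m powr (-1 * (- k - 1/2))"
        using p q by (simp only: powr_mult powr_ge_zero mult_nonneg_nonneg less_imp_le powr_powr)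
      finally show ?thesis by (simp add: add.commute)
    qed
    then have "m powr (- k - 1) * (r * \<rho>) powr (- 2 * k - 1) * sqrt m =
      (p * q) powr (- k - 1/2) * (m powr (- k - 1) * m powr (k + 1/2) * m powr (1/2))"
      using m by (simp add: powr_half_sqrt)
    also have "m powr (- k - 1) * m powr (k + 1/2) * m powr (1/2) = 1"
      using m by (simp add: powr_add[symmetric])
    finally have "ennreal (m powr (- k - 1)) * ennreal ((r * \<rho>) powr (- 2 * k - 1)) * ennreal (sqrt m) = ennreal ((p * q) powr (- k - 1/2))"
      using m by (simp add: ennreal_mult[symmetric])
    then show ?thesis by (metis mult.assoc)
  qed
  finally show ?thesis .
qed

section \<open>Positive definiteness of the kernel\<close>

text \<open>Monomials are indexed by words rather than exponents: over words, (x \<bullet> y) ^ j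
  becomes a plain sum of products, with no multinomial coefficients.\<close>

definition monom_fun :: "'a::euclidean_space list \<Rightarrow> 'a \<Rightarrow> real" where
  "monom_fun l x = (\<Prod>b\<leftarrow>l. x \<bullet> b)"

definition basis_words :: "nat \<Rightarrow> 'a::euclidean_space list set" where
  "basis_words j = {l. set l \<subseteq> Basis \<and> length l = j}"

lemma finite_basis_words [simp]: "finite (basis_words j)"
  unfolding basis_words_def by (rule finite_lists_length_eq) simp

lemma inner_power_basis_words:
  fixes x y :: "'a::euclidean_space"
  shows "(x \<bullet> y) ^ j = (\<Sum>l\<in>basis_words j. monom_fun l x * monom_fun l y)"
proof (induction j)
  case 0
  have "basis_words 0 = {[] :: 'a list}" by (auto simp: basis_words_def)
  then show ?case by (simp add: monom_fun_def)
next
  case (Suc j)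
  have eq: "basis_words (Suc j) = (\<lambda>(b, l). b # l) ` (Basis \<times> basis_words j :: ('a \<times> 'a list) set)"
    unfolding basis_words_def by (auto simp: length_Suc_conv image_iff)
  have inj: "inj_on (\<lambda>(b, l). b # l) (Basis \<times> basis_words j :: ('a \<times> 'a list) set)"
    by (auto simp: inj_on_def)
  have "(x \<bullet> y) ^ Suc j = (\<Sum>b\<in>Basis. (x \<bullet> b) * (y \<bullet> b)) * (\<Sum>l\<in>basis_words j. monom_fun l x * monom_fun l y)"
    by (simp add: Suc flip: euclidean_inner)
  also have "\<dots> = (\<Sum>(b, l)\<in>Basis \<times> basis_words j. monom_fun (b # l) x * monom_fun (b # l) y)"
    by (simp add: sum_product sum.cartesian_product monom_fun_def mult_ac)
  also have "\<dots> = (\<Sum>l\<in>basis_words (Suc j). monom_fun l x * monom_fun l y)"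
    unfolding eq by (subst sum.reindex[OF inj]) (simp add: case_prod_unfold)
  finally show ?case .
qed

lemma continuous_monom_fun [continuous_intros]: "continuous_on S (monom_fun l)"
  unfolding monom_fun_def[abs_def] by (induction l) (auto intro!: continuous_intros)

lemma unit_measuresD:
  assumes "\<mu> \<in> unit_measures"
  shows "prob_space \<mu>" "space \<mu> = sphere 0 1" "sets \<mu> = sets (restrict_space borel (sphere 0 1))"
  using assms sets_eq_imp_space_eq[of \<mu> "restrict_space borel (sphere 0 1)"]
  by (auto simp: unit_measures_def space_restrict_space)

lemma unit_measures_measurable:
  assumes "\<mu> \<in> unit_measures" "f \<in> borel_measurable borel"
  shows "f \<in> borel_measurable \<mu>"
  using measurable_restrict_space1[OF assms(2), of "sphere 0 1"]
    measurable_cong_sets[OF unit_measuresD(3)[OF assms(1)] refl] by auto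

lemma unit_measures_integrable_bounded:
  fixes f :: "'a::euclidean_space \<Rightarrow> real"
  assumes \<mu>: "\<mu> \<in> unit_measures" and f: "f \<in> borel_measurable borel"
    and B: "\<And>x. x \<in> sphere 0 1 \<Longrightarrow> \<bar>f x\<bar> \<le> B"
  shows "integrable \<mu> f"
proof -
  interpret prob_space \<mu> using unit_measuresD(1)[OF \<mu>] .
  show ?thesis
    by (rule integrable_const_bound[where B=B])
       (use unit_measures_measurable[OF \<mu> f] B unit_measuresD(2)[OF \<mu>] in auto)
qed

lemma unit_measures_integrable:
  fixes f :: "'a::euclidean_space \<Rightarrow> real"
  assumes \<mu>: "\<mu> \<in> unit_measures" and f: "continuous_on UNIV f"
  shows "integrable \<mu> f"
proof -
  have "bounded (f ` sphere 0 1)"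
    using f by (intro compact_imp_bounded compact_continuous_image) (auto intro: continuous_on_subset)
  then obtain B where "\<And>x. x \<in> sphere 0 1 \<Longrightarrow> \<bar>f x\<bar> \<le> B" unfolding bounded_real by blast
  with \<mu> f show ?thesis by (intro unit_measures_integrable_bounded borel_measurable_continuous_onI)
qed

text \<open>The linear span of the monomials, given inductively so that equality of integrals passes
  from monomials to all members by rule induction.\<close>

inductive_set monom_span :: "('a::euclidean_space \<Rightarrow> real) set" where
  monom: "set l \<subseteq> Basis \<Longrightarrow> monom_fun l \<in> monom_span"
| add: "f \<in> monom_span \<Longrightarrow> g \<in> monom_span \<Longrightarrow> (\<lambda>x. f x + g x) \<in> monom_span"
| scale: "f \<in> monom_span \<Longrightarrow> (\<lambda>x. c * f x) \<in> monom_span"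

lemma monom_span_zero: "(\<lambda>x. 0) \<in> monom_span"
  using monom_span.scale[OF monom_span.monom[of "[]"], of 0] by simp

lemma monom_span_sum:
  "finite A \<Longrightarrow> (\<And>a. a \<in> A \<Longrightarrow> f a \<in> monom_span) \<Longrightarrow> (\<lambda>x. \<Sum>a\<in>A. f a x) \<in> monom_span"
  by (induction A rule: finite_induct) (auto intro: monom_span_zero monom_span.add)

lemma monom_span_coordinate:
  assumes "f \<in> monom_span" "b \<in> Basis"
  shows "(\<lambda>x. (x \<bullet> b) * f x) \<in> monom_span"
  using assms
proof induction
  case (monom l)
  have "(\<lambda>x. (x \<bullet> b) * monom_fun l x) = monom_fun (b # l)" by (simp add: fun_eq_iff monom_fun_def)
  with monom show ?case by (auto intro!: monom_span.monom)
next
  case (add f g)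
  then show ?case using monom_span.add[of "\<lambda>x. (x \<bullet> b) * f x" "\<lambda>x. (x \<bullet> b) * g x"] by (simp add: distrib_left)
next
  case (scale f c)
  then show ?case using monom_span.scale[of "\<lambda>x. (x \<bullet> b) * f x" c] by (simp add: mult_ac)
qed

lemma real_polynomial_function_monom_span:
  fixes g :: "'a::euclidean_space \<Rightarrow> real"
  assumes "real_polynomial_function g"
  shows "g \<in> monom_span"
proof -
  \<comment> \<open>Strengthened to a statement about multiplication by \<open>g\<close>: the
    product case then is composition of two such multiplications, and products inside the span never
    have to be expanded.\<close>
  have "\<forall>h\<in>monom_span. (\<lambda>x. g x * h x) \<in> monom_span"
    using assms
  proof induction
    case (linear f)
    show ?case
    proof
      fix h :: "'a \<Rightarrow> real" assume h: "h \<in> monom_span"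
      have *: "f x = (\<Sum>b\<in>Basis. (x \<bullet> b) * f b)" for x
      proof -
        have "f x = f (\<Sum>b\<in>Basis. (x \<bullet> b) *\<^sub>R b)" by (simp only: euclidean_representation)
        also have "\<dots> = (\<Sum>b\<in>Basis. f ((x \<bullet> b) *\<^sub>R b))"
          by (rule linear_sum[OF bounded_linear.linear[OF linear]])
        finally show ?thesis by (simp only: linear_scale[OF bounded_linear.linear[OF linear]] real_scaleR_def)
      qed
      have "(\<lambda>x. f x * h x) = (\<lambda>x. \<Sum>b\<in>Basis. f b * ((x \<bullet> b) * h x))"
        by (rule ext, subst *, unfold sum_distrib_right, rule sum.cong) simp_all
      then show "(\<lambda>x. f x * h x) \<in> monom_span"
        using h by (auto intro!: monom_span_sum monom_span.scale monom_span_coordinate)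
    qed
  next
    case (const c) then show ?case by (auto intro: monom_span.scale)
  next
    case (add f g) then show ?case by (auto simp: distrib_right intro!: monom_span.add)
  next
    case (mult f g) then show ?case by (auto simp: mult.assoc)
  qed
  from bspec[OF this monom_span.monom[of "[]"]] show ?thesis by (simp add: monom_fun_def)
qed

text \<open>Moments fix the integrals of polynomials, Stone-Weierstrass passes to continuous
  functions, and continuous functions decreasing to the indicator of a closed set fix the measure on
  an intersection-stable generator.\<close>

lemma unit_measures_eqI:
  fixes \<mu> \<nu> :: "'a::euclidean_space measure"
  assumes \<mu>: "\<mu> \<in> unit_measures" and \<nu>: "\<nu> \<in> unit_measures"
    and eq: "\<And>l. set l \<subseteq> Basis \<Longrightarrow> (\<integral>x. monom_fun l x \<partial>\<mu>) = (\<integral>x. monom_fun l x \<partial>\<nu>)"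
  shows "\<mu> = \<nu>"
proof -
  interpret \<mu>: prob_space \<mu> using unit_measuresD[OF \<mu>] by simp
  interpret \<nu>: prob_space \<nu> using unit_measuresD[OF \<nu>] by simp
  have span: "continuous_on UNIV f \<and> (\<integral>x. f x \<partial>\<mu>) = (\<integral>x. f x \<partial>\<nu>)" if "f \<in> monom_span" for f
    using that
  proof induction
    case (monom l) then show ?case using eq by (simp add: continuous_monom_fun)
  next
    case (add f g) then show ?case
      using unit_measures_integrable[OF \<mu>] unit_measures_integrable[OF \<nu>] by (auto intro!: continuous_intros)
  next
    case (scale f c) then show ?case by (auto intro!: continuous_intros)
  qed
  have cont: "(\<integral>x. f x \<partial>\<mu>) = (\<integral>x. f x \<partial>\<nu>)" if f: "continuous_on UNIV f" for f :: "'a \<Rightarrow> real"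
  proof -
    have "\<bar>(\<integral>x. f x \<partial>\<mu>) - (\<integral>x. f x \<partial>\<nu>)\<bar> \<le> e" if "e > 0" for e
    proof -
      have "continuous_on (sphere 0 1) f" using f continuous_on_subset by blast
      then obtain g where g: "real_polynomial_function g" "\<And>x. x \<in> sphere 0 1 \<Longrightarrow> \<bar>f x - g x\<bar> < e / 2"
        using Stone_Weierstrass_real_polynomial_function[of "sphere 0 1" f "e / 2"] \<open>e > 0\<close> by auto
      have gs: "continuous_on UNIV g" "(\<integral>x. g x \<partial>\<mu>) = (\<integral>x. g x \<partial>\<nu>)"
        using span[OF real_polynomial_function_monom_span[OF g(1)]] by auto
      have close: "\<bar>(\<integral>x. f x \<partial>M) - (\<integral>x. g x \<partial>M)\<bar> \<le> e / 2" if M: "M \<in> unit_measures" for M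
      proof -
        interpret M: prob_space M using unit_measuresD[OF M] by simp
        have i: "integrable M f" "integrable M g"
          using unit_measures_integrable[OF M] f gs by auto
        have "\<bar>(\<integral>x. f x \<partial>M) - (\<integral>x. g x \<partial>M)\<bar> = \<bar>\<integral>x. f x - g x \<partial>M\<bar>" using i by simp
        also have "\<dots> \<le> (\<integral>x. \<bar>f x - g x\<bar> \<partial>M)" by (rule integral_abs_bound)
        also have "\<dots> \<le> (\<integral>x. e / 2 \<partial>M)"
          using i g(2) unit_measuresD(2)[OF M] by (intro integral_mono) (auto intro: less_imp_le)
        also have "\<dots> = e / 2" by (simp add: M.prob_space)
        finally show ?thesis .
      qed
      from close[OF \<mu>] close[OF \<nu>] gs(2) show ?thesis by linarith
    qed
    then show ?thesis by (metis abs_le_zero_iff dense_ge eq_iff_diff_eq_0)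
  qed
  have closed: "measure \<mu> (C \<inter> sphere 0 1) = measure \<nu> (C \<inter> sphere 0 1)" if C: "closed C" for C :: "'a set"
  proof (cases "C = {}")
    case False
    \<comment> \<open>Decreases to the indicator of \<open>C\<close>: at distance r > 0 from
      \<open>C\<close> it vanishes as soon as n * r \<ge> 1.\<close>
    define f where "f n x = max 0 (1 - real n * infdist x C)" for n and x :: 'a
    have fc: "continuous_on UNIV (f n)" for n
      unfolding f_def by (intro continuous_intros)
    have lim: "(\<lambda>n. f n x) \<longlonglongrightarrow> indicator C x" for x
    proof (cases "x \<in> C")
      case True then show ?thesis by (simp add: f_def)
    next
      case x: False
      then have pos: "infdist x C > 0"
        using C False in_closed_iff_infdist_zero infdist_nonneg by (metis order_le_less)
      obtain N where N: "real N * infdist x C > 1"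
        using reals_Archimedean3[OF pos] by blast
      have "f n x = 0" if "n \<ge> N" for n
      proof -
        have "real N * infdist x C \<le> real n * infdist x C"
          using that pos by (intro mult_right_mono) auto
        then show ?thesis using N by (simp add: f_def)
      qed
      then have "eventually (\<lambda>n. f n x = 0) sequentially" by (auto simp: eventually_sequentially)
      then show ?thesis using x by (simp add: tendsto_eventually)
    qed
    have L: "(\<lambda>n. \<integral>x. f n x \<partial>M) \<longlonglongrightarrow> measure M (C \<inter> sphere 0 1)" if M: "M \<in> unit_measures" for M
    proof -
      interpret M: prob_space M using unit_measuresD[OF M] by simp
      have "(\<lambda>n. \<integral>x. f n x \<partial>M) \<longlonglongrightarrow> (\<integral>x. indicator C x \<partial>M)"
      proof (rule integral_dominated_convergence[where w="\<lambda>_. 1"])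
        show "\<And>n. AE x in M. norm (f n x) \<le> 1"
          by (auto simp: f_def infdist_nonneg intro!: AE_I2)
        show "indicat_real C \<in> borel_measurable M"
          using C by (intro unit_measures_measurable[OF M]) auto
        show "\<And>n. f n \<in> borel_measurable M"
          using fc by (intro unit_measures_measurable[OF M] borel_measurable_continuous_onI)
      qed (use lim in auto)
      then show ?thesis using unit_measuresD(2)[OF M] by (simp add: Int_commute)
    qed
    show ?thesis
      by (rule LIMSEQ_unique[OF L[OF \<mu>, unfolded cont[OF fc]] L[OF \<nu>]])
  qed simp
  \<comment> \<open>The measures are pushed forward to the whole space, where the closed sets
    generate the sigma-algebra; on subsets of the sphere the push-forward has the same
    values.\<close>
  have "distr \<mu> borel (\<lambda>x. x) = distr \<nu> borel (\<lambda>x. x)"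
  proof (rule measure_eqI_generator_eq[where \<Omega>=UNIV and E="Collect closed" and A="\<lambda>_. UNIV"])
    have m: "(\<lambda>x. x) \<in> measurable \<mu> borel" "(\<lambda>x. x) \<in> measurable \<nu> borel"
      by (rule unit_measures_measurable[OF \<mu>], simp) (rule unit_measures_measurable[OF \<nu>], simp)
    show "Int_stable (Collect closed :: 'a set set)" by (auto simp: Int_stable_def)
    show "sets (distr \<mu> borel (\<lambda>x. x)) = sigma_sets UNIV (Collect closed)"
      "sets (distr \<nu> borel (\<lambda>x. x)) = sigma_sets UNIV (Collect closed)"
      by (simp_all add: borel_eq_closed)
    show "emeasure (distr \<mu> borel (\<lambda>x. x)) X = emeasure (distr \<nu> borel (\<lambda>x. x)) X" if "X \<in> Collect closed" for X
      using that closed[of X] m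
      by (simp add: emeasure_distr unit_measuresD(2)[OF \<mu>] unit_measuresD(2)[OF \<nu>] \<mu>.emeasure_eq_measure \<nu>.emeasure_eq_measure)
    show "emeasure (distr \<mu> borel (\<lambda>x. x)) UNIV \<noteq> \<infinity>"
      using m(1) by (simp add: emeasure_distr \<mu>.emeasure_eq_measure)
  qed auto
  note D = this
  show ?thesis
  proof (rule measure_eqI)
    show "sets \<mu> = sets \<nu>" using unit_measuresD(3)[OF \<mu>] unit_measuresD(3)[OF \<nu>] by simp
    fix A assume A: "A \<in> sets \<mu>"
    then have A': "A \<in> sets borel" "A \<subseteq> sphere 0 1"
      unfolding unit_measuresD(3)[OF \<mu>] by (auto simp: sets_restrict_space)
    have "emeasure M A = emeasure (distr M borel (\<lambda>x. x)) A" if M: "M \<in> unit_measures" for M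
    proof -
      have "(\<lambda>x. x) \<in> measurable M borel" by (rule unit_measures_measurable[OF M]) simp
      then have "emeasure (distr M borel (\<lambda>x. x)) A = emeasure M (A \<inter> space M)"
        using A'(1) by (simp add: emeasure_distr)
      also have "A \<inter> space M = A" using A'(2) unit_measuresD(2)[OF M] by auto
      finally show ?thesis ..
    qed
    from this[OF \<mu>] this[OF \<nu>] D show "emeasure \<mu> A = emeasure \<nu> A" by simp
  qed
qed

section \<open>The kernel as a power series, the energy as a sum of squares\<close>

definition mutual_energy :: "'a::euclidean_space measure \<Rightarrow> 'a measure \<Rightarrow> ennreal" where
  "mutual_energy \<mu> \<nu> = (\<integral>\<^sup>+ x. (\<integral>\<^sup>+ y. inverse (ennreal (norm (x - y) ^ (DIM('a) - 2))) \<partial>\<nu>) \<partial>\<mu>)"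

lemma energy_eq_mutual: "energy \<mu> = mutual_energy \<mu> \<mu>"
  by (simp add: energy_def mutual_energy_def)

lemma sums_pochhammer_powr:
  fixes w p :: real
  assumes "0 \<le> w" "w < 1"
  shows "(\<lambda>n. pochhammer p n / fact n * w ^ n) sums (1 - w) powr (- p)"
proof -
  have "(\<lambda>n. ((- p) gchoose n) * (- w) ^ n) sums (1 + - w) powr (- p)"
    by (rule gen_binomial_real) (use assms in simp)
  moreover have "((- p) gchoose n) * (- w) ^ n = pochhammer p n / fact n * w ^ n" for n
  proof -
    have "((- p) gchoose n) * (- w) ^ n = ((-1) ^ n * (-1) ^ n) * (pochhammer p n / fact n * w ^ n)"
      unfolding gbinomial_pochhammer by (subst power_minus) simp
    then show ?thesis by (simp flip: power_mult_distrib)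
  qed
  ultimately show ?thesis by simp
qed

text \<open>With w = (1 + x \<bullet> y) / 2 one has |x - y|^2 = 4 * (1 - w) on the sphere, so the
  kernel is (1 - w) powr (-(d - 2) / 2) / 2 ^ (d - 2); these are the coefficients of its binomial
  series.\<close>

definition kernel_coeff :: "nat \<Rightarrow> nat \<Rightarrow> real" where
  "kernel_coeff d n = pochhammer ((real d - 2) / 2) n / fact n / 2 ^ (d - 2)"

lemma kernel_coeff_pos: "d \<ge> 3 \<Longrightarrow> kernel_coeff d n > 0"
  unfolding kernel_coeff_def by (intro divide_pos_pos pochhammer_pos) auto

text \<open>All terms are nonnegative, unlike those of the expansion in powers of \<open>x \<bullet> y\<close>; this is why
  \<open>(1 + x \<bullet> y) / 2\<close> is used. On the diagonal both sides are infinite.\<close>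

lemma kernel_series:
  fixes x y :: "'a::euclidean_space"
  assumes x: "x \<in> sphere 0 1" and y: "y \<in> sphere 0 1" and d: "DIM('a) \<ge> 3"
  shows "inverse (ennreal (norm (x - y) ^ (DIM('a) - 2))) =
    (\<Sum>n. ennreal (kernel_coeff DIM('a) n) * ennreal (((1 + x \<bullet> y) / 2) ^ n))"
proof -
  define D p c where "D = DIM('a)" and "p = (real D - 2) / 2" and "c = kernel_coeff D"
  have p: "p > 0" using d by (simp add: p_def D_def)
  have c0: "c n \<ge> 0" for n using kernel_coeff_pos[of D n] d by (simp add: D_def c_def)
  have S: "(\<Sum>n. ennreal (c n) * ennreal (w ^ n)) = ennreal ((1 - w) powr (- p) / 2 ^ (D - 2))"
    if w: "0 \<le> w" "w < 1" for w
  proof -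
    have "(\<lambda>n. pochhammer p n / fact n * w ^ n / 2 ^ (D - 2)) sums ((1 - w) powr (- p) / 2 ^ (D - 2))"
      by (intro sums_divide sums_pochhammer_powr w)
    moreover have "c n * w ^ n = pochhammer p n / fact n * w ^ n / 2 ^ (D - 2)" for n
      by (simp add: c_def kernel_coeff_def p_def)
    ultimately have "(\<lambda>n. c n * w ^ n) sums ((1 - w) powr (- p) / 2 ^ (D - 2))" by (simp only:)
    then have "(\<Sum>n. ennreal (c n * w ^ n)) = ennreal ((1 - w) powr (- p) / 2 ^ (D - 2))"
      using c0 w by (intro suminf_ennreal_eq) auto
    then show ?thesis using c0 w by (simp add: ennreal_mult)
  qed
  have nn: "norm x = 1" "norm y = 1" using x y by auto
  have n2: "(norm (x - y))\<^sup>2 = 4 * (1 - (1 + x \<bullet> y) / 2)"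
    using nn by (simp add: power2_norm_eq_inner inner_diff norm_eq_1 inner_commute field_simps)
  have b: "\<bar>x \<bullet> y\<bar> \<le> 1" using Cauchy_Schwarz_ineq2[of x y] nn by simp
  show ?thesis
  proof (cases "x \<bullet> y < 1")
    case True
    define w where "w = (1 + x \<bullet> y) / 2"
    have w: "0 \<le> w" "w < 1" using True b by (auto simp: w_def)
    have "norm (x - y) = sqrt (4 * (1 - w))"
      using n2 by (metis norm_ge_zero real_sqrt_abs2 real_sqrt_unique w_def)
    also have "\<dots> = 2 * (1 - w) powr (1/2)" unfolding real_sqrt_mult using w by (simp add: powr_half_sqrt)
    finally have "norm (x - y) ^ (D - 2) = 2 ^ (D - 2) * ((1 - w) powr (1/2)) ^ (D - 2)"
      by (simp only: power_mult_distrib)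
    also have "((1 - w) powr (1/2)) ^ (D - 2) = (1 - w) powr p"
      using w d by (subst powr_realpow[symmetric]) (simp_all add: powr_powr p_def D_def of_nat_diff)
    finally have e: "norm (x - y) ^ (D - 2) = 2 ^ (D - 2) * (1 - w) powr p" .
    have "inverse (ennreal (norm (x - y) ^ (D - 2))) = ennreal ((1 - w) powr (- p) / 2 ^ (D - 2))"
      unfolding e using w by (simp add: inverse_ennreal powr_minus divide_inverse mult_ac)
    then show ?thesis using S[OF w] by (simp add: D_def c_def w_def)
  next
    case False
    with b have xy1: "x \<bullet> y = 1" by simp
    then have "x = y" using n2 by simp
    have "(\<Sum>n. ennreal (c n) * ennreal (1 ^ n)) = \<top>"
    proof (rule ccontr)
      assume "(\<Sum>n. ennreal (c n) * ennreal (1 ^ n)) \<noteq> \<top>"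
      then obtain K where K: "(\<Sum>n. ennreal (c n) * ennreal (1 ^ n)) = ennreal K" "K \<ge> 0"
        by (cases "(\<Sum>n. ennreal (c n) * ennreal (1 ^ n))") auto
      define K' where "K' = (K + 1) * 2 ^ (D - 2)"
      \<comment> \<open>If the sum at 1 were K, comparing it with the sum at the point w < 1 where
        (1 - w) powr (- p) = K' would give K + 1 \<le> K.\<close>
      define w where "w = 1 - K' powr (- 1 / p)"
      have K': "K' \<ge> 1" using K(2) mult_mono[of 1 "K + 1" 1 "2 ^ (D - 2)"] by (simp add: K'_def)
      have "K' powr (- 1 / p) \<le> 1" using K' p powr_mono[of "-1/p" 0 K'] by simp
      then have w: "0 \<le> w" "w < 1" using K' by (auto simp: w_def)
      have "(1 - w) powr (- p) = K'" using K' p by (simp add: w_def powr_powr)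
      then have "ennreal (K + 1) = (\<Sum>n. ennreal (c n) * ennreal (w ^ n))"
        using S[OF w] by (simp add: K'_def)
      also have "\<dots> \<le> (\<Sum>n. ennreal (c n) * ennreal (1 ^ n))"
        using w by (intro suminf_le mult_left_mono ennreal_leI power_mono) auto
      finally show False using K by simp
    qed
    then show ?thesis using \<open>x = y\<close> xy1 d by (simp add: D_def c_def)
  qed
qed

definition moment :: "'a::euclidean_space list \<Rightarrow> 'a measure \<Rightarrow> real" where
  "moment l \<mu> = (\<integral>x. monom_fun l x \<partial>\<mu>)"

text \<open>The double integral of ((1 + x \<bullet> y) / 2) ^ n, expanded by the binomial theorem
  and then into words. It is a real number, so differences can be formed, which
  \<open>ennreal\<close> energies do not permit.\<close>

definition moment_form :: "nat \<Rightarrow> 'a::euclidean_space measure \<Rightarrow> 'a measure \<Rightarrow> real" where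
  "moment_form n \<mu> \<nu> = (\<Sum>j\<le>n. real (n choose j) / 2 ^ n * (\<Sum>l\<in>basis_words j. moment l \<mu> * moment l \<nu>))"

text \<open>The inner integral is a polynomial \<open>h n\<close> in x. Since the integrand is
  nonnegative on the sphere, the same quantity can be read in \<open>ennreal\<close> and as a real
  integral.\<close>

lemma unit_measures_nn_integral_power:
  fixes \<mu> \<nu> :: "'a::euclidean_space measure"
  assumes \<mu>: "\<mu> \<in> unit_measures" and \<nu>: "\<nu> \<in> unit_measures"
  defines "h n x \<equiv> (\<Sum>j\<le>n. real (n choose j) / 2 ^ n * (\<Sum>l\<in>basis_words j. monom_fun l x * moment l \<nu>))"
  shows "x \<in> sphere 0 1 \<Longrightarrow> (\<integral>\<^sup>+y. ennreal (((1 + x \<bullet> y) / 2) ^ n) \<partial>\<nu>) = ennreal (h n x)"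
    and "x \<in> sphere 0 1 \<Longrightarrow> 0 \<le> h n x"
    and "continuous_on UNIV (h n)"
    and "(\<integral>\<^sup>+x. ennreal (h n x) \<partial>\<mu>) = ennreal (moment_form n \<mu> \<nu>)"
    and "0 \<le> moment_form n \<mu> \<nu>"
proof -
  have i\<nu>: "integrable \<nu> (monom_fun l)" and i\<mu>: "integrable \<mu> (monom_fun l)" for l
    by (auto intro!: unit_measures_integrable \<mu> \<nu> continuous_monom_fun)
  have e: "((1 + x \<bullet> y) / 2) ^ n = (\<Sum>j\<le>n. real (n choose j) / 2 ^ n * (\<Sum>l\<in>basis_words j. monom_fun l x * monom_fun l y))" for x y :: 'a
  proof -
    have "((1 + x \<bullet> y) / 2) ^ n = (x \<bullet> y + 1) ^ n / 2 ^ n" by (simp add: power_divide add.commute)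
    also have "\<dots> = (\<Sum>j\<le>n. real (n choose j) / 2 ^ n * (x \<bullet> y) ^ j)"
      by (simp add: binomial_ring sum_divide_distrib mult_ac)
    finally show ?thesis by (simp only: inner_power_basis_words)
  qed
  have int: "(\<integral>y. ((1 + x \<bullet> y) / 2) ^ n \<partial>\<nu>) = h n x" for x
    unfolding e h_def moment_def using i\<nu> by simp
  have nn: "0 \<le> ((1 + x \<bullet> y) / 2) ^ n" if "x \<in> sphere 0 1" "y \<in> sphere 0 1" for x y :: 'a
  proof -
    have "\<bar>x \<bullet> y\<bar> \<le> 1" using Cauchy_Schwarz_ineq2[of x y] that by simp
    then show ?thesis by (intro zero_le_power) auto
  qed
  have sp: "space \<nu> = sphere 0 1" "space \<mu> = sphere 0 1" using unit_measuresD \<mu> \<nu> by auto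
  show *: "(\<integral>\<^sup>+y. ennreal (((1 + x \<bullet> y) / 2) ^ n) \<partial>\<nu>) = ennreal (h n x)" if "x \<in> sphere 0 1" for x
  proof -
    have "integrable \<nu> (\<lambda>y. ((1 + x \<bullet> y) / 2) ^ n)"
      by (rule unit_measures_integrable[OF \<nu>]) (intro continuous_intros, simp)
    then have "(\<integral>\<^sup>+y. ennreal (((1 + x \<bullet> y) / 2) ^ n) \<partial>\<nu>) = ennreal (\<integral>y. ((1 + x \<bullet> y) / 2) ^ n \<partial>\<nu>)"
      by (rule nn_integral_eq_integral) (use nn[OF that] sp in auto)
    then show ?thesis by (simp only: int)
  qed
  show h0: "0 \<le> h n x" if "x \<in> sphere 0 1" for x
    unfolding int[symmetric] using nn[OF that] sp by (intro integral_nonneg_AE) auto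
  show hc: "continuous_on UNIV (h n)"
    unfolding h_def[abs_def] by (intro continuous_intros)
  have "(\<integral>x. h n x \<partial>\<mu>) = moment_form n \<mu> \<nu>"
    unfolding h_def moment_form_def using i\<mu> by (simp add: moment_def)
  moreover have "(\<integral>\<^sup>+x. ennreal (h n x) \<partial>\<mu>) = ennreal (\<integral>x. h n x \<partial>\<mu>)"
    by (rule nn_integral_eq_integral[OF unit_measures_integrable[OF \<mu> hc]]) (use h0 sp in auto)
  moreover have "0 \<le> (\<integral>x. h n x \<partial>\<mu>)" using h0 sp by (intro integral_nonneg_AE) auto
  ultimately show "(\<integral>\<^sup>+x. ennreal (h n x) \<partial>\<mu>) = ennreal (moment_form n \<mu> \<nu>)" "0 \<le> moment_form n \<mu> \<nu>"
    by simp_all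
qed

text \<open>All terms are nonnegative, so sum and integrals may be exchanged; infinite energies are
  covered as well.\<close>

lemma mutual_energy_series:
  fixes \<mu> \<nu> :: "'a::euclidean_space measure"
  assumes \<mu>: "\<mu> \<in> unit_measures" and \<nu>: "\<nu> \<in> unit_measures" and d: "DIM('a) \<ge> 3"
  shows "mutual_energy \<mu> \<nu> = (\<Sum>n. ennreal (kernel_coeff DIM('a) n) * ennreal (moment_form n \<mu> \<nu>))"
proof -
  define h where "h n x = (\<Sum>j\<le>n. real (n choose j) / 2 ^ n * (\<Sum>l\<in>basis_words j. monom_fun l x * moment l \<nu>))"
    for n and x :: 'a
  note h = unit_measures_nn_integral_power[OF \<mu> \<nu>, folded h_def]
  have sp: "space \<nu> = sphere 0 1" "space \<mu> = sphere 0 1" using unit_measuresD \<mu> \<nu> by auto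
  have "mutual_energy \<mu> \<nu> = (\<integral>\<^sup>+x. (\<Sum>n. ennreal (kernel_coeff DIM('a) n) * ennreal (h n x)) \<partial>\<mu>)"
    unfolding mutual_energy_def
  proof (rule nn_integral_cong)
    fix x assume "x \<in> space \<mu>"
    then have x: "x \<in> sphere 0 1" using sp by simp
    have m: "(\<lambda>y. ennreal (((1 + x \<bullet> y) / 2) ^ n)) \<in> borel_measurable \<nu>" for n
      by (rule unit_measures_measurable[OF \<nu>]) measurable
    have "(\<integral>\<^sup>+ y. inverse (ennreal (norm (x - y) ^ (DIM('a) - 2))) \<partial>\<nu>) =
      (\<integral>\<^sup>+ y. (\<Sum>n. ennreal (kernel_coeff DIM('a) n) * ennreal (((1 + x \<bullet> y) / 2) ^ n)) \<partial>\<nu>)"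
      by (rule nn_integral_cong, rule kernel_series[OF x _ d]) (use sp in auto)
    also have "\<dots> = (\<Sum>n. \<integral>\<^sup>+ y. ennreal (kernel_coeff DIM('a) n) * ennreal (((1 + x \<bullet> y) / 2) ^ n) \<partial>\<nu>)"
      by (rule nn_integral_suminf) (use m in measurable)
    also have "\<dots> = (\<Sum>n. ennreal (kernel_coeff DIM('a) n) * ennreal (h n x))"
      by (simp only: nn_integral_cmult[OF m] h(1)[OF x])
    finally show "(\<integral>\<^sup>+ y. inverse (ennreal (norm (x - y) ^ (DIM('a) - 2))) \<partial>\<nu>) = \<dots>" .
  qed
  also have "\<dots> = (\<Sum>n. \<integral>\<^sup>+x. ennreal (kernel_coeff DIM('a) n) * ennreal (h n x) \<partial>\<mu>)"
  proof (rule nn_integral_suminf)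
    show "(\<lambda>x. ennreal (kernel_coeff DIM('a) n) * ennreal (h n x)) \<in> borel_measurable \<mu>" for n
      by (rule unit_measures_measurable[OF \<mu>]) (use borel_measurable_continuous_onI[OF h(3)[of n]] in measurable)
  qed
  also have "\<dots> = (\<Sum>n. ennreal (kernel_coeff DIM('a) n) * ennreal (moment_form n \<mu> \<nu>))"
  proof -
    have "(\<lambda>x. ennreal (h n x)) \<in> borel_measurable \<mu>" for n
      by (rule unit_measures_measurable[OF \<mu>]) (use borel_measurable_continuous_onI[OF h(3)[of n]] in measurable)
    then show ?thesis by (simp only: nn_integral_cmult h(4))
  qed
  finally show ?thesis .
qed

text \<open>Completing the square: this is the n-th term of the energy of the difference of the two
  measures, written without signed measures.\<close>

lemma moment_form_diff:
  "moment_form n \<mu> \<mu> + moment_form n \<nu> \<nu> - 2 * moment_form n \<mu> \<nu> =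
    (\<Sum>j\<le>n. real (n choose j) / 2 ^ n * (\<Sum>l\<in>basis_words j. (moment l \<mu> - moment l \<nu>)\<^sup>2))"
  unfolding moment_form_def power2_diff
  by (simp add: sum.distrib sum_subtractf sum_distrib_left power2_eq_square algebra_simps)

text \<open>Summing the completed squares, the two energies equal twice the mutual energy plus a
  nonnegative series. When that series is 0, all moments agree.\<close>

lemma mutual_energy_le:
  fixes \<mu> \<nu> :: "'a::euclidean_space measure"
  assumes \<mu>: "\<mu> \<in> unit_measures" and \<nu>: "\<nu> \<in> unit_measures" and d: "DIM('a) \<ge> 3"
  shows "2 * mutual_energy \<mu> \<nu> \<le> energy \<mu> + energy \<nu>"
    and "energy \<mu> < \<infinity> \<Longrightarrow> energy \<nu> < \<infinity> \<Longrightarrow> 2 * mutual_energy \<mu> \<nu> = energy \<mu> + energy \<nu> \<Longrightarrow> \<mu> = \<nu>"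
proof -
  let ?c = "kernel_coeff DIM('a)"
  have c0: "?c n > 0" for n using kernel_coeff_pos[OF d] .
  define \<delta> where "\<delta> n = (\<Sum>j\<le>n. real (n choose j) / 2 ^ n * (\<Sum>l\<in>basis_words j. (moment l \<mu> - moment l \<nu>)\<^sup>2))" for n
  have \<delta>0: "\<delta> n \<ge> 0" for n
    unfolding \<delta>_def by (intro sum_nonneg mult_nonneg_nonneg) auto
  have F: "0 \<le> moment_form n \<mu> \<nu>" "0 \<le> moment_form n \<mu> \<mu>" "0 \<le> moment_form n \<nu> \<nu>" for n
    using unit_measures_nn_integral_power(5) \<mu> \<nu> by blast+
  have termwise: "ennreal (?c n) * ennreal (moment_form n \<mu> \<mu>) + ennreal (?c n) * ennreal (moment_form n \<nu> \<nu>) =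
    2 * (ennreal (?c n) * ennreal (moment_form n \<mu> \<nu>)) + ennreal (?c n * \<delta> n)" for n
  proof -
    have "?c n * moment_form n \<mu> \<mu> + ?c n * moment_form n \<nu> \<nu> = 2 * (?c n * moment_form n \<mu> \<nu>) + ?c n * \<delta> n"
      unfolding moment_form_diff[of n \<mu> \<nu>, folded \<delta>_def, symmetric] by (simp add: algebra_simps)
    then have "ennreal (?c n * moment_form n \<mu> \<mu> + ?c n * moment_form n \<nu> \<nu>) = ennreal (2 * (?c n * moment_form n \<mu> \<nu>) + ?c n * \<delta> n)"
      by (simp only:)
    then show ?thesis using F[of n] c0[of n] \<delta>0[of n] by (simp add: ennreal_mult)
  qed
  have sum: "energy \<mu> + energy \<nu> = 2 * mutual_energy \<mu> \<nu> + (\<Sum>n. ennreal (?c n * \<delta> n))"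
  proof -
    have "energy \<mu> + energy \<nu> = (\<Sum>n. 2 * (ennreal (?c n) * ennreal (moment_form n \<mu> \<nu>)) + ennreal (?c n * \<delta> n))"
      unfolding energy_eq_mutual mutual_energy_series[OF \<mu> \<mu> d] mutual_energy_series[OF \<nu> \<nu> d]
      by (subst suminf_add) (simp_all only: termwise summableI)
    also have "\<dots> = 2 * (\<Sum>n. ennreal (?c n) * ennreal (moment_form n \<mu> \<nu>)) + (\<Sum>n. ennreal (?c n * \<delta> n))"
      by (subst suminf_add[symmetric]) (simp_all add: ennreal_suminf_cmult)
    finally show ?thesis by (simp only: mutual_energy_series[OF \<mu> \<nu> d])
  qed
  show "2 * mutual_energy \<mu> \<nu> \<le> energy \<mu> + energy \<nu>" unfolding sum by simp
  assume fin: "energy \<mu> < \<infinity>" "energy \<nu> < \<infinity>" and eq: "2 * mutual_energy \<mu> \<nu> = energy \<mu> + energy \<nu>"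
  \<comment> \<open>Finiteness is what permits cancelling the common summand in
    \<open>ennreal\<close>.\<close>
  have "2 * mutual_energy \<mu> \<nu> \<noteq> \<top>" using fin unfolding eq by (auto simp: less_top)
  with sum eq have S0: "(\<Sum>n. ennreal (?c n * \<delta> n)) = 0"
    by (metis add.right_neutral ennreal_add_left_cancel infinity_ennreal_def)
  have z: "\<delta> n = 0" for n
  proof -
    have "ennreal (?c n * \<delta> n) \<le> (\<Sum>n. ennreal (?c n * \<delta> n))"
      using sum_le_suminf[of "\<lambda>n. ennreal (?c n * \<delta> n)" "{n}"] by simp
    then have "?c n * \<delta> n \<le> 0" using S0 by (simp add: ennreal_eq_0_iff)
    then show ?thesis using c0[of n] \<delta>0[of n] by (simp add: mult_le_0_iff)
  qed
  show "\<mu> = \<nu>"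
  proof (rule unit_measures_eqI[OF \<mu> \<nu>])
    fix l :: "'a list" assume l: "set l \<subseteq> Basis"
    \<comment> \<open>The moment of a word of length n occurs in the n-th term at j = n, with
      binomial coefficient 1; so every word is reached.\<close>
    let ?n = "length l"
    have "\<forall>j\<in>{..?n}. real (?n choose j) / 2 ^ ?n * (\<Sum>l\<in>basis_words j. (moment l \<mu> - moment l \<nu>)\<^sup>2) = 0"
      using z[of ?n] unfolding \<delta>_def by (subst (asm) sum_nonneg_eq_0_iff) (auto intro!: divide_nonneg_nonneg mult_nonneg_nonneg sum_nonneg)
    then have "(\<Sum>l\<in>basis_words ?n. (moment l \<mu> - moment l \<nu>)\<^sup>2) = 0" by auto
    then have "\<forall>l\<in>basis_words ?n. (moment l \<mu> - moment l \<nu>)\<^sup>2 = 0"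
      by (subst (asm) sum_nonneg_eq_0_iff) auto
    moreover have "l \<in> basis_words ?n" using l by (simp add: basis_words_def)
    ultimately show "(\<integral>x. monom_fun l x \<partial>\<mu>) = (\<integral>x. monom_fun l x \<partial>\<nu>)" by (auto simp: moment_def)
  qed
qed

section \<open>Incomplete Beta functions\<close>

lemma has_integral_inc_beta:
  assumes "a > 0" "b > 0" "0 \<le> z" "z \<le> 1"
  shows "((\<lambda>t. t powr (a - 1) * (1 - t) powr (b - 1)) has_integral inc_beta z a b) {0..z}"
proof -
  have "(\<lambda>t. t powr (a - 1) * (1 - t) powr (b - 1)) integrable_on {0..z}"
    by (rule integrable_on_subinterval[OF has_integral_integrable[OF has_integral_Beta_real[OF assms(1,2)]]])
       (use assms(3,4) in simp)
  then show ?thesis unfolding inc_beta_def by (rule integrable_integral)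
qed

lemma inc_beta_0: "inc_beta 0 a b = 0"
  by (simp add: inc_beta_def)

lemma inc_beta_1: "a > 0 \<Longrightarrow> b > 0 \<Longrightarrow> inc_beta 1 a b = Beta a b"
  unfolding inc_beta_def by (rule integral_unique, rule has_integral_Beta_real)

text \<open>Passes from gauge integrals on closed intervals to Lebesgue integrals on open ones. The
  singular powers met here take conventional values at the endpoints, hence the sign condition
  inside only.\<close>

lemma nn_integral_Ioo_has_integral:
  fixes f :: "real \<Rightarrow> real"
  assumes "(f has_integral I) {a..b}" "\<And>x. a < x \<Longrightarrow> x < b \<Longrightarrow> 0 \<le> f x"
  shows "(\<integral>\<^sup>+x\<in>{a<..<b}. ennreal (f x) \<partial>lborel) = ennreal I"
proof -
  define g where "g x = (if x \<in> {a<..<b} then f x else 0)" for x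
  have "(g has_integral I) UNIV"
    unfolding g_def has_integral_restrict_UNIV using assms(1) by (simp only: has_integral_Icc_iff_Ioo)
  from nn_integral_has_integral_lebesgue[OF _ this] assms(2)
  have "(\<integral>\<^sup>+x. ennreal (g x) \<partial>lborel) = ennreal I" by (auto simp: g_def)
  moreover have "ennreal (g x) = ennreal (f x) * indicator {a<..<b} x" for x
    by (auto simp: g_def indicator_def)
  ultimately show ?thesis by simp
qed

lemma nn_integral_inc_beta:
  assumes "a > 0" "b > 0" "0 \<le> z" "z \<le> 1"
  shows "(\<integral>\<^sup>+t\<in>{0<..<z}. ennreal (t powr (a - 1) * (1 - t) powr (b - 1)) \<partial>lborel) = ennreal (inc_beta z a b)"
  by (rule nn_integral_Ioo_has_integral[OF has_integral_inc_beta[OF assms]]) simp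

lemma nn_integral_affine_subst:
  fixes f :: "real \<Rightarrow> ennreal"
  assumes "f \<in> borel_measurable borel" "c > 0"
  shows "(\<integral>\<^sup>+x. f x \<partial>lborel) = ennreal c * (\<integral>\<^sup>+x. f (s + c * x) \<partial>lborel)"
  using nn_integral_real_affine[OF assms(1), of c s] assms(2) by simp

lemma nn_integral_Beta_interval:
  assumes "a > 0" "b > 0" "s < r"
  shows "(\<integral>\<^sup>+t\<in>{s<..<r}. ennreal ((t - s) powr (a - 1) * (r - t) powr (b - 1)) \<partial>lborel) =
    ennreal ((r - s) powr (a + b - 1) * Beta a b)"
proof -
  define c where "c = r - s"
  have c: "c > 0" using assms by (simp add: c_def)
  have "(\<integral>\<^sup>+t\<in>{s<..<r}. ennreal ((t - s) powr (a - 1) * (r - t) powr (b - 1)) \<partial>lborel) =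
    ennreal c * (\<integral>\<^sup>+x. ennreal ((s + c * x - s) powr (a - 1) * (r - (s + c * x)) powr (b - 1)) * indicator {s<..<r} (s + c * x) \<partial>lborel)"
    by (rule nn_integral_affine_subst[OF _ c]) measurable
  also have "(\<integral>\<^sup>+x. ennreal ((s + c * x - s) powr (a - 1) * (r - (s + c * x)) powr (b - 1)) * indicator {s<..<r} (s + c * x) \<partial>lborel) =
    (\<integral>\<^sup>+x. ennreal (c powr (a + b - 2)) * (ennreal (x powr (a - 1) * (1 - x) powr (b - 1)) * indicator {0<..<1} x) \<partial>lborel)"
  proof (rule nn_integral_cong)
    fix x
    have "s + c * x \<in> {s<..<r} \<longleftrightarrow> x \<in> {0<..<1}"
    proof -
      have "s + c * x < r \<longleftrightarrow> c * x < c * 1" by (auto simp: c_def)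
      then show ?thesis using c by (simp add: zero_less_mult_iff)
    qed
    moreover have "(s + c * x - s) powr (a - 1) * (r - (s + c * x)) powr (b - 1) = c powr (a + b - 2) * (x powr (a - 1) * (1 - x) powr (b - 1))"
      if x: "x \<in> {0<..<1}"
    proof -
      have "r - (s + c * x) = c * (1 - x)" by (simp add: c_def algebra_simps)
      then have "(s + c * x - s) powr (a - 1) * (r - (s + c * x)) powr (b - 1) =
        (c powr (a - 1) * c powr (b - 1)) * (x powr (a - 1) * (1 - x) powr (b - 1))"
        using x c by (simp add: powr_mult)
      also have "c powr (a - 1) * c powr (b - 1) = c powr (a + b - 2)"
        unfolding powr_add[symmetric] by (simp add: algebra_simps)
      finally show ?thesis .
    qed
    moreover have "ennreal (c powr (a + b - 2) * y) = ennreal (c powr (a + b - 2)) * ennreal y" for y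
      by (rule ennreal_mult') simp
    ultimately show "ennreal ((s + c * x - s) powr (a - 1) * (r - (s + c * x)) powr (b - 1)) * indicator {s<..<r} (s + c * x) =
      ennreal (c powr (a + b - 2)) * (ennreal (x powr (a - 1) * (1 - x) powr (b - 1)) * indicator {0<..<1} x)"
      by (cases "x \<in> {0<..<1}") (simp_all only: indicator_simps mult_1_right mult_zero_right simp_thms)
  qed
  also have "\<dots> = ennreal (c powr (a + b - 2)) * ennreal (Beta a b)"
    by (subst nn_integral_cmult) (simp_all add: nn_integral_inc_beta inc_beta_1 assms)
  also have "ennreal c * (ennreal (c powr (a + b - 2)) * ennreal (Beta a b)) = ennreal (c * (c powr (a + b - 2) * Beta a b))"
    by (simp only: ennreal_mult'[OF powr_ge_zero] ennreal_mult'[OF less_imp_le[OF c]])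
  also have "c * (c powr (a + b - 2) * Beta a b) = (c powr 1 * c powr (a + b - 2)) * Beta a b"
    using c by simp
  also have "c powr 1 * c powr (a + b - 2) = c powr (a + b - 1)"
    unfolding powr_add[symmetric] by simp
  finally show ?thesis unfolding c_def .
qed

text \<open>The constant of Abel inversion: B(1/2, 1/2) = pi, independently of the interval.\<close>

lemma nn_integral_arcsine:
  assumes "s < (r::real)"
  shows "(\<integral>\<^sup>+t\<in>{s<..<r}. ennreal (1 / (sqrt (t - s) * sqrt (r - t))) \<partial>lborel) = ennreal pi"
proof -
  have "(\<integral>\<^sup>+t\<in>{s<..<r}. ennreal (1 / (sqrt (t - s) * sqrt (r - t))) \<partial>lborel) =
    (\<integral>\<^sup>+t\<in>{s<..<r}. ennreal ((t - s) powr (1/2 - 1) * (r - t) powr (1/2 - 1)) \<partial>lborel)"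
  proof (rule nn_integral_cong)
    fix t
    have "1 / (sqrt (t - s) * sqrt (r - t)) = (t - s) powr (1/2 - 1) * (r - t) powr (1/2 - 1)" if "t \<in> {s<..<r}"
    proof -
      have e: "(1/2 - 1 :: real) = - (1/2)" by simp
      show ?thesis unfolding e using that by (simp only: powr_minus_divide powr_half_sqrt greaterThanLessThan_iff less_imp_le) (simp add: powr_half_sqrt)
    qed
    then show "ennreal (1 / (sqrt (t - s) * sqrt (r - t))) * indicator {s<..<r} t =
      ennreal ((t - s) powr (1/2 - 1) * (r - t) powr (1/2 - 1)) * indicator {s<..<r} t"
      by (auto simp: indicator_def)
  qed
  also have "\<dots> = ennreal ((r - s) powr (1/2 + 1/2 - 1) * Beta (1/2) (1/2))"
    by (rule nn_integral_Beta_interval) (use assms in auto)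
  also have "(r - s) powr (1/2 + 1/2 - 1) * Beta (1/2) (1/2) = pi"
    using assms by (simp add: Beta_def Gamma_one_half_real)
  finally show ?thesis .
qed

text \<open>Integrate the derivative of t powr a * (1 - t) powr b from 0 to w. The boundary terms
  arising here cancel in the Abel inversion below.\<close>

lemma inc_beta_plus1:
  assumes a: "a > 0" and b: "b > 0" and w: "0 \<le> w" "w < 1"
  shows "(a + b) * inc_beta w a (b + 1) = b * inc_beta w a b + w powr a * (1 - w) powr b"
proof -
  let ?f = "\<lambda>t. (a + b) * (t powr (a - 1) * (1 - t) powr (b + 1 - 1)) - b * (t powr (a - 1) * (1 - t) powr (b - 1))"
  have "(?f has_integral (a + b) * inc_beta w a (b + 1) - b * inc_beta w a b) {0..w}"
    by (intro has_integral_diff has_integral_mult_right has_integral_inc_beta) (use assms in auto)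
  moreover have "(?f has_integral w powr a * (1 - w) powr b - 0 powr a * (1 - 0) powr b) {0..w}"
  proof (rule fundamental_theorem_of_calculus_interior)
    show "continuous_on {0..w} (\<lambda>t. t powr a * (1 - t) powr b)"
      using a w by (intro continuous_intros continuous_on_powr') auto
    fix t assume t: "t \<in> {0<..<w}"
    then have t01: "0 < t" "t < 1" using w by auto
    have "((\<lambda>t. t powr a * (1 - t) powr b) has_real_derivative
      a * t powr (a - 1) * (1 - t) powr b + t powr a * (b * (1 - t) powr (b - 1) * (-1))) (at t)"
      using t01 by (auto intro!: derivative_eq_intros)
    moreover have "a * t powr (a - 1) * (1 - t) powr b + t powr a * (b * (1 - t) powr (b - 1) * (-1)) = ?f t"
    proof -
      have 1: "t powr a = t powr (a - 1) * t" using t01 by (simp add: powr_diff)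
      have 2: "(1 - t) powr b = (1 - t) powr (b - 1) * (1 - t)" using t01 by (simp add: powr_diff)
      have 3: "b + 1 - 1 = b" by simp
      show ?thesis unfolding 3 1 2 by (simp add: algebra_simps)
    qed
    ultimately show "((\<lambda>t. t powr a * (1 - t) powr b) has_vector_derivative ?f t) (at t)"
      by (simp add: has_real_derivative_iff_has_vector_derivative)
  qed (use w in auto)
  ultimately have "(a + b) * inc_beta w a (b + 1) - b * inc_beta w a b = w powr a * (1 - w) powr b - 0 powr a * (1 - 0) powr b"
    by (rule has_integral_unique)
  then show ?thesis by simp
qed

text \<open>Multiplying \<open>hyp2F1 1 b (1/2) w - 1\<close> by the integrating factor
  \<open>w powr (-1/2) * (1 - w) powr (b + 1/2)\<close> of its differential equation gives \<open>b\<close> times an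
  antiderivative of the Beta integrand.\<close>

lemma hyp2F1_one_half:
  assumes b: "b > 0" and w: "0 \<le> w" "w < 1"
  shows "hyp2F1 1 b (1/2) w = 1 + b * sqrt w * (1 - w) powr (- (b + 1/2)) * inc_beta w (1/2) (b + 1/2)"
proof -
  \<comment> \<open>\<open>pochhammer 1 n\<close> cancels \<open>fact n\<close>. The shift
    \<open>m\<close> drops the constant term, so the hypergeometric function is 1 + w * M w for the
    power series M with coefficients \<open>m\<close>.\<close>
  define c where "c n = pochhammer b n / pochhammer (1/2) n" for n
  define m where "m n = c (Suc n)" for n
  have ph: "pochhammer (1/2 :: real) n > 0" for n by (rule pochhammer_pos) simp
  have m_rec: "m (Suc n) * (real n + 3/2) = m n * (b + real n + 1)" for n
  proof -
    have "pochhammer (1/2) (Suc (Suc n)) = pochhammer (1/2) (Suc n) * (real n + 3/2)"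
      "pochhammer b (Suc (Suc n)) = pochhammer b (Suc n) * (b + real n + 1)"
      by (simp_all add: pochhammer_Suc[of _ "Suc n"] algebra_simps)
    then show ?thesis using ph[of "Suc n"] by (simp add: m_def c_def)
  qed
  have m0: "m 0 = 2 * b" by (simp add: m_def c_def)
  have summ: "summable (\<lambda>n. m n * x ^ n)" if x: "\<bar>x\<bar> < 1" for x
  proof (cases "x = 0")
    case True then show ?thesis by (simp add: summable_0_powser)
  next
    case False
    define C where "C = (1 + \<bar>x\<bar>) / 2"
    have C: "\<bar>x\<bar> < C" "C < 1" using x by (simp_all add: C_def)
    have "(\<lambda>n. (b + real n + 1) / (real n + 3/2) * \<bar>x\<bar>) \<longlonglongrightarrow> 1 * \<bar>x\<bar>"
    proof (intro tendsto_mult tendsto_const)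
      have "(\<lambda>n. 1 + (b - 1/2) / (3/2 + real n)) \<longlonglongrightarrow> 1 + 0"
        by (intro tendsto_add tendsto_const real_tendsto_divide_at_top[OF tendsto_const]
            filterlim_tendsto_add_at_top[OF tendsto_const] filterlim_real_sequentially)
      moreover have "1 + (b - 1/2) / (3/2 + real n) = (b + real n + 1) / (real n + 3/2)" for n
        by (simp add: field_simps)
      ultimately show "(\<lambda>n. (b + real n + 1) / (real n + 3/2)) \<longlonglongrightarrow> 1" by simp
    qed
    then have "eventually (\<lambda>n. (b + real n + 1) / (real n + 3/2) * \<bar>x\<bar> < C) sequentially"
      using C(1) by (auto dest!: order_tendstoD(2))
    then obtain N where N: "\<And>n. n \<ge> N \<Longrightarrow> (b + real n + 1) / (real n + 3/2) * \<bar>x\<bar> < C"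
      by (auto simp: eventually_sequentially)
    show ?thesis
    proof (rule summable_ratio_test[OF C(2)])
      fix n assume "n \<ge> N"
      have "m (Suc n) = m n * ((b + real n + 1) / (real n + 3/2))"
        using m_rec[of n] by (simp add: field_simps)
      then have "norm (m (Suc n) * x ^ Suc n) = ((b + real n + 1) / (real n + 3/2) * \<bar>x\<bar>) * norm (m n * x ^ n)"
        using b by (simp add: abs_mult power_abs)
      also have "\<dots> \<le> C * norm (m n * x ^ n)"
        using N[OF \<open>n \<ge> N\<close>] by (intro mult_right_mono) auto
      finally show "norm (m (Suc n) * x ^ Suc n) \<le> C * norm (m n * x ^ n)" .
    qed
  qed
  define M where "M t = (\<Sum>n. m n * t ^ n)" for t
  define M' where "M' t = (\<Sum>n. diffs m n * t ^ n)" for t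
  have dM: "(M has_real_derivative M' t) (at t)" if t: "\<bar>t\<bar> < 1" for t
  proof -
    obtain K where K: "\<bar>t\<bar> < K" "K < 1" using dense[OF t] by blast
    then show ?thesis unfolding M_def M'_def
      by (intro termdiffs_strong[of _ K] summ) auto
  qed
  \<comment> \<open>The two-term recurrence of \<open>m\<close> summed against powers of t; the
    starting value m 0 = 2 * b supplies the inhomogeneous term b.\<close>
  have ode: "t * M' t + M t / 2 = b + t * (t * M' t + (1 + b) * M t)" if t: "\<bar>t\<bar> < 1" for t
  proof -
    have S0: "(\<lambda>n. m n * t ^ n) sums M t"
      unfolding M_def using summ[OF t] by (rule summable_sums)
    have S1: "(\<lambda>n. real n * m n * t ^ n) sums (t * M' t)"
    proof -
      have "summable (\<lambda>n. diffs m n * t ^ n)"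
        by (rule termdiff_converges[of t 1]) (use t summ in auto)
      then have "(\<lambda>n. diffs m n * t ^ n) sums M' t" unfolding M'_def by (rule summable_sums)
      then have "(\<lambda>n. t * (diffs m n * t ^ n)) sums (t * M' t)" by (rule sums_mult)
      then have "(\<lambda>n. real (Suc n) * m (Suc n) * t ^ Suc n) sums (t * M' t)"
        by (simp add: diffs_def mult_ac)
      then show ?thesis by (subst (asm) sums_Suc_iff) simp
    qed
    have A: "(\<lambda>n. (real n + 1/2) * m n * t ^ n) sums (t * M' t + M t / 2)"
      using sums_add[OF S1 sums_mult[OF S0, of "1/2"]] by (simp add: algebra_simps)
    have B: "(\<lambda>n. t * ((b + real n + 1) * m n * t ^ n)) sums (t * (t * M' t + (1 + b) * M t))"
      using sums_mult[OF sums_add[OF S1 sums_mult[OF S0, of "1 + b"]], of t] by (simp add: algebra_simps)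
    have "(real (Suc n) + 1/2) * m (Suc n) * t ^ Suc n = t * ((b + real n + 1) * m n * t ^ n)" for n
      using m_rec[of n] by (simp add: algebra_simps)
    then have "(\<lambda>n. (real (Suc n) + 1/2) * m (Suc n) * t ^ Suc n) sums (t * (t * M' t + (1 + b) * M t))"
      using B by (simp only:)
    then have "(\<lambda>n. (real n + 1/2) * m n * t ^ n) sums (t * (t * M' t + (1 + b) * M t) + (real 0 + 1/2) * m 0 * t ^ 0)"
      by (subst (asm) sums_Suc_iff) simp
    from sums_unique2[OF A this] show ?thesis using m0 by simp
  qed
  have hyp: "hyp2F1 1 b (1/2) w = 1 + w * M w"
  proof -
    have S0: "(\<lambda>n. m n * w ^ n) sums M w"
      unfolding M_def by (rule summable_sums, rule summ) (use w in simp)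
    then have "(\<lambda>n. w * (m n * w ^ n)) sums (w * M w)" by (rule sums_mult)
    then have "(\<lambda>n. c (Suc n) * w ^ Suc n) sums (w * M w)" by (simp add: m_def mult_ac)
    then have "(\<lambda>n. c n * w ^ n) sums (w * M w + c 0 * w ^ 0)" by (subst (asm) sums_Suc_iff) simp
    moreover have "c 0 = 1" by (simp add: c_def)
    ultimately have "(\<Sum>n. c n * w ^ n) = 1 + w * M w" by (simp add: sums_unique[symmetric])
    moreover have "pochhammer 1 n * pochhammer b n / pochhammer (1/2) n * w ^ n / fact n = c n * w ^ n" for n
      unfolding pochhammer_fact[symmetric, of n, where 'a=real] c_def by simp
    ultimately show ?thesis unfolding hyp2F1_def by (simp only:)
  qed
  let ?\<Phi> = "\<lambda>t. t powr (1/2) * (1 - t) powr (b + 1/2) * M t"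
  have "((\<lambda>t. b * (t powr (1/2 - 1) * (1 - t) powr (b + 1/2 - 1))) has_integral ?\<Phi> w - ?\<Phi> 0) {0..w}"
  proof (rule fundamental_theorem_of_calculus_interior)
    have "continuous_on {0..w} M"
    proof (rule DERIV_continuous_on)
      fix x assume "x \<in> {0..w}"
      then have "\<bar>x\<bar> < 1" using w by simp
      then show "(M has_real_derivative M' x) (at x within {0..w})"
        by (rule has_field_derivative_at_within[OF dM])
    qed
    moreover have "continuous_on {0..w} (\<lambda>t. t powr (1/2))"
      by (intro continuous_on_powr' continuous_intros) auto
    moreover have "continuous_on {0..w} (\<lambda>t. (1 - t) powr (b + 1/2))"
      by (intro continuous_on_powr' continuous_intros) (use w in auto)
    ultimately show "continuous_on {0..w} ?\<Phi>"
      by (intro continuous_on_mult)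
    fix t assume t: "t \<in> {0<..<w}"
    then have t01: "0 < t" "t < 1" "\<bar>t\<bar> < 1" using w by auto
    define P where "P = t powr (-1/2)"
    define R where "R = (1 - t) powr (b - 1/2)"
    have P: "t powr (1/2) = P * t" "t powr (1/2 - 1) = P"
    proof -
      have "P * t = t powr (-1/2) * t powr 1" using t01 by (simp add: P_def)
      also have "\<dots> = t powr (1/2)" unfolding powr_add[symmetric] by simp
      finally show "t powr (1/2) = P * t" ..
    qed (simp add: P_def)
    have R: "(1 - t) powr (b + 1/2) = R * (1 - t)" "(1 - t) powr (b + 1/2 - 1) = R"
    proof -
      have "R * (1 - t) = (1 - t) powr (b - 1/2) * (1 - t) powr 1" using t01 by (simp add: R_def)
      also have "\<dots> = (1 - t) powr (b + 1/2)" unfolding powr_add[symmetric] by (rule arg_cong[where f="(powr) (1 - t)"]) simp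
      finally show "(1 - t) powr (b + 1/2) = R * (1 - t)" ..
      show "(1 - t) powr (b + 1/2 - 1) = R" by (simp add: R_def)
    qed
    have d1: "((\<lambda>t. t powr (1/2)) has_real_derivative P / 2) (at t)"
      using has_real_derivative_powr[OF t01(1), of "1/2"] unfolding P by simp
    have d2: "((\<lambda>t. (1 - t) powr (b + 1/2)) has_real_derivative - ((b + 1/2) * R)) (at t)"
      using t01 R(2) by (auto intro!: derivative_eq_intros)
    have "(?\<Phi> has_real_derivative (P / 2 * (R * (1 - t)) + - ((b + 1/2) * R) * (P * t)) * M t + M' t * (P * t * (R * (1 - t)))) (at t)"
      using DERIV_mult[OF DERIV_mult[OF d1 d2] dM[OF t01(3)]] unfolding P R .
    moreover have "(P / 2 * (R * (1 - t)) + - ((b + 1/2) * R) * (P * t)) * M t + M' t * (P * t * (R * (1 - t))) = b * (P * R)"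
    proof -
      have "(P / 2 * (R * (1 - t)) + - ((b + 1/2) * R) * (P * t)) * M t + M' t * (P * t * (R * (1 - t))) =
        P * R * ((1/2 * (1 - t) - t * (b + 1/2)) * M t + t * (1 - t) * M' t)"
        by (simp add: algebra_simps)
      also have "(1/2 * (1 - t) - t * (b + 1/2)) * M t + t * (1 - t) * M' t = b"
      proof -
        have "(1/2 * (1 - t) - t * (b + 1/2)) * M t + t * (1 - t) * M' t =
          (t * M' t + M t / 2) - t * (t * M' t + (1 + b) * M t)" by (simp add: field_simps)
        then show ?thesis using ode[OF t01(3)] by simp
      qed
      finally show ?thesis by (simp only: mult_ac)
    qed
    ultimately show "(?\<Phi> has_vector_derivative b * (t powr (1/2 - 1) * (1 - t) powr (b + 1/2 - 1))) (at t)"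
      unfolding P R has_real_derivative_iff_has_vector_derivative[symmetric] by (rule DERIV_cong)
  qed (use w in auto)
  moreover have "((\<lambda>t. b * (t powr (1/2 - 1) * (1 - t) powr (b + 1/2 - 1))) has_integral b * inc_beta w (1/2) (b + 1/2)) {0..w}"
    by (intro has_integral_mult_right has_integral_inc_beta) (use b w in auto)
  ultimately have "?\<Phi> w - ?\<Phi> 0 = b * inc_beta w (1/2) (b + 1/2)" by (rule has_integral_unique)
  then have \<Phi>: "sqrt w * (1 - w) powr (b + 1/2) * M w = b * inc_beta w (1/2) (b + 1/2)"
    using w by (simp add: powr_half_sqrt)
  have "b * sqrt w * (1 - w) powr (- (b + 1/2)) * inc_beta w (1/2) (b + 1/2) =
    sqrt w * (1 - w) powr (- (b + 1/2)) * (sqrt w * (1 - w) powr (b + 1/2) * M w)"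
    unfolding \<Phi> by (simp only: mult_ac)
  also have "\<dots> = (sqrt w * sqrt w) * ((1 - w) powr (- (b + 1/2)) * (1 - w) powr (b + 1/2)) * M w"
    by (simp only: mult_ac)
  also have "\<dots> = w * M w"
    unfolding powr_add[symmetric] using w by simp
  finally show ?thesis by (simp add: hyp)
qed

section \<open>The equation for the angle\<close>

text \<open>The area of the unit sphere of R^(d-2): fixing the coordinates along two orthogonal axes
  leaves a scaled copy of that sphere.\<close>

definition surface_const :: "nat \<Rightarrow> real" where
  "surface_const d = (real d - 2) * unit_ball_vol (real d - 2)"

text \<open>Four times the prefactor of \<open>F_term\<close>: in heights, squares such as (1 + cos
  \<alpha>)^2 = 4 * z^2 release a factor 4. Its value is dictated by the coefficient of the field,
  through \<open>surface_density_const\<close>.\<close>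

definition density_const :: "nat \<Rightarrow> real" where
  "density_const d = 8 * Gamma ((real d + 3) / 2) / (d * (real d - 2) * pi powr ((real d + 1) / 2))"

text \<open>The right-hand side of the angle equation in the variable z = cos^2 (\<alpha> / 2). It
  equals the integral of (z^2 - t^2) * t powr (d/2 - 2) * (1 - t) powr (d/2 - 1) over (0, z), from
  which monotonicity is read off.\<close>

definition angle_function :: "nat \<Rightarrow> real \<Rightarrow> real" where
  "angle_function d z = z\<^sup>2 * inc_beta z (d / 2 - 1) (d / 2) - inc_beta z (d / 2 + 1) (d / 2)"

lemma Gamma_real_plus1: "x > 0 \<Longrightarrow> Gamma (x + 1) = x * Gamma (x :: real)"
  by (rule Gamma_plus1) (auto elim!: nonpos_Ints_cases)

lemma Gamma_half_shifts:
  assumes "d \<ge> 3"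
  shows "Gamma (real d / 2) = (real d / 2 - 1) * Gamma (real d / 2 - 1)"
    and "Gamma (real d / 2 + 1) = real d / 2 * ((real d / 2 - 1) * Gamma (real d / 2 - 1))"
    and "Gamma ((real d + 3) / 2) = (real d + 1) / 2 * ((real d - 1) / 2 * Gamma ((real d - 1) / 2))"
proof -
  show 1: "Gamma (real d / 2) = (real d / 2 - 1) * Gamma (real d / 2 - 1)"
    using Gamma_real_plus1[of "real d / 2 - 1"] assms by simp
  show "Gamma (real d / 2 + 1) = real d / 2 * ((real d / 2 - 1) * Gamma (real d / 2 - 1))"
    using Gamma_real_plus1[of "real d / 2"] assms 1 by simp
  have "\<exists>x. x = (real d - 1) / 2 \<and> x > 0"
    by (rule exI[of _ "(real d - 1) / 2"]) (use assms in simp)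
  then obtain x where x: "x = (real d - 1) / 2" "x > 0" by blast
  have e: "(real d + 3) / 2 = x + 1 + 1" "(real d + 1) / 2 = x + 1"
    by (simp_all add: x(1) field_simps)
  have x1: "x + 1 > 0" using x(2) by simp
  show "Gamma ((real d + 3) / 2) = (real d + 1) / 2 * ((real d - 1) / 2 * Gamma ((real d - 1) / 2))"
    unfolding e x(1)[symmetric] Gamma_real_plus1[OF x1] Gamma_real_plus1[OF x(2)] ..
qed

lemma Gamma_duplication_real:
  assumes "x > 0"
  shows "Gamma x * Gamma (x + 1/2) = 2 powr (1 - 2 * x) * sqrt pi * Gamma (2 * x)"
proof -
  have np: "y > 0 \<Longrightarrow> complex_of_real y \<notin> \<int>\<^sub>\<le>\<^sub>0" for y
    by (metis Re_complex_of_real nonpos_Ints_cases not_le of_int_0_le_iff of_int_le_0_iff Re_complex_of_real of_real_of_int_eq)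
  have "complex_of_real (Gamma x * Gamma (x + 1/2)) = Gamma (of_real x) * Gamma (of_real x + 1/2)"
    using Gamma_complex_of_real[of "x + 1/2"] by (simp add: Gamma_complex_of_real)
  also have "\<dots> = exp ((1 - 2 * of_real x) * of_real (ln 2)) * of_real (sqrt pi) * Gamma (2 * of_real x)"
    using np[OF assms] np[of "x + 1/2"] assms by (intro Gamma_legendre_duplication) auto
  also have "\<dots> = complex_of_real (exp ((1 - 2 * x) * ln 2) * sqrt pi * Gamma (2 * x))"
    using Gamma_complex_of_real[of "2 * x"] by (simp flip: exp_of_real)
  finally show ?thesis unfolding of_real_eq_iff by (simp add: powr_def)
qed

lemma Gamma_half_pos:
  assumes "d \<ge> 3"
  shows "Gamma (real d / 2 - 1) > 0" "Gamma ((real d - 1) / 2) > 0"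
  using assms by (auto intro!: Gamma_real_pos)

text \<open>Shifting the Gamma arguments reveals the Beta value that also occurs in
  \<open>surface_density_const\<close>; this is how the angle equation meets the total mass.\<close>

lemma angle_rhs_eq_Beta:
  assumes "d \<ge> 3"
  shows "sqrt pi * d * (real d - 2) * Gamma (d / 2 - 1) / (2 ^ d * ((real d)\<^sup>2 - 1) * Gamma ((real d - 1) / 2))
    = Beta (d / 2 + 1) (1 / 2) / 2 ^ d"
proof -
  have e: "real d / 2 + 1 + 1 / 2 = (real d + 3) / 2" by (simp add: field_simps)
  have s: "(real d)\<^sup>2 - 1 = (real d + 1) * (real d - 1)" by (simp add: power2_eq_square algebra_simps)
  show ?thesis
    unfolding Beta_def e Gamma_half_shifts(2,3)[OF assms] Gamma_one_half_real s
    using Gamma_half_pos[OF assms] assms by (simp add: divide_simps)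
qed

lemma density_const_pos: "d \<ge> 3 \<Longrightarrow> density_const d > 0"
  unfolding density_const_def by (intro divide_pos_pos mult_pos_pos Gamma_real_pos) auto

lemma surface_const_pos: "d \<ge> 3 \<Longrightarrow> surface_const d > 0"
  unfolding surface_const_def by (intro mult_pos_pos) auto

text \<open>The origin of \<open>density_const\<close>: on the cap the potential contains -p^2 times
  this product, which has to offset the field 4 * p^2.\<close>

lemma surface_density_const:
  assumes "d \<ge> 3"
  shows "surface_const d * (pi * density_const d) * Beta (d / 2 + 1) (1 / 2) = 4"
proof -
  have e: "real d / 2 + 1 + 1 / 2 = (real d + 3) / 2" "(real d - 2) / 2 = real d / 2 - 1"
    "real d / 2 - 1 + 1 = real d / 2" by (simp_all add: field_simps)
  have p: "pi powr ((real d + 1) / 2) = pi powr (real d / 2 - 1) * pi * sqrt pi"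
  proof -
    have "pi powr (real d / 2 - 1) * pi * sqrt pi = pi powr (real d / 2 - 1) * pi powr 1 * pi powr (1/2)"
      by (simp add: powr_half_sqrt)
    also have "\<dots> = pi powr (real d / 2 - 1 + 1 + 1/2)" by (simp only: powr_add)
    also have "real d / 2 - 1 + 1 + 1/2 = (real d + 1) / 2" by (simp add: field_simps)
    finally show ?thesis ..
  qed
  have pp: "pi powr (real d / 2 - 1) > 0" by simp
  have G: "Gamma ((real d + 3) / 2) > 0" using assms by (intro Gamma_real_pos) auto
  define P g G3 D where "P = pi powr (real d / 2 - 1)" and "g = Gamma (real d / 2 - 1)"
    and "G3 = Gamma ((real d + 3) / 2)" and "D = real d"
  have "P > 0" "g > 0" "G3 > 0" "D \<ge> 3"
    using pp Gamma_half_pos(1)[OF assms] G assms by (simp_all add: P_def g_def G3_def D_def)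
  then have "(D - 2) * (P / ((D / 2 - 1) * g)) * (pi * (8 * G3 / (D * (D - 2) * (P * pi * sqrt pi)))) *
    (D / 2 * ((D / 2 - 1) * g) * sqrt pi / G3) = 4"
    by (simp add: divide_simps)
  then show ?thesis
    unfolding surface_const_def density_const_def unit_ball_vol_def Beta_def e p Gamma_one_half_real
      Gamma_half_shifts(1,2)[OF assms] P_def g_def G3_def D_def .
qed

section \<open>Monotonicity and solvability of the angle equation\<close>

text \<open>The height y in the integrand is kept apart from the limit z because the monotonicity
  argument takes the integrand of the larger height on the shorter interval.\<close>

lemma has_integral_angle_function:
  assumes d: "d \<ge> 3" and z: "0 \<le> z" "z \<le> 1"
  shows "((\<lambda>t. (y\<^sup>2 - t\<^sup>2) * (t powr (d / 2 - 2) * (1 - t) powr (d / 2 - 1))) has_integral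
    y\<^sup>2 * inc_beta z (d / 2 - 1) (d / 2) - inc_beta z (d / 2 + 1) (d / 2)) {0..z}"
proof -
  have "((\<lambda>t. y\<^sup>2 * (t powr (d / 2 - 1 - 1) * (1 - t) powr (d / 2 - 1)) - t powr (d / 2 + 1 - 1) * (1 - t) powr (d / 2 - 1)) has_integral
    y\<^sup>2 * inc_beta z (d / 2 - 1) (d / 2) - inc_beta z (d / 2 + 1) (d / 2)) {0..z}"
    by (intro has_integral_diff has_integral_mult_right has_integral_inc_beta) (use d z in auto)
  moreover have "y\<^sup>2 * (t powr (d / 2 - 1 - 1) * (1 - t) powr (d / 2 - 1)) - t powr (d / 2 + 1 - 1) * (1 - t) powr (d / 2 - 1) =
    (y\<^sup>2 - t\<^sup>2) * (t powr (d / 2 - 2) * (1 - t) powr (d / 2 - 1))" if "t \<in> {0..z}" for t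
  proof (cases "t = 0")
    case False
    then have t: "t > 0" using that by simp
    have "t powr (d / 2 + 1 - 1) = t powr 2 * t powr (d / 2 - 2)"
      unfolding powr_add[symmetric] by simp
    then show ?thesis using t by (simp add: algebra_simps)
  qed simp
  ultimately show ?thesis by (rule has_integral_eq[rotated])
qed

text \<open>Raising b lowers the integrand, so the recurrence in b bounds a * inc_beta z a b below
  by the positive boundary term z powr a * (1 - z) powr b.\<close>

lemma inc_beta_pos:
  assumes "a > 0" "b > 0" "0 < z" "z < 1"
  shows "inc_beta z a b > 0"
proof -
  have "inc_beta z a (b + 1) \<le> inc_beta z a b"
  proof (rule has_integral_le[OF has_integral_inc_beta has_integral_inc_beta])
    fix t assume "t \<in> {0..z}"
    then show "t powr (a - 1) * (1 - t) powr (b + 1 - 1) \<le> t powr (a - 1) * (1 - t) powr (b - 1)"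
      using assms by (intro mult_left_mono powr_mono') auto
  qed (use assms in auto)
  then have "(a + b) * inc_beta z a (b + 1) \<le> (a + b) * inc_beta z a b"
    using assms by (intro mult_left_mono) auto
  then have "z powr a * (1 - z) powr b \<le> a * inc_beta z a b"
    using inc_beta_plus1[of a b z] assms by (simp add: distrib_right)
  moreover have "z powr a * (1 - z) powr b > 0" using assms by simp
  ultimately have "a * inc_beta z a b > 0" by linarith
  then show ?thesis using assms(1) by (simp add: zero_less_mult_iff)
qed

text \<open>A larger height raises z^2 - t^2 by a positive constant on the old interval and adds a
  nonnegative piece on the new one. Strictness comes from the first effect.\<close>

lemma angle_function_strict_mono:
  assumes d: "d \<ge> 3" and z: "0 < z" "z < z'" "z' < 1"
  shows "angle_function d z < angle_function d z'"
proof -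
  let ?\<rho> = "\<lambda>t. t powr (d / 2 - 2) * (1 - t) powr (d / 2 - 1)"
  let ?I = "z'\<^sup>2 * inc_beta z (d / 2 - 1) (d / 2) - inc_beta z (d / 2 + 1) (d / 2)"
  have 1: "((\<lambda>t. (z'\<^sup>2 - t\<^sup>2) * ?\<rho> t) has_integral ?I) {0..z}"
    by (rule has_integral_angle_function) (use d z in auto)
  have 2: "((\<lambda>t. (z'\<^sup>2 - t\<^sup>2) * ?\<rho> t) has_integral angle_function d z') {0..z'}"
    unfolding angle_function_def by (rule has_integral_angle_function) (use d z in auto)
  have "?I \<le> angle_function d z'"
  proof (rule has_integral_subset_le[OF _ 1 2])
    show "\<forall>t\<in>{0..z'}. 0 \<le> (z'\<^sup>2 - t\<^sup>2) * ?\<rho> t"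
      using power_mono[of _ z' 2] by (intro ballI mult_nonneg_nonneg) auto
  qed (use z in auto)
  moreover have "?I = angle_function d z + (z'\<^sup>2 - z\<^sup>2) * inc_beta z (d / 2 - 1) (d / 2)"
    by (simp add: angle_function_def algebra_simps)
  moreover have "(z'\<^sup>2 - z\<^sup>2) * inc_beta z (d / 2 - 1) (d / 2) > 0"
    using z d by (intro mult_pos_pos inc_beta_pos) (auto simp: power_strict_mono)
  ultimately show ?thesis by linarith
qed

lemma continuous_on_inc_beta:
  assumes "a > 0" "b > 0"
  shows "continuous_on {0..1} (\<lambda>z. inc_beta z a b)"
  unfolding inc_beta_def
  by (rule indefinite_integral_continuous_1)
     (rule has_integral_integrable[OF has_integral_Beta_real[OF assms]])

text \<open>With the value 0 at z = 0 this opens the way to the intermediate value theorem. In terms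
  of mass, the datum belonging to the full sphere would carry more than 1. At z = 1 the Beta values
  are complete and both sides become rational multiples of one \<open>B\<close>; what remains is d *
  (d - 2) < (3 * d - 2) * (d + 1).\<close>

lemma angle_function_1:
  assumes d: "d \<ge> 3"
  shows "angle_function d 1 > Beta (d / 2 + 1) (1 / 2) / 2 ^ d"
proof -
  define B where "B = Beta (real d / 2 - 1) (real d / 2)"
  have B: "B > 0" unfolding B_def Beta_def using d by (intro divide_pos_pos mult_pos_pos Gamma_real_pos) auto
  have G: "Gamma (real d - 1) > 0" using d by (intro Gamma_real_pos) auto
  have b2: "Beta (d / 2 + 1) (real d / 2) = B * ((real d - 2) / (4 * (real d - 1)))"
  proof -
    have e: "real d / 2 + 1 + real d / 2 = (real d - 1) + 1 + 1" "real d / 2 - 1 + real d / 2 = real d - 1" by simp_all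
    have "Gamma ((real d - 1) + 1 + 1) = real d * ((real d - 1) * Gamma (real d - 1))"
      using Gamma_real_plus1[of "real d - 1"] Gamma_real_plus1[of "real d - 1 + 1"] d by simp
    then show ?thesis
      unfolding B_def Beta_def e Gamma_half_shifts(2)[OF d] using G d by (simp add: divide_simps)
  qed
  \<comment> \<open>Duplication at (d - 1) / 2 expresses Gamma ((d - 1) / 2) * Gamma (d / 2) by
    Gamma (d - 1), the denominator of \<open>B\<close>.\<close>
  have L: "Beta (d / 2 + 1) (1 / 2) / 2 ^ d = B * (d * (real d - 2) / (4 * ((real d)\<^sup>2 - 1)))"
  proof -
    have e1: "2 powr (1 - 2 * ((real d - 1) / 2)) = 4 / 2 ^ d"
    proof -
      have "1 - 2 * ((real d - 1) / 2) = 2 - real d" by (simp add: field_simps)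
      then have "2 powr (1 - 2 * ((real d - 1) / 2)) = 2 powr (2 - real d)" by (simp only:)
      also have "\<dots> = 4 / 2 ^ d" by (simp add: powr_diff powr_realpow)
      finally show ?thesis .
    qed
    have e2: "(real d - 1) / 2 + 1 / 2 = real d / 2" and e3: "2 * ((real d - 1) / 2) = real d - 1"
      by (simp_all add: field_simps)
    have "(real d - 1) / 2 > 0" using d by simp
    from Gamma_duplication_real[OF this, unfolded e1, unfolded e2 e3]
    have dup: "Gamma ((real d - 1) / 2) * Gamma (real d / 2) = 4 / 2 ^ d * sqrt pi * Gamma (real d - 1)"
      by simp
    have e: "real d / 2 - 1 + real d / 2 = real d - 1" by simp
    have "B = Gamma (real d / 2 - 1) * (4 / 2 ^ d * sqrt pi) / Gamma ((real d - 1) / 2)"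
    proof -
      have "B * (Gamma ((real d - 1) / 2) * Gamma (real d - 1)) = Gamma (real d / 2 - 1) * (Gamma ((real d - 1) / 2) * Gamma (real d / 2))"
        unfolding B_def Beta_def e using G by simp
      also have "\<dots> = Gamma (real d / 2 - 1) * (4 / 2 ^ d * sqrt pi) * Gamma (real d - 1)"
        unfolding dup by simp
      finally have "(B * Gamma ((real d - 1) / 2)) * Gamma (real d - 1) = Gamma (real d / 2 - 1) * (4 / 2 ^ d * sqrt pi) * Gamma (real d - 1)"
        by (simp only: mult.assoc)
      then have "B * Gamma ((real d - 1) / 2) = Gamma (real d / 2 - 1) * (4 / 2 ^ d * sqrt pi)"
        by (rule mult_right_cancel[THEN iffD1, rotated]) (use G in simp)
      then show ?thesis using Gamma_half_pos(2)[OF d] by (simp add: field_simps)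
    qed
    moreover have "sqrt pi * D * (D - 2) * g / (T * N * h) = g * (4 / T * sqrt pi) / h * (D * (D - 2) / (4 * N))" for D g T N h :: real
      by (cases "T = 0"; cases "h = 0"; cases "N = 0") (simp_all add: field_simps)
    ultimately show ?thesis
      unfolding angle_rhs_eq_Beta[OF d, symmetric] by (simp only:)
  qed
  have "angle_function d 1 = B * (1 - (real d - 2) / (4 * (real d - 1)))"
    using d b2 by (simp add: angle_function_def inc_beta_1 B_def[symmetric] right_diff_distrib)
  moreover have "d * (real d - 2) / (4 * ((real d)\<^sup>2 - 1)) < 1 - (real d - 2) / (4 * (real d - 1))"
  proof -
    have s: "(real d)\<^sup>2 - 1 = (real d + 1) * (real d - 1)" by (simp add: power2_eq_square algebra_simps)
    have "0 < (real d - 1) * (2 * real d + 2) + real d"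
      using d by (intro add_nonneg_pos mult_nonneg_nonneg) auto
    then have "d * (real d - 2) < (3 * real d - 2) * (real d + 1)"
      using d by (simp add: algebra_simps power2_eq_square)
    moreover have "1 - (real d - 2) / (4 * (real d - 1)) = (3 * real d - 2) * (real d + 1) / (4 * ((real d)\<^sup>2 - 1))"
    proof -
      have "1 - a / b = (b - a) / b" if "b \<noteq> 0" for a b :: real
        using that by (simp add: diff_divide_distrib)
      then have "1 - (real d - 2) / (4 * (real d - 1)) = (4 * (real d - 1) - (real d - 2)) / (4 * (real d - 1))"
        using d by simp
      also have "4 * (real d - 1) - (real d - 2) = 3 * real d - 2" by simp
      also have "(3 * real d - 2) / (4 * (real d - 1)) = (3 * real d - 2) * (real d + 1) / (4 * (real d - 1) * (real d + 1))"
        by (rule mult_divide_mult_cancel_right[symmetric]) simp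
      also have "4 * (real d - 1) * (real d + 1) = 4 * ((real d + 1) * (real d - 1))" by simp
      finally show ?thesis unfolding s .
    qed
    moreover have "4 * ((real d)\<^sup>2 - 1) > 0" unfolding s using d by simp
    ultimately show ?thesis by (simp add: divide_strict_right_mono)
  qed
  ultimately show ?thesis unfolding L by (simp only: mult_strict_left_mono[OF _ B])
qed

lemma angle_equation_iff:
  assumes "d \<ge> 3"
  shows "angle_equation d \<alpha> \<longleftrightarrow> angle_function d ((cos (\<alpha> / 2))\<^sup>2) = Beta (d / 2 + 1) (1 / 2) / 2 ^ d"
proof -
  have "cos (\<alpha> / 2) ^ 4 = ((cos (\<alpha> / 2))\<^sup>2)\<^sup>2" by simp
  then show ?thesis
    unfolding angle_equation_def angle_function_def angle_rhs_eq_Beta[OF assms] by auto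
qed

lemma ex1_angle_equation:
  assumes d: "d \<ge> 3"
  shows "\<exists>!\<alpha>. \<alpha> \<in> {0<..<pi} \<and> angle_equation d \<alpha>"
proof -
  let ?L = "Beta (d / 2 + 1) (1 / 2) / 2 ^ d"
  have L: "?L > 0" unfolding Beta_def using d by (intro divide_pos_pos mult_pos_pos Gamma_real_pos) auto
  have "continuous_on {0..1} (angle_function d)"
    unfolding angle_function_def using d
    by (intro continuous_intros continuous_on_inc_beta) auto
  moreover have "angle_function d 0 = 0" by (simp add: angle_function_def inc_beta_0)
  ultimately obtain z where z: "0 \<le> z" "z \<le> 1" "angle_function d z = ?L"
    using IVT'[of "angle_function d" 0 ?L 1] angle_function_1[OF d] L by auto
  have "z \<noteq> 0" "z \<noteq> 1" using z(3) L angle_function_1[OF d] \<open>angle_function d 0 = 0\<close> by auto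
  with z have z01: "0 < z" "z < 1" by auto
  define \<alpha> where "\<alpha> = 2 * arccos (sqrt z)"
  have sz: "0 < sqrt z" "sqrt z < 1" using z01 by auto
  have "0 < arccos (sqrt z)" "arccos (sqrt z) < pi / 2"
    using arccos_less_arccos[of "sqrt z" 1] arccos_less_arccos[of 0 "sqrt z"] sz by auto
  then have a: "\<alpha> \<in> {0<..<pi}" by (simp add: \<alpha>_def)
  have "cos (arccos (sqrt z)) = sqrt z" by (rule cos_arccos) (use sz in linarith)+
  then have "(cos (\<alpha> / 2))\<^sup>2 = z" using z01 by (simp add: \<alpha>_def)
  then have ex: "angle_equation d \<alpha>" using z(3) by (simp add: angle_equation_iff[OF d])
  have bounds: "0 < (cos (\<beta> / 2))\<^sup>2 \<and> (cos (\<beta> / 2))\<^sup>2 < 1" if "\<beta> \<in> {0<..<pi}" for \<beta>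
  proof -
    have "cos (\<beta> / 2) > 0" using that by (intro cos_gt_zero) auto
    moreover have "cos (\<beta> / 2) < 1"
      using that cos_monotone_0_pi[of 0 "\<beta> / 2"] by simp
    ultimately show ?thesis by (simp add: power_less_one_iff abs_square_less_1)
  qed
  \<comment> \<open>cos^2 (\<beta> / 2) decreases strictly on (0, pi), so strict monotonicity of
    \<open>angle_function\<close> separates two solutions.\<close>
  have less: "\<not> angle_equation d \<gamma>" if "\<beta> \<in> {0<..<pi}" "\<gamma> \<in> {0<..<pi}" "\<beta> < \<gamma>" "angle_equation d \<beta>" for \<beta> \<gamma>
  proof -
    have "cos (\<gamma> / 2) < cos (\<beta> / 2)" using that by (intro cos_monotone_0_pi) auto
    moreover have "cos (\<gamma> / 2) > 0" using that by (intro cos_gt_zero) auto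
    ultimately have "(cos (\<gamma> / 2))\<^sup>2 < (cos (\<beta> / 2))\<^sup>2" by (intro power_strict_mono) auto
    from angle_function_strict_mono[OF d _ this] bounds that
    show ?thesis by (simp add: angle_equation_iff[OF d])
  qed
  show ?thesis
  proof (rule ex1I[of _ \<alpha>])
    fix \<beta> assume "\<beta> \<in> {0<..<pi} \<and> angle_equation d \<beta>"
    then show "\<beta> = \<alpha>" using less[of \<alpha> \<beta>] less[of \<beta> \<alpha>] a ex by (cases \<alpha> \<beta> rule: linorder_cases) auto
  qed (use a ex in auto)
qed

section \<open>Abel inversion of the equilibrium datum\<close>

definition cap_height :: "nat \<Rightarrow> real" where
  "cap_height d = (cos (alpha0 d / 2))\<^sup>2"

text \<open>The intended inner Abel transform of the density. Above \<open>cap_height\<close> it is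
  negative, and there \<open>ennreal\<close> replaces it by 0.\<close>

definition abel_datum :: "nat \<Rightarrow> real \<Rightarrow> real" where
  "abel_datum d t = pi * density_const d * (1 - t) powr (d / 2 - 1) * ((cap_height d)\<^sup>2 - t\<^sup>2)"

text \<open>Minus the derivative of \<open>abel_datum\<close>; Abel inversion integrates it against
  1 / sqrt (t - q).\<close>

definition abel_slope :: "nat \<Rightarrow> real \<Rightarrow> real" where
  "abel_slope d t = pi * density_const d *
     ((d / 2 - 1) * (1 - t) powr (d / 2 - 2) * ((cap_height d)\<^sup>2 - t\<^sup>2) + 2 * t * (1 - t) powr (d / 2 - 1))"

text \<open>\<open>eq_density\<close> in the variable q = (1 + cos \<eta>) / 2, with the
  hypergeometric function rewritten as an incomplete Beta function and the singular terms cancelled.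
  As q approaches \<open>cap_height\<close>, w tends to 0 and so does the density.\<close>

definition height_density :: "nat \<Rightarrow> real \<Rightarrow> real" where
  "height_density d q =
     (let w = (cap_height d - q) / (1 - q) in density_const d *
       (((cap_height d)\<^sup>2 - 1) * ((real d - 1) / 2) * inc_beta w (1 / 2) (d / 2)
        + (real d + 1) * (1 - q) * inc_beta w (1 / 2) (d / 2 + 1)
        - (real d + 3) / 2 * (1 - q)\<^sup>2 * inc_beta w (1 / 2) (d / 2 + 2)))"

lemma alpha0_props:
  assumes "d \<ge> 3"
  shows "alpha0 d \<in> {0<..<pi}" "angle_equation d (alpha0 d)"
    "0 < cap_height d" "cap_height d < 1" "cos (alpha0 d) = 2 * cap_height d - 1"
    "angle_function d (cap_height d) = Beta (d / 2 + 1) (1 / 2) / 2 ^ d"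
proof -
  have *: "alpha0 d \<in> {0<..<pi} \<and> angle_equation d (alpha0 d)"
    unfolding alpha0_def by (rule theI') (rule ex1_angle_equation[OF assms])
  then show "alpha0 d \<in> {0<..<pi}" "angle_equation d (alpha0 d)" by auto
  from * show "angle_function d (cap_height d) = Beta (d / 2 + 1) (1 / 2) / 2 ^ d"
    by (simp add: angle_equation_iff[OF assms] cap_height_def)
  have c: "cos (alpha0 d / 2) > 0" using * by (intro cos_gt_zero) auto
  have "cos (alpha0 d / 2) < cos 0" using * by (intro cos_monotone_0_pi) auto
  with c show "0 < cap_height d" "cap_height d < 1"
    by (simp_all add: cap_height_def power_less_one_iff abs_square_less_1)
  show "cos (alpha0 d) = 2 * cap_height d - 1"
    using cos_double_cos[of "alpha0 d / 2"] by (simp add: cap_height_def)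
qed

text \<open>The angle equation turns the bracket in \<open>C_const\<close> into a multiple of z^2
  times the very Beta value that \<open>C_const\<close> divides by. The result is the coefficient
  for which the singular terms of \<open>eq_density\<close> cancel.\<close>

lemma C_const_eq:
  assumes d: "d \<ge> 3"
  shows "C_const d = density_const d * (cap_height d)\<^sup>2"
proof -
  define z where "z = cap_height d"
  note a0 = alpha0_props[OF d, folded z_def]
  define Ba Bb where "Ba = inc_beta z (real d / 2 - 1) (d / 2)" and "Bb = inc_beta z (real d / 2 + 1) (d / 2)"
  have Ba: "Ba > 0" unfolding Ba_def using d a0 by (intro inc_beta_pos) auto
  define P g G3 D T where "P = pi powr (real d / 2)" and "g = Gamma (real d / 2 - 1)"
    and "G3 = Gamma ((real d + 3) / 2)" and "D = real d" and "T = (2::real) ^ d"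
  have pos: "P > 0" "g > 0" "G3 > 0" "D \<ge> 3" "T > 0"
    using Gamma_half_pos(1)[OF d] d by (auto simp: P_def g_def G3_def D_def T_def intro!: Gamma_real_pos)
  have eq: "z\<^sup>2 * Ba - Bb = (D / 2 * ((D / 2 - 1) * g)) * sqrt pi / G3 / T"
  proof -
    have e: "real d / 2 + 1 + 1 / 2 = (real d + 3) / 2" by (simp add: field_simps)
    show ?thesis
      using a0(6) unfolding angle_function_def Ba_def[symmetric] Bb_def[symmetric] Beta_def e
        Gamma_half_shifts(2)[OF d] Gamma_one_half_real by (simp add: D_def g_def G3_def T_def)
  qed
  have M: "1 + T * G3 / (sqrt pi * (D / 2 * ((D / 2 - 1) * g))) * Bb = T * G3 / (sqrt pi * (D / 2 * ((D / 2 - 1) * g))) * (z\<^sup>2 * Ba)"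
  proof -
    have "T * G3 / (sqrt pi * (D / 2 * ((D / 2 - 1) * g))) * (z\<^sup>2 * Ba - Bb) = 1"
      unfolding eq using pos by simp
    then show ?thesis by (simp add: right_diff_distrib)
  qed
  have T2: "(2::real) ^ (d - 1) = T / 2" using d by (simp add: T_def power_diff)
  have p: "pi powr ((real d + 1) / 2) = P * sqrt pi"
  proof -
    have "P * sqrt pi = pi powr (real d / 2 + 1/2)" by (simp only: P_def powr_add) (simp add: powr_half_sqrt)
    also have "real d / 2 + 1/2 = (real d + 1) / 2" by (simp add: field_simps)
    finally show ?thesis ..
  qed
  have "C_const d = g / (T / 2 * P) * inverse Ba * (1 + T * G3 / (sqrt pi * (D / 2 * ((D / 2 - 1) * g))) * Bb)"
  proof -
    have e: "(real d - 2) / 2 = real d / 2 - 1" by (simp add: field_simps)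
    show ?thesis
      unfolding C_const_def Let_def cap_height_def[symmetric] z_def[symmetric] T2 Gamma_half_shifts(2)[OF d] e
      by (simp only: Ba_def Bb_def P_def g_def G3_def D_def T_def)
  qed
  also have "\<dots> = 8 * G3 / (D * (D - 2) * (P * sqrt pi)) * z\<^sup>2"
    unfolding M using pos Ba by (simp add: divide_simps)
  finally show ?thesis unfolding density_const_def p z_def by (simp add: G3_def D_def)
qed

text \<open>The factor \<open>W\<close> blows up like 1 / sqrt w at the rim. The hypergeometric part
  contributes \<kappa> * z^2 * W and \<open>F_term\<close> contributes its negative, so only
  incomplete Beta functions remain.\<close>

lemma eq_density_eq:
  assumes d: "d \<ge> 3" and \<eta>: "cos \<eta> = 2 * q - 1" and q: "0 \<le> q" "q < cap_height d"
  shows "eq_density d \<eta> = height_density d q"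
proof -
  define z where "z = cap_height d"
  note a0 = alpha0_props[OF d, folded z_def]
  define w where "w = (z - q) / (1 - q)"
  have q1: "1 - q > 0" using q a0 by (simp add: z_def)
  have w: "0 < w" "w < 1" using q q1 a0 by (simp_all add: w_def z_def)
  have ratios: "(cos (alpha0 d) - cos \<eta>) / (1 - cos \<eta>) = w" "(1 - cos (alpha0 d)) / (1 - cos \<eta>) = 1 - w"
    "(1 - cos (alpha0 d)) / (cos (alpha0 d) - cos \<eta>) = (1 - w) / w" "(1 - cos \<eta>) / (cos (alpha0 d) - cos \<eta>) = 1 / w"
    "1 - cos \<eta> = 2 * (1 - q)" "1 + cos (alpha0 d) = 2 * z"
  proof -
    have zq: "z - q > 0" using q by (simp add: z_def)
    have e: "1 - cos \<eta> = 2 * (1 - q)" "cos (alpha0 d) - cos \<eta> = 2 * (z - q)" "1 - cos (alpha0 d) = 2 * (1 - z)"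
      using \<eta> a0(5) by simp_all
    have w1: "1 - w = (1 - z) / (1 - q)" using q1 by (simp add: w_def field_simps)
    show "(cos (alpha0 d) - cos \<eta>) / (1 - cos \<eta>) = w"
      unfolding e w_def by (rule mult_divide_mult_cancel_left) simp
    show "(1 - cos (alpha0 d)) / (1 - cos \<eta>) = 1 - w"
      unfolding e w1 by (rule mult_divide_mult_cancel_left) simp
    show "(1 - cos (alpha0 d)) / (cos (alpha0 d) - cos \<eta>) = (1 - w) / w"
    proof -
      have "2 * a / (2 * b) = a / b" for a b :: real by simp
      then have "(1 - cos (alpha0 d)) / (cos (alpha0 d) - cos \<eta>) = (1 - z) / (z - q)" unfolding e .
      then show ?thesis unfolding w1 unfolding w_def using q1 zq by simp
    qed
    show "(1 - cos \<eta>) / (cos (alpha0 d) - cos \<eta>) = 1 / w"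
    proof -
      have "2 * a / (2 * b) = a / b" for a b :: real by simp
      then have "(1 - cos \<eta>) / (cos (alpha0 d) - cos \<eta>) = (1 - q) / (z - q)" unfolding e .
      then show ?thesis by (simp add: w_def)
    qed
    show "1 - cos \<eta> = 2 * (1 - q)" by (rule e)
    show "1 + cos (alpha0 d) = 2 * z" using a0(5) by simp
  qed
  define B0 where "B0 = inc_beta w (1/2) (d / 2)"
  define B1 where "B1 = inc_beta w (1/2) (d / 2 + 1)"
  define B2 where "B2 = inc_beta w (1/2) (d / 2 + 2)"
  define \<kappa> where "\<kappa> = density_const d"
  define W where "W = (1 - w) powr (d / 2) / sqrt w"
  have hyp: "hyp2F1 1 ((real d - 1) / 2) (1/2) w = 1 + (real d - 1) / 2 * sqrt w * (1 - w) powr (- (d / 2)) * B0"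
  proof -
    have e: "(real d - 1) / 2 + 1/2 = real d / 2" by (simp add: field_simps)
    show ?thesis
      unfolding B0_def by (rule hyp2F1_one_half[of "(real d - 1) / 2" w, unfolded e]) (use d w in auto)
  qed
  have K: "2 * Gamma ((real d + 3) / 2) / (d * (real d - 2) * pi powr ((real d + 1) / 2)) = \<kappa> / 4"
    by (simp add: \<kappa>_def density_const_def)
  have F: "F_term d \<eta> = - (\<kappa> / 4) * (W * (2 * z)\<^sup>2 + 2 * (real d - 1) * B0 - 2 * (real d + 1) * (2 * (1 - q)) * B1
      + (real d + 3) / 2 * (2 * (1 - q))\<^sup>2 * B2)"
    unfolding F_term_def Let_def ratios(1-4) unfolding ratios(5,6) K by (simp add: W_def B0_def B1_def B2_def real_sqrt_divide)
  have "(1 - w) powr ((real d - 1) / 2) * sqrt ((1 - w) / w) = W"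
  proof -
    have "(1 - w) powr ((real d - 1) / 2) * (1 - w) powr (1/2) = (1 - w) powr (d / 2)"
      unfolding powr_add[symmetric] by (rule arg_cong[where f="(powr) (1 - w)"]) (simp add: field_simps)
    then show ?thesis using w by (simp add: W_def real_sqrt_divide powr_half_sqrt)
  qed
  moreover have "W * (sqrt w * (1 - w) powr (- (d / 2))) = 1"
    using w by (simp add: W_def powr_minus)
  ultimately have "(1 - w) powr ((real d - 1) / 2) * sqrt ((1 - w) / w) * hyp2F1 1 ((real d - 1) / 2) (1/2) w = W + (real d - 1) / 2 * B0"
    unfolding hyp by (simp add: distrib_left mult_ac)
  then have H: "\<kappa> * z\<^sup>2 * ((1 - w) powr ((real d - 1) / 2)) * sqrt ((1 - w) / w) * hyp2F1 1 ((real d - 1) / 2) (1/2) w = \<kappa> * z\<^sup>2 * (W + (real d - 1) / 2 * B0)"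
    by (simp only: mult.assoc)
  have "eq_density d \<eta> = \<kappa> * z\<^sup>2 * (W + (real d - 1) / 2 * B0) + F_term d \<eta>"
    unfolding eq_density_def Let_def ratios(1-3) C_const_eq[OF d] \<kappa>_def[symmetric] z_def[symmetric] H ..
  also have "\<dots> = \<kappa> * ((z\<^sup>2 - 1) * ((real d - 1) / 2) * B0 + (real d + 1) * (1 - q) * B1 - (real d + 3) / 2 * (1 - q)\<^sup>2 * B2)"
    unfolding F by (simp add: field_simps power2_eq_square)
  finally show ?thesis
    unfolding height_density_def Let_def by (simp add: \<kappa>_def B0_def B1_def B2_def w_def z_def)
qed

section \<open>The Abel integral equation\<close>

lemma abel_slope_pos:
  assumes "d \<ge> 3" "0 < t" "t < cap_height d"
  shows "abel_slope d t > 0"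
proof -
  have t1: "t < 1" using assms alpha0_props[OF assms(1)] by linarith
  have "t\<^sup>2 < (cap_height d)\<^sup>2" using assms by (simp add: power_strict_mono)
  then show ?thesis
    unfolding abel_slope_def using assms t1 density_const_pos[OF assms(1)]
    by (intro mult_pos_pos add_pos_pos) auto
qed

text \<open>The datum vanishes at \<open>cap_height\<close>, so integrating its slope back recovers
  it without a boundary term.\<close>

lemma nn_integral_abel_slope:
  assumes d: "d \<ge> 3" and s: "0 < s" "s < cap_height d"
  shows "(\<integral>\<^sup>+t\<in>{s<..<cap_height d}. ennreal (abel_slope d t) \<partial>lborel) = ennreal (abel_datum d s)"
proof -
  let ?z = "cap_height d"
  note a0 = alpha0_props[OF d]
  have "(abel_slope d has_integral - abel_datum d ?z - - abel_datum d s) {s..?z}"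
  proof (rule fundamental_theorem_of_calculus)
    fix t assume t: "t \<in> {s..?z}"
    then have t1: "t < 1" "0 < t" using a0 s by auto
    have d1: "((\<lambda>t. (1 - t) powr (real d / 2 - 1)) has_real_derivative (real d / 2 - 1) * (1 - t) powr (real d / 2 - 1 - 1) * (0 - 1)) (at t)"
      using t1 by (auto intro!: derivative_eq_intros)
    have d2: "((\<lambda>t. ?z\<^sup>2 - t\<^sup>2) has_real_derivative - (2 * t)) (at t)"
      by (auto intro!: derivative_eq_intros)
    have "((\<lambda>t. - (pi * density_const d * ((1 - t) powr (real d / 2 - 1) * (?z\<^sup>2 - t\<^sup>2)))) has_real_derivative
      - (pi * density_const d * ((real d / 2 - 1) * (1 - t) powr (real d / 2 - 1 - 1) * (0 - 1) * (?z\<^sup>2 - t\<^sup>2) + - (2 * t) * (1 - t) powr (real d / 2 - 1)))) (at t)"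
      by (rule DERIV_minus[OF DERIV_cmult[OF DERIV_mult[OF d1 d2]]])
    moreover have "real d / 2 - 1 - 1 = real d / 2 - 2" by simp
    ultimately have "((\<lambda>t. - abel_datum d t) has_real_derivative abel_slope d t) (at t)"
      unfolding abel_datum_def abel_slope_def by (simp add: algebra_simps)
    then show "((\<lambda>t. - abel_datum d t) has_vector_derivative abel_slope d t) (at t within {s..?z})"
      using has_field_derivative_at_within has_real_derivative_iff_has_vector_derivative by blast
  qed (use s in auto)
  moreover have "abel_datum d ?z = 0" by (simp add: abel_datum_def)
  ultimately have "(abel_slope d has_integral abel_datum d s) {s..?z}" by simp
  then show ?thesis
    by (rule nn_integral_Ioo_has_integral) (use abel_slope_pos[OF d] s in \<open>auto intro: less_imp_le\<close>)
qed

text \<open>With t = q + (1 - q) * x one has 1 - t = (1 - q) * (1 - x), so the integrand is x powr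
  (-1/2) times a combination of three powers of 1 - x. This yields incomplete Beta functions with
  second parameters d/2 - 1, d/2 and d/2 + 1; raising each by 1 gives the form of
  \<open>height_density\<close>.\<close>

lemma nn_integral_abel_inverse:
  assumes d: "d \<ge> 3" and q: "0 < q" "q < cap_height d"
  shows "ennreal ((1 - q) powr (- ((real d - 3) / 2)) / pi) *
      (\<integral>\<^sup>+t\<in>{q<..<cap_height d}. ennreal (abel_slope d t / sqrt (t - q)) \<partial>lborel) = ennreal (height_density d q)"
proof -
  define z where "z = cap_height d"
  note a0 = alpha0_props[OF d, folded z_def]
  define s where "s = 1 - q"
  have s: "0 < s" "s < 1" using q a0 by (auto simp: s_def z_def)
  define w where "w = (z - q) / s"
  have w: "0 < w" "w < 1" using q a0 s by (simp_all add: w_def z_def s_def)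
  define \<kappa> where "\<kappa> = density_const d"
  have \<kappa>: "\<kappa> > 0" using density_const_pos[OF d] by (simp add: \<kappa>_def)
  define B0 where "B0 = inc_beta w (1/2) (d / 2)"
  define B1 where "B1 = inc_beta w (1/2) (d / 2 + 1)"
  define B2 where "B2 = inc_beta w (1/2) (d / 2 + 2)"
  define Bm where "Bm = inc_beta w (1/2) (real d / 2 - 1)"
  define S where "S = s powr (real d / 2 - 5/2)"
  let ?b = "\<lambda>b x. x powr (1/2 - 1) * (1 - x) powr (b - 1)"
  let ?h = "\<lambda>x. pi * \<kappa> * S * ((real d / 2 - 1) * (z\<^sup>2 - 1) * ?b (real d / 2 - 1) x
      + real d * s * ?b (real d / 2) x - (real d / 2 + 1) * s\<^sup>2 * ?b (real d / 2 + 1) x)"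
  have h: "abel_slope d (q + s * x) / sqrt (q + s * x - q) = ?h x" if x: "0 < x" "x < w" for x
  proof -
    have x1: "1 - x > 0" using x w by simp
    have t: "1 - (q + s * x) = s * (1 - x)" by (simp add: s_def algebra_simps)
    define Y where "Y = (s * (1 - x)) powr (real d / 2 - 2)"
    have Y: "Y = s powr (real d / 2 - 2) * (1 - x) powr (real d / 2 - 1 - 1)" using s x1 by (simp add: Y_def powr_mult)
    have Y1: "(s * (1 - x)) powr (real d / 2 - 1) = Y * (s * (1 - x))"
    proof -
      have "Y * (s * (1 - x)) = (s * (1 - x)) powr (real d / 2 - 2) * (s * (1 - x)) powr 1" using s x1 by (simp add: Y_def)
      also have "\<dots> = (s * (1 - x)) powr (real d / 2 - 1)" unfolding powr_add[symmetric] by simp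
      finally show ?thesis ..
    qed
    have X0: "(1 - x) powr (real d / 2 - 1) = (1 - x) powr (real d / 2 - 1 - 1) * (1 - x)"
      "(1 - x) powr (real d / 2 + 1 - 1) = (1 - x) powr (real d / 2 - 1 - 1) * (1 - x)\<^sup>2"
    proof -
      have "(1 - x) powr (real d / 2 - 1 - 1) * (1 - x) = (1 - x) powr (real d / 2 - 1 - 1) * (1 - x) powr 1" using x1 by simp
      also have "\<dots> = (1 - x) powr (real d / 2 - 1)" unfolding powr_add[symmetric] by simp
      finally show "(1 - x) powr (real d / 2 - 1) = (1 - x) powr (real d / 2 - 1 - 1) * (1 - x)" ..
      have "(1 - x) powr (real d / 2 - 1 - 1) * (1 - x)\<^sup>2 = (1 - x) powr (real d / 2 - 1 - 1) * (1 - x) powr 2" using x1 by simp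
      also have "\<dots> = (1 - x) powr (real d / 2 + 1 - 1)" unfolding powr_add[symmetric] by simp
      finally show "(1 - x) powr (real d / 2 + 1 - 1) = (1 - x) powr (real d / 2 - 1 - 1) * (1 - x)\<^sup>2" ..
    qed
    have sx: "1 / sqrt (s * x) = s powr (- 1/2) * x powr (1/2 - 1)"
    proof -
      have "1 / sqrt (s * x) = (s * x) powr (- (1/2))" using s x by (simp only: powr_minus_divide) (simp add: powr_half_sqrt)
      then show ?thesis using s x by (simp add: powr_mult)
    qed
    have SS: "S = s powr (real d / 2 - 2) * s powr (- 1/2)"
      unfolding S_def powr_add[symmetric] by simp
    define X where "X = (1 - x) powr (real d / 2 - 1 - 1)"
    have qq: "q + s * x - q = s * x" by simp
    have tt: "q + s * x = 1 - s * (1 - x)" using t by simp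
    have "abel_slope d (q + s * x) / sqrt (q + s * x - q) =
      pi * \<kappa> * ((real d / 2 - 1) * Y * (z\<^sup>2 - (1 - s * (1 - x))\<^sup>2) + 2 * (1 - s * (1 - x)) * (Y * (s * (1 - x)))) * (1 / sqrt (s * x))"
      unfolding qq unfolding abel_slope_def unfolding t Y1 unfolding Y_def[symmetric] \<kappa>_def[symmetric] z_def[symmetric]
      unfolding tt by simp
    also have "\<dots> = pi * \<kappa> * (s powr (real d / 2 - 2) * s powr (- 1/2)) * (x powr (1/2 - 1) *
       (X * ((real d / 2 - 1) * (z\<^sup>2 - (1 - s * (1 - x))\<^sup>2) + 2 * (1 - s * (1 - x)) * (s * (1 - x)))))"
    proof -
      have "p * (A * (a * X) * N + T * (a * X * u)) * (h * c) = p * (a * h) * (c * (X * (A * N + T * u)))"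
        for p A a N T u h c :: real by (simp add: algebra_simps)
      then show ?thesis unfolding sx Y X_def[symmetric] .
    qed
    \<comment> \<open>Expansion in u = s * (1 - x), using z^2 - (1 - u)^2 = (z^2 - 1) + 2 * u -
      u^2.\<close>
    also have "X * ((real d / 2 - 1) * (z\<^sup>2 - (1 - s * (1 - x))\<^sup>2) + 2 * (1 - s * (1 - x)) * (s * (1 - x))) =
      (real d / 2 - 1) * (z\<^sup>2 - 1) * X + real d * s * (X * (1 - x)) - (real d / 2 + 1) * s\<^sup>2 * (X * (1 - x)\<^sup>2)"
      by (simp add: field_simps power2_eq_square)
    finally have "abel_slope d (q + s * x) / sqrt (q + s * x - q) = pi * \<kappa> * (s powr (real d / 2 - 2) * s powr (- 1/2)) * (x powr (1/2 - 1) *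
       ((real d / 2 - 1) * (z\<^sup>2 - 1) * X + real d * s * (X * (1 - x)) - (real d / 2 + 1) * s\<^sup>2 * (X * (1 - x)\<^sup>2)))" .
    then show ?thesis
      unfolding SS[symmetric] X0 X_def[symmetric] by (simp add: algebra_simps)
  qed
  have "(\<integral>\<^sup>+t\<in>{q<..<z}. ennreal (abel_slope d t / sqrt (t - q)) \<partial>lborel) =
    ennreal s * (\<integral>\<^sup>+x. ennreal (abel_slope d (q + s * x) / sqrt (q + s * x - q)) * indicator {q<..<z} (q + s * x) \<partial>lborel)"
    unfolding abel_slope_def by (rule nn_integral_affine_subst[OF _ s(1)]) measurable
  also have "(\<integral>\<^sup>+x. ennreal (abel_slope d (q + s * x) / sqrt (q + s * x - q)) * indicator {q<..<z} (q + s * x) \<partial>lborel) =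
    (\<integral>\<^sup>+x\<in>{0<..<w}. ennreal (?h x) \<partial>lborel)"
  proof (rule nn_integral_cong)
    fix x
    have "q + s * x \<in> {q<..<z} \<longleftrightarrow> x \<in> {0<..<w}"
      using s by (auto simp: w_def zero_less_mult_iff pos_less_divide_eq algebra_simps)
    then show "ennreal (abel_slope d (q + s * x) / sqrt (q + s * x - q)) * indicator {q<..<z} (q + s * x) =
      ennreal (?h x) * indicator {0<..<w} x"
      using h[of x] by (cases "x \<in> {0<..<w}") (simp_all only: indicator_simps greaterThanLessThan_iff mult_1_right mult_zero_right simp_thms)
  qed
  also have "\<dots> = ennreal (pi * \<kappa> * S * ((real d / 2 - 1) * (z\<^sup>2 - 1) * Bm + real d * s * B0 - (real d / 2 + 1) * s\<^sup>2 * B1))"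
  proof (rule nn_integral_Ioo_has_integral)
    show "(?h has_integral pi * \<kappa> * S * ((real d / 2 - 1) * (z\<^sup>2 - 1) * Bm + real d * s * B0 - (real d / 2 + 1) * s\<^sup>2 * B1)) {0..w}"
      unfolding Bm_def B0_def B1_def
      by (intro has_integral_mult_right has_integral_add has_integral_diff has_integral_inc_beta) (use d w in auto)
    fix x assume x: "0 < x" "x < w"
    then have "q + s * x < z" using s by (simp add: w_def pos_less_divide_eq algebra_simps)
    then have "abel_slope d (q + s * x) > 0" using x q s by (intro abel_slope_pos[OF d]) (auto simp: z_def add_pos_pos)
    then show "0 \<le> ?h x" unfolding h[OF x, symmetric] using x s by simp
  qed
  finally have I: "(\<integral>\<^sup>+t\<in>{q<..<z}. ennreal (abel_slope d t / sqrt (t - q)) \<partial>lborel) =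
    ennreal s * ennreal (pi * \<kappa> * S * ((real d / 2 - 1) * (z\<^sup>2 - 1) * Bm + real d * s * B0 - (real d / 2 + 1) * s\<^sup>2 * B1))" .
  have rec: "(real d / 2 - 1) * (z\<^sup>2 - 1) * Bm + real d * s * B0 - (real d / 2 + 1) * s\<^sup>2 * B1 =
    (z\<^sup>2 - 1) * ((real d - 1) / 2) * B0 + (real d + 1) * s * B1 - (real d + 3) / 2 * s\<^sup>2 * B2"
  proof -
    define V where "V = w powr (1/2) * (1 - w) powr (real d / 2 - 1)"
    have sw: "s * (1 - w) = 1 - z" using s by (simp add: w_def s_def field_simps)
    have p1: "(1 - w) powr (real d / 2) = (1 - w) powr (real d / 2 - 1) * (1 - w)"
      and p2: "(1 - w) powr (real d / 2 + 1) = (1 - w) powr (real d / 2 - 1) * (1 - w)\<^sup>2"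
    proof -
      have "(1 - w) powr (real d / 2 - 1) * (1 - w) = (1 - w) powr (real d / 2 - 1) * (1 - w) powr 1" using w by simp
      also have "\<dots> = (1 - w) powr (real d / 2)" unfolding powr_add[symmetric] by simp
      finally show "(1 - w) powr (real d / 2) = (1 - w) powr (real d / 2 - 1) * (1 - w)" ..
      have "(1 - w) powr (real d / 2 - 1) * (1 - w)\<^sup>2 = (1 - w) powr (real d / 2 - 1) * (1 - w) powr 2" using w by simp
      also have "\<dots> = (1 - w) powr (real d / 2 + 1)" unfolding powr_add[symmetric] by (simp add: add.commute)
      finally show "(1 - w) powr (real d / 2 + 1) = (1 - w) powr (real d / 2 - 1) * (1 - w)\<^sup>2" ..
    qed
    have r0: "(real d / 2 - 1) * Bm = (real d - 1) / 2 * B0 - V"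
    proof -
      have "(1/2 + (real d / 2 - 1)) * inc_beta w (1/2) (real d / 2 - 1 + 1) = (real d / 2 - 1) * Bm + V"
        unfolding Bm_def V_def by (rule inc_beta_plus1) (use d w in auto)
      moreover have "1/2 + (real d / 2 - 1) = (real d - 1) / 2" "real d / 2 - 1 + 1 = real d / 2" by (simp_all add: field_simps)
      ultimately have "(real d - 1) / 2 * B0 = (real d / 2 - 1) * Bm + V" by (simp only: B0_def)
      then show ?thesis by linarith
    qed
    have r1: "real d * B0 = (real d + 1) * B1 - 2 * (V * (1 - w))"
    proof -
      have "(1/2 + real d / 2) * inc_beta w (1/2) (real d / 2 + 1) = real d / 2 * B0 + w powr (1/2) * (1 - w) powr (real d / 2)"
        unfolding B0_def by (rule inc_beta_plus1) (use d w in auto)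
      then show ?thesis unfolding p1 B1_def[symmetric] V_def by (simp add: algebra_simps)
    qed
    have r2: "(real d / 2 + 1) * B1 = (real d + 3) / 2 * B2 - V * (1 - w)\<^sup>2"
    proof -
      have "(1/2 + (real d / 2 + 1)) * inc_beta w (1/2) (real d / 2 + 1 + 1) = (real d / 2 + 1) * B1 + w powr (1/2) * (1 - w) powr (real d / 2 + 1)"
        unfolding B1_def by (rule inc_beta_plus1) (use d w in auto)
      moreover have "1/2 + (real d / 2 + 1) = (real d + 3) / 2" "real d / 2 + 1 + 1 = real d / 2 + 2" by (simp_all add: field_simps)
      ultimately have "(real d + 3) / 2 * B2 = (real d / 2 + 1) * B1 + w powr (1/2) * ((1 - w) powr (real d / 2 - 1) * (1 - w)\<^sup>2)"
        by (simp only: B2_def p2)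
      then show ?thesis unfolding V_def mult.assoc by linarith
    qed
    have "(real d / 2 - 1) * (z\<^sup>2 - 1) * Bm + real d * s * B0 - (real d / 2 + 1) * s\<^sup>2 * B1 =
      (z\<^sup>2 - 1) * ((real d / 2 - 1) * Bm) + s * (real d * B0) - s\<^sup>2 * ((real d / 2 + 1) * B1)" by (simp add: mult_ac)
    also have "\<dots> = (z\<^sup>2 - 1) * ((real d - 1) / 2 * B0) + s * ((real d + 1) * B1) - s\<^sup>2 * ((real d + 3) / 2 * B2)
      - V * ((z\<^sup>2 - 1) + 2 * (s * (1 - w)) - (s * (1 - w))\<^sup>2)"
      unfolding r0 r1 r2 by (simp add: algebra_simps power2_eq_square)
    \<comment> \<open>The three boundary terms share the factor \<open>V\<close>, and the sum of
      their coefficients is z^2 - (1 - u)^2 at u = s * (1 - w) = 1 - z. It is 0 because the datum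
      vanishes at z.\<close>
    also have "(z\<^sup>2 - 1) + 2 * (s * (1 - w)) - (s * (1 - w))\<^sup>2 = 0"
      unfolding sw by (simp add: power2_eq_square algebra_simps)
    finally show ?thesis by (simp add: mult_ac)
  qed
  define R where "R = (z\<^sup>2 - 1) * ((real d - 1) / 2) * B0 + (real d + 1) * s * B1 - (real d + 3) / 2 * s\<^sup>2 * B2"
  have sp: "s powr (- ((real d - 3) / 2)) / pi * (s * (pi * \<kappa> * S * R)) = \<kappa> * R"
  proof -
    have "s powr (- ((real d - 3) / 2)) * (s powr 1 * s powr (real d / 2 - 5/2)) = s powr 0"
      unfolding powr_add[symmetric] by (rule arg_cong[where f="(powr) s"]) (simp add: field_simps)
    then have "s powr (- ((real d - 3) / 2)) * (s * S) = 1" using s by (simp add: S_def)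
    then have "s powr (- ((real d - 3) / 2)) * (s * S) * (\<kappa> * R) = \<kappa> * R" by simp
    then show ?thesis by (simp add: mult_ac)
  qed
  have "ennreal (s powr (- ((real d - 3) / 2)) / pi) * (ennreal s * ennreal (pi * \<kappa> * S * R)) = ennreal (\<kappa> * R)"
    unfolding sp[symmetric] using s by (simp only: ennreal_mult' divide_nonneg_pos powr_ge_zero pi_gt_zero less_imp_le)
  then show ?thesis
    unfolding z_def[symmetric] s_def[symmetric] I rec R_def[symmetric]
    by (simp add: R_def height_density_def Let_def \<kappa>_def B0_def B1_def B2_def w_def z_def s_def)
qed

text \<open>The closed formula has terms of both signs and hides positivity; in the Abel
  representation the integrand is positive on a nondegenerate interval.\<close>

lemma height_density_pos:
  assumes d: "d \<ge> 3" and q: "0 < q" "q < cap_height d"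
  shows "height_density d q > 0"
proof (rule ccontr)
  assume "\<not> height_density d q > 0"
  then have "ennreal ((1 - q) powr (- ((real d - 3) / 2)) / pi) *
      (\<integral>\<^sup>+t\<in>{q<..<cap_height d}. ennreal (abel_slope d t / sqrt (t - q)) \<partial>lborel) = 0"
    using nn_integral_abel_inverse[OF assms] by (simp add: ennreal_neg)
  moreover have "(1 - q) powr (- ((real d - 3) / 2)) / pi > 0" using q alpha0_props[OF d] by simp
  ultimately have "(\<integral>\<^sup>+t\<in>{q<..<cap_height d}. ennreal (abel_slope d t / sqrt (t - q)) \<partial>lborel) = 0"
    by (auto simp: ennreal_eq_0_iff)
  then have "AE t in lborel. ennreal (abel_slope d t / sqrt (t - q)) * indicator {q<..<cap_height d} t = 0"
    unfolding abel_slope_def by (subst (asm) nn_integral_0_iff_AE) auto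
  moreover have "ennreal (abel_slope d t / sqrt (t - q)) * indicator {q<..<cap_height d} t \<noteq> 0" if "t \<in> {q<..<cap_height d}" for t
  proof -
    have "abel_slope d t / sqrt (t - q) > 0" using that q by (intro divide_pos_pos abel_slope_pos[OF d]) auto
    moreover have "indicator {q<..<cap_height d} t = (1::ennreal)" using that by simp
    ultimately show ?thesis by (simp only: mult_1_right ennreal_eq_0_iff not_le)
  qed
  ultimately have "AE t in lborel. t \<notin> {q<..<cap_height d}" by (auto elim!: eventually_mono)
  then have "emeasure lborel {q<..<cap_height d} = 0" by (subst (asm) AE_iff_measurable[where N="{q<..<cap_height d}"]) auto
  then show False using q by simp
qed

lemma measurable_pred_Ioo [measurable (raw)]:
  fixes f g h :: "'c \<Rightarrow> real"
  assumes "f \<in> borel_measurable M" "g \<in> borel_measurable M" "h \<in> borel_measurable M"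
  shows "Measurable.pred M (\<lambda>x. f x \<in> {g x<..<h x})"
  using assms unfolding greaterThanLessThan_iff by measurable

section \<open>Potentials of zonal densities\<close>

lemma surface_const_Suc: "surface_const (m + 3) = real (Suc m) * unit_ball_vol (Suc m)"
  by (simp add: surface_const_def)

text \<open>u = 2 * q - 1, hence 1 - u^2 = 4 * q * (1 - q). The order of integration is exchanged so
  that the integral over v, the average over rotations about the axis, stands inside.\<close>

lemma nn_integral_sphere_height:
  fixes e w :: "'a::euclidean_space" and G :: "real \<Rightarrow> real \<Rightarrow> ennreal"
  assumes e: "e \<in> Basis" and w: "norm w = 1" "e \<bullet> w = 0" and d: "DIM('a) = m + 3"
    and G: "(\<lambda>(u,s). G u s) \<in> borel_measurable (borel \<Otimes>\<^sub>M borel)"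
  shows "(\<integral>\<^sup>+y. G (y \<bullet> e) (y \<bullet> w) \<partial>sphere_measure) = ennreal (surface_const (m + 3)) *
     (\<integral>\<^sup>+q\<in>{0<..<1}. ennreal (2 * (4 * (q * (1 - q))) powr (real m / 2)) *
       (\<integral>\<^sup>+v\<in>{-1<..<1}. ennreal ((1 - v\<^sup>2) powr ((real m - 1) / 2)) * G (2 * q - 1) (v * sqrt (4 * (q * (1 - q)))) \<partial>lborel) \<partial>lborel)"
proof -
  have Gm [measurable (raw)]: "(\<lambda>x. G (f x) (g x)) \<in> borel_measurable M"
    if "f \<in> borel_measurable M" "g \<in> borel_measurable M" for f g and M :: "'c measure"
    using measurable_compose[of "\<lambda>x. (f x, g x)", OF _ G] that by simp
  define h where "h u = ennreal ((1 - u\<^sup>2) powr (real m / 2)) *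
       (\<integral>\<^sup>+v\<in>{-1<..<1}. ennreal ((1 - v\<^sup>2) powr ((real m - 1) / 2)) * G u (v * sqrt (1 - u\<^sup>2)) \<partial>lborel)" for u
  have [measurable]: "h \<in> borel_measurable borel" unfolding h_def[abs_def] by measurable
  let ?F = "\<lambda>v u. ennreal ((1 - v\<^sup>2) powr ((real m - 1) / 2)) * ennreal ((1 - u\<^sup>2) powr (real m / 2)) * G u (v * sqrt (1 - u\<^sup>2))"
  have "(\<integral>\<^sup>+v\<in>{-1<..<1}. (\<integral>\<^sup>+u\<in>{-1<..<1}. ?F v u \<partial>lborel) \<partial>lborel) =
    (\<integral>\<^sup>+v. \<integral>\<^sup>+u. ?F v u * indicator {-1<..<1} u * indicator {-1<..<1} v \<partial>lborel \<partial>lborel)"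
    by (intro nn_integral_cong nn_integral_multc[symmetric]) measurable
  also have "\<dots> = (\<integral>\<^sup>+u. \<integral>\<^sup>+v. ?F v u * indicator {-1<..<1} u * indicator {-1<..<1} v \<partial>lborel \<partial>lborel)"
    by (rule lborel_pair.Fubini') measurable
  also have "\<dots> = (\<integral>\<^sup>+u\<in>{-1<..<1}. h u \<partial>lborel)"
  proof (rule nn_integral_cong)
    fix u :: real
    have "(\<integral>\<^sup>+v. ?F v u * indicator {-1<..<1} u * indicator {-1<..<1} v \<partial>lborel) =
      (\<integral>\<^sup>+v. (ennreal ((1 - u\<^sup>2) powr (real m / 2)) * indicator {-1<..<1} u) *
        (ennreal ((1 - v\<^sup>2) powr ((real m - 1) / 2)) * G u (v * sqrt (1 - u\<^sup>2)) * indicator {-1<..<1} v) \<partial>lborel)"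
      by (simp only: mult_ac)
    also have "\<dots> = (ennreal ((1 - u\<^sup>2) powr (real m / 2)) * indicator {-1<..<1} u) *
      (\<integral>\<^sup>+v\<in>{-1<..<1}. ennreal ((1 - v\<^sup>2) powr ((real m - 1) / 2)) * G u (v * sqrt (1 - u\<^sup>2)) \<partial>lborel)"
      by (rule nn_integral_cmult) measurable
    finally show "(\<integral>\<^sup>+v. ?F v u * indicator {-1<..<1} u * indicator {-1<..<1} v \<partial>lborel) = h u * indicator {-1<..<1} u"
      unfolding h_def by (simp only: mult_ac)
  qed
  also have "\<dots> = ennreal 2 * (\<integral>\<^sup>+q. h (-1 + 2 * q) * indicator {-1<..<1} (-1 + 2 * q) \<partial>lborel)"
    by (rule nn_integral_affine_subst) auto
  also have "\<dots> = (\<integral>\<^sup>+q. ennreal 2 * (h (-1 + 2 * q) * indicator {-1<..<1} (-1 + 2 * q)) \<partial>lborel)"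
    by (rule nn_integral_cmult[symmetric]) measurable
  also have "\<dots> = (\<integral>\<^sup>+q\<in>{0<..<1}. ennreal (2 * (4 * (q * (1 - q))) powr (real m / 2)) *
       (\<integral>\<^sup>+v\<in>{-1<..<1}. ennreal ((1 - v\<^sup>2) powr ((real m - 1) / 2)) * G (2 * q - 1) (v * sqrt (4 * (q * (1 - q)))) \<partial>lborel) \<partial>lborel)"
  proof (rule nn_integral_cong)
    fix q :: real
    have 1: "-1 + 2 * q = 2 * q - 1" by simp
    have 2: "1 - (2 * q - 1)\<^sup>2 = 4 * (q * (1 - q))" by (simp add: power2_eq_square algebra_simps)
    have 3: "indicator {-1<..<1} (2 * q - 1) = (indicator {0<..<1} q :: ennreal)" by (auto simp: indicator_def)
    have 4: "ennreal (2 * x) = ennreal 2 * ennreal x" for x by (rule ennreal_mult') simp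
    show "ennreal 2 * (h (-1 + 2 * q) * indicator {-1<..<1} (-1 + 2 * q)) = ennreal (2 * (4 * (q * (1 - q))) powr (real m / 2)) *
       (\<integral>\<^sup>+v\<in>{-1<..<1}. ennreal ((1 - v\<^sup>2) powr ((real m - 1) / 2)) * G (2 * q - 1) (v * sqrt (4 * (q * (1 - q)))) \<partial>lborel) * indicator {0<..<1} q"
      unfolding 1 3 h_def 2 4 by (simp only: mult.assoc)
  qed
  finally show ?thesis
    unfolding nn_integral_sphere[OF e w d G] surface_const_Suc by (simp only:)
qed

text \<open>The squared distance from x to y depends only on the coordinates of y along
  \<open>e\<close> and along the horizontal direction \<open>w\<close> of x. The integral over v is
  Copson's with k = (m - 1) / 2; then all powers of 2 and of q cancel, and exchanging q and t
  exhibits the nested Abel transforms.\<close>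

lemma zonal_potential:
  fixes e x :: "'a::euclidean_space" and \<phi> :: "real \<Rightarrow> ennreal"
  assumes e: "e \<in> Basis" and x: "norm x = 1" "x \<bullet> e = 2 * p - 1" and p: "0 < p" "p < 1" and d: "DIM('a) = m + 3"
    and [measurable]: "\<phi> \<in> borel_measurable borel"
  shows "(\<integral>\<^sup>+y. \<phi> ((1 + y \<bullet> e) / 2) * inverse (ennreal (norm (x - y) ^ (DIM('a) - 2))) \<partial>sphere_measure) =
    ennreal (surface_const (m + 3) * p powr (- (real m / 2))) *
     (\<integral>\<^sup>+t\<in>{0<..<p}. ennreal (t powr ((real m - 1) / 2) * (1 - t) powr (- ((real m + 1) / 2)) / sqrt (p - t)) *
       (\<integral>\<^sup>+q\<in>{t<..<1}. \<phi> q * ennreal ((1 - q) powr (real m / 2) / sqrt (q - t)) \<partial>lborel) \<partial>lborel)"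
proof -
  \<comment> \<open>The sine of the polar angle of x, positive because x is not a pole.\<close>
  define c where "c = sqrt (4 * (p * (1 - p)))"
  have c: "c > 0" using p by (simp add: c_def)
  have c2: "c\<^sup>2 = 4 * (p * (1 - p))" using p by (simp add: c_def)
  have ee: "e \<bullet> e = 1" using e by simp
  define w where "w = (1 / c) *\<^sub>R (x - (2 * p - 1) *\<^sub>R e)"
  have xx: "x \<bullet> x = 1" using x by (simp add: norm_eq_1)
  have ew: "e \<bullet> w = 0" using x ee by (simp add: w_def inner_diff_right inner_commute)
  have nw: "norm w = 1"
  proof -
    have "(x - a *\<^sub>R e) \<bullet> (x - a *\<^sub>R e) = 1 - a\<^sup>2" if "x \<bullet> e = a" for a
      using that ee xx inner_commute[of e x] by (simp add: inner_diff_left inner_diff_right power2_eq_square)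
    from this[OF x(2)] have "w \<bullet> w = (1 / c)\<^sup>2 * (1 - (2 * p - 1)\<^sup>2)"
      unfolding w_def by (simp add: power2_eq_square)
    also have "1 - (2 * p - 1)\<^sup>2 = c\<^sup>2" unfolding c2 by (simp add: power2_eq_square algebra_simps)
    also have "(1 / c)\<^sup>2 * c\<^sup>2 = 1" using c by (simp add: power_divide)
    finally show ?thesis by (simp add: norm_eq_1)
  qed
  have xw: "x = (2 * p - 1) *\<^sub>R e + c *\<^sub>R w" using c by (simp add: w_def)
  define N where "N u s = 2 - 2 * ((2 * p - 1) * u + c * s)" for u s
  define G where "G u s = \<phi> ((1 + u) / 2) * inverse (ennreal (sqrt (N u s) ^ (m + 1)))" for u s
  have Gm: "(\<lambda>(u,s). G u s) \<in> borel_measurable (borel \<Otimes>\<^sub>M borel)"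
    unfolding G_def N_def by measurable
  define k where "k = (real m - 1) / 2"
  have e1: "(real m - 1) / 2 = k" and e2: "- ((real m + 1) / 2) = - k - 1"
    by (simp_all add: k_def field_simps)
  define E where "E q v = p + q - 2 * p * q - 2 * sqrt (p * (1 - p) * (q * (1 - q))) * v" for q v
  have "(\<integral>\<^sup>+y. \<phi> ((1 + y \<bullet> e) / 2) * inverse (ennreal (norm (x - y) ^ (DIM('a) - 2))) \<partial>sphere_measure) =
    (\<integral>\<^sup>+y. G (y \<bullet> e) (y \<bullet> w) \<partial>sphere_measure)"
  proof (rule nn_integral_cong)
    fix y :: 'a assume "y \<in> space sphere_measure"
    then have "norm y = 1" by (simp add: sphere_measure_def space_scale_measure space_restrict_space)
    then have yy: "y \<bullet> y = 1" by (simp add: norm_eq_1)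
    have "x \<bullet> y = (2 * p - 1) * (y \<bullet> e) + c * (y \<bullet> w)"
      by (subst xw) (simp add: inner_add_left inner_commute[of e y] inner_commute[of w y])
    then have "(norm (x - y))\<^sup>2 = N (y \<bullet> e) (y \<bullet> w)"
      using xx yy by (simp add: power2_norm_eq_inner inner_diff_left inner_diff_right inner_commute[of y x] N_def)
    then have "norm (x - y) = sqrt (N (y \<bullet> e) (y \<bullet> w))"
      by (metis norm_ge_zero real_sqrt_unique)
    then show "\<phi> ((1 + y \<bullet> e) / 2) * inverse (ennreal (norm (x - y) ^ (DIM('a) - 2))) = G (y \<bullet> e) (y \<bullet> w)"
      unfolding G_def d by simp
  qed
  also have "\<dots> = ennreal (surface_const (m + 3)) *
     (\<integral>\<^sup>+q\<in>{0<..<1}. ennreal (2 * (4 * (q * (1 - q))) powr (real m / 2)) *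
       (\<integral>\<^sup>+v\<in>{-1<..<1}. ennreal ((1 - v\<^sup>2) powr ((real m - 1) / 2)) * G (2 * q - 1) (v * sqrt (4 * (q * (1 - q)))) \<partial>lborel) \<partial>lborel)"
    by (rule nn_integral_sphere_height[OF e nw ew d Gm])
  also have "(\<integral>\<^sup>+q\<in>{0<..<1}. ennreal (2 * (4 * (q * (1 - q))) powr (real m / 2)) *
       (\<integral>\<^sup>+v\<in>{-1<..<1}. ennreal ((1 - v\<^sup>2) powr ((real m - 1) / 2)) * G (2 * q - 1) (v * sqrt (4 * (q * (1 - q)))) \<partial>lborel) \<partial>lborel) =
    (\<integral>\<^sup>+q\<in>{0<..<1}. ennreal (p powr (- (real m / 2))) * (\<phi> q * ennreal ((1 - q) powr (real m / 2)) *
       (\<integral>\<^sup>+t\<in>{0<..<min p q}. ennreal (t powr k * (1 - t) powr (- k - 1) / sqrt ((p - t) * (q - t))) \<partial>lborel)) \<partial>lborel)"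
  \<comment> \<open>The Copson formula concerns distinct heights; q = p is a null set.\<close>
  proof (rule nn_integral_cong_AE, rule AE_mp[OF AE_lborel_singleton[of p]], rule AE_I2, rule impI)
    fix q :: real assume qp: "q \<noteq> p"
    let ?I = "\<integral>\<^sup>+t\<in>{0<..<min p q}. ennreal (t powr k * (1 - t) powr (- k - 1) / sqrt ((p - t) * (q - t))) \<partial>lborel"
    have "ennreal (2 * (4 * (q * (1 - q))) powr (real m / 2)) *
       (\<integral>\<^sup>+v\<in>{-1<..<1}. ennreal ((1 - v\<^sup>2) powr ((real m - 1) / 2)) * G (2 * q - 1) (v * sqrt (4 * (q * (1 - q)))) \<partial>lborel) =
      ennreal (p powr (- (real m / 2))) * (\<phi> q * ennreal ((1 - q) powr (real m / 2)) * ?I)" if q: "0 < q" "q < 1"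
    proof -
      have N: "N (2 * q - 1) (v * sqrt (4 * (q * (1 - q)))) = 4 * E q v" for v
      proof -
        define Z S where "Z = sqrt (4 * (q * (1 - q)))" and "S = sqrt (p * (1 - p) * (q * (1 - q)))"
        have cZ: "c * Z = 4 * S"
          unfolding c_def Z_def S_def by (simp add: real_sqrt_mult)
        have "c * (v * Z) = (c * Z) * v" by simp
        then have "N (2 * q - 1) (v * Z) = 2 - 2 * ((2 * p - 1) * (2 * q - 1) + 4 * S * v)"
          unfolding N_def cZ by (simp only:)
        also have "\<dots> = 4 * (p + q - 2 * p * q - 2 * S * v)" by (simp add: algebra_simps)
        finally show ?thesis unfolding Z_def S_def E_def .
      qed
      have E0: "E q v > 0" if "v < 1" for v
      proof -
        define S where "S = sqrt (p * (1 - p) * (q * (1 - q)))"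
        have S: "S > 0" using p q by (simp add: S_def)
        have SS: "S = sqrt (p * (1 - q)) * sqrt (q * (1 - p))"
          unfolding S_def real_sqrt_mult[symmetric] by (simp add: mult_ac)
        have "0 \<le> (sqrt (p * (1 - q)) - sqrt (q * (1 - p)))\<^sup>2" by simp
        also have "\<dots> = p * (1 - q) + q * (1 - p) - 2 * S"
          unfolding power2_diff SS using p q by simp
        finally have "2 * S \<le> p + q - 2 * p * q" by (simp add: algebra_simps)
        moreover have "S * v < S * 1" using that S by (intro mult_strict_left_mono)
        ultimately show ?thesis unfolding E_def S_def[symmetric] by (simp add: mult.assoc)
      qed
      have "(\<integral>\<^sup>+v\<in>{-1<..<1}. ennreal ((1 - v\<^sup>2) powr ((real m - 1) / 2)) * G (2 * q - 1) (v * sqrt (4 * (q * (1 - q)))) \<partial>lborel) =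
        (\<integral>\<^sup>+v. \<phi> q * ennreal (1 / 2 ^ (m + 1)) * (ennreal ((1 - v\<^sup>2) powr k * E q v powr (- k - 1)) * indicator {-1<..<1} v) \<partial>lborel)"
      proof (rule nn_integral_cong)
        fix v :: real
        have "G (2 * q - 1) (v * sqrt (4 * (q * (1 - q)))) = \<phi> q * (ennreal (1 / 2 ^ (m + 1)) * ennreal (E q v powr (- k - 1)))"
          if v: "v \<in> {-1<..<1}"
        proof -
          have Ev: "E q v > 0" using E0 v by simp
          have "sqrt (4 * E q v) ^ (m + 1) = 2 ^ (m + 1) * E q v powr (k + 1)"
          proof -
            have "sqrt (4 * E q v) = 2 * E q v powr (1/2)" using Ev by (simp add: real_sqrt_mult powr_half_sqrt)
            moreover have "(E q v powr (1/2)) ^ (m + 1) = E q v powr (k + 1)"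
            proof -
              have "(E q v powr (1/2)) ^ (m + 1) = (E q v powr (1/2)) powr real (m + 1)"
                by (rule powr_realpow[symmetric]) (use Ev in simp)
              also have "\<dots> = E q v powr (1/2 * real (m + 1))" by (rule powr_powr)
              also have "1/2 * real (m + 1) = k + 1" by (simp add: k_def field_simps)
              finally show ?thesis .
            qed
            ultimately show ?thesis by (simp only: power_mult_distrib)
          qed
          moreover have "inverse (ennreal (2 ^ (m + 1) * E q v powr (k + 1))) = ennreal (1 / 2 ^ (m + 1) * E q v powr (- k - 1))"
          proof -
            have e: "- k - 1 = - (k + 1)" by simp
            have "inverse (ennreal (2 ^ (m + 1) * E q v powr (k + 1))) = ennreal (inverse (2 ^ (m + 1) * E q v powr (k + 1)))"
              by (rule inverse_ennreal) (use Ev in simp)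
            also have "inverse (2 ^ (m + 1) * E q v powr (k + 1)) = 1 / 2 ^ (m + 1) * E q v powr (- k - 1)"
              unfolding e powr_minus by (simp add: field_simps)
            finally show ?thesis .
          qed
          moreover have "(1 + (2 * q - 1)) / 2 = q" by simp
          moreover have "ennreal (1 / 2 ^ (m + 1) * E q v powr (- k - 1)) = ennreal (1 / 2 ^ (m + 1)) * ennreal (E q v powr (- k - 1))"
            by (rule ennreal_mult) auto
          ultimately show ?thesis unfolding G_def N by (simp only:)
        qed
        moreover have "ennreal ((1 - v\<^sup>2) powr k * E q v powr (- k - 1)) = ennreal ((1 - v\<^sup>2) powr k) * ennreal (E q v powr (- k - 1))"
          by (rule ennreal_mult) auto
        ultimately show "ennreal ((1 - v\<^sup>2) powr ((real m - 1) / 2)) * G (2 * q - 1) (v * sqrt (4 * (q * (1 - q)))) * indicator {-1<..<1} v =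
          \<phi> q * ennreal (1 / 2 ^ (m + 1)) * (ennreal ((1 - v\<^sup>2) powr k * E q v powr (- k - 1)) * indicator {-1<..<1} v)"
          by (cases "v \<in> {-1<..<1}") (simp_all only: indicator_simps mult_1_right mult_zero_right mult_zero_left k_def[symmetric] simp_thms mult_ac)
      qed
      also have "\<dots> = \<phi> q * ennreal (1 / 2 ^ (m + 1)) * (\<integral>\<^sup>+v\<in>{-1<..<1}. ennreal ((1 - v\<^sup>2) powr k * E q v powr (- k - 1)) \<partial>lborel)"
        by (rule nn_integral_cmult) (unfold E_def, measurable)
      also have "(\<integral>\<^sup>+v\<in>{-1<..<1}. ennreal ((1 - v\<^sup>2) powr k * E q v powr (- k - 1)) \<partial>lborel) = ennreal ((p * q) powr (- k - 1/2)) * ?I"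
        unfolding E_def using qp by (intro nn_integral_copson_cap p q) simp
      finally have "ennreal (2 * (4 * (q * (1 - q))) powr (real m / 2)) *
         (\<integral>\<^sup>+v\<in>{-1<..<1}. ennreal ((1 - v\<^sup>2) powr ((real m - 1) / 2)) * G (2 * q - 1) (v * sqrt (4 * (q * (1 - q)))) \<partial>lborel) =
        ennreal (2 * (4 * (q * (1 - q))) powr (real m / 2)) * (\<phi> q * ennreal (1 / 2 ^ (m + 1)) * (ennreal ((p * q) powr (- k - 1/2)) * ?I))"
        by (simp only:)
      also have "\<dots> = (ennreal (2 * (4 * (q * (1 - q))) powr (real m / 2)) * ennreal (1 / 2 ^ (m + 1)) * ennreal ((p * q) powr (- k - 1/2))) * (\<phi> q * ?I)"
        by (simp only: mult_ac)
      also have "ennreal (2 * (4 * (q * (1 - q))) powr (real m / 2)) * ennreal (1 / 2 ^ (m + 1)) * ennreal ((p * q) powr (- k - 1/2)) =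
        ennreal (p powr (- (real m / 2))) * ennreal ((1 - q) powr (real m / 2))"
      proof -
        have "(4 * (q * (1 - q))) powr (real m / 2) = 2 ^ m * (q powr (real m / 2) * (1 - q) powr (real m / 2))"
        proof -
          have "(4::real) powr (real m / 2) = 2 powr (2 * (real m / 2))"
            using powr_powr[of 2 2 "real m / 2"] by simp
          also have "\<dots> = 2 ^ m" by (simp add: powr_realpow)
          finally show ?thesis using q by (simp add: powr_mult)
        qed
        moreover have "(p * q) powr (- k - 1/2) = p powr (- (real m / 2)) * q powr (- (real m / 2))"
        proof -
          have "- k - 1/2 = - (real m / 2)" by (simp add: k_def field_simps)
          then show ?thesis using p q by (simp add: powr_mult)
        qed
        moreover have "q powr (real m / 2) * q powr (- (real m / 2)) = 1"
          unfolding powr_add[symmetric] using q by simp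
        ultimately have "2 * (4 * (q * (1 - q))) powr (real m / 2) * (1 / 2 ^ (m + 1)) * (p * q) powr (- k - 1/2) =
          p powr (- (real m / 2)) * (1 - q) powr (real m / 2)" by (simp add: field_simps)
        moreover have "ennreal (2 * (4 * (q * (1 - q))) powr (real m / 2)) * ennreal (1 / 2 ^ (m + 1)) * ennreal ((p * q) powr (- k - 1/2)) =
          ennreal (2 * (4 * (q * (1 - q))) powr (real m / 2) * (1 / 2 ^ (m + 1)) * (p * q) powr (- k - 1/2))"
          by (simp add: ennreal_mult[symmetric])
        moreover have "ennreal (p powr (- (real m / 2)) * (1 - q) powr (real m / 2)) = ennreal (p powr (- (real m / 2))) * ennreal ((1 - q) powr (real m / 2))"
          by (rule ennreal_mult) auto
        ultimately show ?thesis by (simp only:)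
      qed
      finally show ?thesis by (simp only: mult_ac)
    qed
    then show "ennreal (2 * (4 * (q * (1 - q))) powr (real m / 2)) *
       (\<integral>\<^sup>+v\<in>{-1<..<1}. ennreal ((1 - v\<^sup>2) powr ((real m - 1) / 2)) * G (2 * q - 1) (v * sqrt (4 * (q * (1 - q)))) \<partial>lborel) * indicator {0<..<1} q =
      ennreal (p powr (- (real m / 2))) * (\<phi> q * ennreal ((1 - q) powr (real m / 2)) * ?I) * indicator {0<..<1} q"
    proof (cases "q \<in> {0<..<1}")
      case True
      then have "0 < q" "q < 1" by auto
      moreover assume *: "0 < q \<Longrightarrow> q < 1 \<Longrightarrow> ennreal (2 * (4 * (q * (1 - q))) powr (real m / 2)) *
       (\<integral>\<^sup>+v\<in>{-1<..<1}. ennreal ((1 - v\<^sup>2) powr ((real m - 1) / 2)) * G (2 * q - 1) (v * sqrt (4 * (q * (1 - q)))) \<partial>lborel) =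
      ennreal (p powr (- (real m / 2))) * (\<phi> q * ennreal ((1 - q) powr (real m / 2)) * ?I)"
      ultimately show ?thesis by (simp only:)
    next
      case False
      then have "indicator {0<..<1} q = (0::ennreal)" by simp
      then show ?thesis by (simp only: mult_zero_right)
    qed
  qed
  also have "\<dots> = (\<integral>\<^sup>+q. \<integral>\<^sup>+t. ennreal (p powr (- (real m / 2))) * ((ennreal (t powr k * (1 - t) powr (- k - 1) / sqrt (p - t)) * indicator {0<..<p} t) *
      (\<phi> q * ennreal ((1 - q) powr (real m / 2) / sqrt (q - t)) * indicator {t<..<1} q)) \<partial>lborel \<partial>lborel)"
  proof (rule nn_integral_cong)
    fix q :: real
    let ?c = "ennreal (p powr (- (real m / 2))) * (\<phi> q * ennreal ((1 - q) powr (real m / 2))) * indicator {0<..<1} q"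
    have "ennreal (p powr (- (real m / 2))) * (\<phi> q * ennreal ((1 - q) powr (real m / 2)) *
       (\<integral>\<^sup>+t\<in>{0<..<min p q}. ennreal (t powr k * (1 - t) powr (- k - 1) / sqrt ((p - t) * (q - t))) \<partial>lborel)) * indicator {0<..<1} q =
      ?c * (\<integral>\<^sup>+t\<in>{0<..<min p q}. ennreal (t powr k * (1 - t) powr (- k - 1) / sqrt ((p - t) * (q - t))) \<partial>lborel)"
      by (simp only: mult_ac)
    also have "\<dots> = (\<integral>\<^sup>+t. ?c * (ennreal (t powr k * (1 - t) powr (- k - 1) / sqrt ((p - t) * (q - t))) * indicator {0<..<min p q} t) \<partial>lborel)"
      by (rule nn_integral_cmult[symmetric]) measurable
    also have "\<dots> = (\<integral>\<^sup>+t. ennreal (p powr (- (real m / 2))) * ((ennreal (t powr k * (1 - t) powr (- k - 1) / sqrt (p - t)) * indicator {0<..<p} t) *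
      (\<phi> q * ennreal ((1 - q) powr (real m / 2) / sqrt (q - t)) * indicator {t<..<1} q)) \<partial>lborel)"
    proof (rule nn_integral_cong)
      fix t :: real
      \<comment> \<open>The region 0 < t < min p q, q < 1 rewritten as 0 < t < p, t < q < 1, the
        shape in which q becomes the inner variable.\<close>
      have ind: "indicator {0<..<1} q * indicator {0<..<min p q} t = (indicator {0<..<p} t * indicator {t<..<1} q :: ennreal)"
        by (auto simp: indicator_def)
      have e: "ennreal ((1 - q) powr (real m / 2)) * ennreal (t powr k * (1 - t) powr (- k - 1) / sqrt ((p - t) * (q - t))) =
        ennreal (t powr k * (1 - t) powr (- k - 1) / sqrt (p - t)) * ennreal ((1 - q) powr (real m / 2) / sqrt (q - t))" if "t < p" "t < q"
        using that by (simp add: ennreal_mult[symmetric] real_sqrt_mult)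
      show "?c * (ennreal (t powr k * (1 - t) powr (- k - 1) / sqrt ((p - t) * (q - t))) * indicator {0<..<min p q} t) =
        ennreal (p powr (- (real m / 2))) * ((ennreal (t powr k * (1 - t) powr (- k - 1) / sqrt (p - t)) * indicator {0<..<p} t) *
      (\<phi> q * ennreal ((1 - q) powr (real m / 2) / sqrt (q - t)) * indicator {t<..<1} q))" (is "?l = ?r")
      proof -
        have "?l = ennreal (p powr (- (real m / 2))) * \<phi> q * (ennreal ((1 - q) powr (real m / 2)) * ennreal (t powr k * (1 - t) powr (- k - 1) / sqrt ((p - t) * (q - t)))) *
          (indicator {0<..<1} q * indicator {0<..<min p q} t)" by (simp only: mult_ac)
        also have "\<dots> = ennreal (p powr (- (real m / 2))) * \<phi> q * (ennreal (t powr k * (1 - t) powr (- k - 1) / sqrt (p - t)) * ennreal ((1 - q) powr (real m / 2) / sqrt (q - t))) *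
          (indicator {0<..<1} q * indicator {0<..<min p q} t)"
        proof (cases "t < p \<and> t < q")
          case False
          then have "indicator {0<..<min p q} t = (0::ennreal)" by auto
          then show ?thesis by (simp only: mult_zero_right)
        qed (simp only: e simp_thms)
        also have "\<dots> = ?r" unfolding ind by (simp only: mult_ac)
        finally show ?thesis .
      qed
    qed
    finally show "ennreal (p powr (- (real m / 2))) * (\<phi> q * ennreal ((1 - q) powr (real m / 2)) *
       (\<integral>\<^sup>+t\<in>{0<..<min p q}. ennreal (t powr k * (1 - t) powr (- k - 1) / sqrt ((p - t) * (q - t))) \<partial>lborel)) * indicator {0<..<1} q = \<dots>" .
  qed
  also have "\<dots> = (\<integral>\<^sup>+t. \<integral>\<^sup>+q. ennreal (p powr (- (real m / 2))) * ((ennreal (t powr k * (1 - t) powr (- k - 1) / sqrt (p - t)) * indicator {0<..<p} t) *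
      (\<phi> q * ennreal ((1 - q) powr (real m / 2) / sqrt (q - t)) * indicator {t<..<1} q)) \<partial>lborel \<partial>lborel)"
    by (rule lborel_pair.Fubini') measurable
  also have "\<dots> = (\<integral>\<^sup>+t. ennreal (p powr (- (real m / 2))) * (ennreal (t powr k * (1 - t) powr (- k - 1) / sqrt (p - t)) *
       (\<integral>\<^sup>+q\<in>{t<..<1}. \<phi> q * ennreal ((1 - q) powr (real m / 2) / sqrt (q - t)) \<partial>lborel) * indicator {0<..<p} t) \<partial>lborel)"
  proof (rule nn_integral_cong)
    fix t :: real
    have "(\<integral>\<^sup>+q. ennreal (p powr (- (real m / 2))) * ((ennreal (t powr k * (1 - t) powr (- k - 1) / sqrt (p - t)) * indicator {0<..<p} t) *
      (\<phi> q * ennreal ((1 - q) powr (real m / 2) / sqrt (q - t)) * indicator {t<..<1} q)) \<partial>lborel) =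
      ennreal (p powr (- (real m / 2))) * (\<integral>\<^sup>+q. (ennreal (t powr k * (1 - t) powr (- k - 1) / sqrt (p - t)) * indicator {0<..<p} t) *
      (\<phi> q * ennreal ((1 - q) powr (real m / 2) / sqrt (q - t)) * indicator {t<..<1} q) \<partial>lborel)"
      by (rule nn_integral_cmult) measurable
    also have "(\<integral>\<^sup>+q. (ennreal (t powr k * (1 - t) powr (- k - 1) / sqrt (p - t)) * indicator {0<..<p} t) *
      (\<phi> q * ennreal ((1 - q) powr (real m / 2) / sqrt (q - t)) * indicator {t<..<1} q) \<partial>lborel) =
      (ennreal (t powr k * (1 - t) powr (- k - 1) / sqrt (p - t)) * indicator {0<..<p} t) *
       (\<integral>\<^sup>+q\<in>{t<..<1}. \<phi> q * ennreal ((1 - q) powr (real m / 2) / sqrt (q - t)) \<partial>lborel)"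
      by (rule nn_integral_cmult) measurable
    finally show "(\<integral>\<^sup>+q. ennreal (p powr (- (real m / 2))) * ((ennreal (t powr k * (1 - t) powr (- k - 1) / sqrt (p - t)) * indicator {0<..<p} t) *
      (\<phi> q * ennreal ((1 - q) powr (real m / 2) / sqrt (q - t)) * indicator {t<..<1} q)) \<partial>lborel) =
      ennreal (p powr (- (real m / 2))) * (ennreal (t powr k * (1 - t) powr (- k - 1) / sqrt (p - t)) *
       (\<integral>\<^sup>+q\<in>{t<..<1}. \<phi> q * ennreal ((1 - q) powr (real m / 2) / sqrt (q - t)) \<partial>lborel) * indicator {0<..<p} t)"
      by (simp only: mult_ac)
  qed
  also have "\<dots> = ennreal (p powr (- (real m / 2))) * (\<integral>\<^sup>+t\<in>{0<..<p}. ennreal (t powr k * (1 - t) powr (- k - 1) / sqrt (p - t)) *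
       (\<integral>\<^sup>+q\<in>{t<..<1}. \<phi> q * ennreal ((1 - q) powr (real m / 2) / sqrt (q - t)) \<partial>lborel) \<partial>lborel)"
    by (rule nn_integral_cmult) measurable
  also have "ennreal (surface_const (m + 3)) * (ennreal (p powr (- (real m / 2))) * X) = ennreal (surface_const (m + 3) * p powr (- (real m / 2))) * X" for X
    using surface_const_pos[of "m + 3"] by (simp add: ennreal_mult mult.assoc)
  finally show ?thesis unfolding e1 e2 .
qed

section \<open>Abel transform, mass and potential of the equilibrium density\<close>

text \<open>The open interval is where positivity and the Abel representation hold; the South Pole
  and the rim, which it omits, have surface measure 0.\<close>

definition height_weight :: "nat \<Rightarrow> real \<Rightarrow> ennreal" where
  "height_weight d q = ennreal (height_density d q) * indicator {0<..<cap_height d} q"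

lemma abel_slope_measurable [measurable]: "abel_slope d \<in> borel_measurable borel"
  unfolding abel_slope_def[abs_def] by measurable

lemma abel_datum_measurable [measurable]: "abel_datum d \<in> borel_measurable borel"
  unfolding abel_datum_def[abs_def] by measurable

text \<open>The Abel representation, rather than the closed formula, is what later integrals use: it
  gives measurability as a parametrized integral and supplies the inner integral to be
  exchanged.\<close>

lemma height_weight_eq:
  assumes "d \<ge> 3"
  shows "height_weight d q = ennreal ((1 - q) powr (- ((real d - 3) / 2)) / pi) *
      (\<integral>\<^sup>+t. ennreal (abel_slope d t / sqrt (t - q)) * indicator {q<..<cap_height d} t \<partial>lborel) * indicator {0<..<cap_height d} q"
  using nn_integral_abel_inverse[OF assms, of q] by (simp add: height_weight_def indicator_def)

lemma height_weight_measurable [measurable]: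
  assumes "d \<ge> 3"
  shows "height_weight d \<in> borel_measurable borel"
  unfolding height_weight_eq[OF assms, abs_def] by measurable

text \<open>Exchanging q and t leaves the arcsine integral over s < q < t, which is pi whatever t
  is; the slope then integrates back to the datum.\<close>

lemma abel_transform_height_weight:
  assumes d: "d = m + 3" and s: "0 < s" "s < 1"
  shows "(\<integral>\<^sup>+q\<in>{s<..<1}. height_weight d q * ennreal ((1 - q) powr (real m / 2) / sqrt (q - s)) \<partial>lborel) =
    ennreal (abel_datum d s)"
proof -
  have d3: "d \<ge> 3" using d by simp
  note a0 = alpha0_props[OF d3]
  define z where "z = cap_height d"
  have m: "(real d - 3) / 2 = real m / 2" using d by simp
  have "(\<integral>\<^sup>+q\<in>{s<..<1}. height_weight d q * ennreal ((1 - q) powr (real m / 2) / sqrt (q - s)) \<partial>lborel) =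
    (\<integral>\<^sup>+q. \<integral>\<^sup>+t. ennreal (1 / pi) * (ennreal (abel_slope d t) * indicator {s<..<z} t * (ennreal (1 / (sqrt (q - s) * sqrt (t - q))) * indicator {s<..<t} q)) \<partial>lborel \<partial>lborel)"
  proof (rule nn_integral_cong)
    fix q :: real
    let ?c = "ennreal ((1 - q) powr (- (real m / 2)) / pi) * indicator {0<..<z} q * ennreal ((1 - q) powr (real m / 2) / sqrt (q - s)) * indicator {s<..<1} q"
    have "height_weight d q * ennreal ((1 - q) powr (real m / 2) / sqrt (q - s)) * indicator {s<..<1} q =
      ?c * (\<integral>\<^sup>+t. ennreal (abel_slope d t / sqrt (t - q)) * indicator {q<..<z} t \<partial>lborel)"
      unfolding height_weight_eq[OF d3] m z_def by (simp only: mult_ac)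
    also have "\<dots> = (\<integral>\<^sup>+t. ?c * (ennreal (abel_slope d t / sqrt (t - q)) * indicator {q<..<z} t) \<partial>lborel)"
      by (rule nn_integral_cmult[symmetric]) measurable
    also have "\<dots> = (\<integral>\<^sup>+t. ennreal (1 / pi) * (ennreal (abel_slope d t) * indicator {s<..<z} t * (ennreal (1 / (sqrt (q - s) * sqrt (t - q))) * indicator {s<..<t} q)) \<partial>lborel)"
    proof (rule nn_integral_cong)
      fix t :: real
      show "?c * (ennreal (abel_slope d t / sqrt (t - q)) * indicator {q<..<z} t) =
        ennreal (1 / pi) * (ennreal (abel_slope d t) * indicator {s<..<z} t * (ennreal (1 / (sqrt (q - s) * sqrt (t - q))) * indicator {s<..<t} q))"
      proof (cases "s < q \<and> q < t \<and> t < z")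
        case True
        then have i: "indicator {0<..<z} q = (1::ennreal)" "indicator {s<..<1} q = (1::ennreal)" "indicator {q<..<z} t = (1::ennreal)"
          "indicator {s<..<z} t = (1::ennreal)" "indicator {s<..<t} q = (1::ennreal)"
          using s a0 by (auto simp: z_def)
        have g: "abel_slope d t > 0" using True s by (intro abel_slope_pos[OF d3]) (auto simp: z_def)
        have "q < 1" using True a0 by (simp add: z_def)
        then have "(1 - q) powr (- (real m / 2)) * (1 - q) powr (real m / 2) = 1"
          unfolding powr_add[symmetric] by simp
        then have "(1 - q) powr (- (real m / 2)) / pi * ((1 - q) powr (real m / 2) / sqrt (q - s)) * (abel_slope d t / sqrt (t - q)) =
          1 / pi * (abel_slope d t * (1 / (sqrt (q - s) * sqrt (t - q))))"
          by (simp add: field_simps)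
        then have "ennreal ((1 - q) powr (- (real m / 2)) / pi * ((1 - q) powr (real m / 2) / sqrt (q - s)) * (abel_slope d t / sqrt (t - q))) =
          ennreal (1 / pi * (abel_slope d t * (1 / (sqrt (q - s) * sqrt (t - q)))))" by (simp only:)
        moreover have "0 \<le> (1 - q) powr (- (real m / 2)) / pi" "0 \<le> (1 - q) powr (real m / 2) / sqrt (q - s)"
          "0 \<le> abel_slope d t / sqrt (t - q)" "0 \<le> 1 / (sqrt (q - s) * sqrt (t - q))" "0 \<le> 1 / pi" "0 \<le> abel_slope d t"
          using True g by (auto intro!: divide_nonneg_nonneg)
        ultimately show ?thesis unfolding i mult_1_right by (simp only: ennreal_mult mult_nonneg_nonneg)
      next
        case False
        then have "indicator {s<..<1} q * indicator {q<..<z} t = (0::ennreal)"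
          "indicator {s<..<z} t * indicator {s<..<t} q = (0::ennreal)" by (auto simp: indicator_def)
        then have "x * indicator {s<..<1} q * (y * indicator {q<..<z} t) = 0"
          "x * (y * indicator {s<..<z} t * (w * indicator {s<..<t} q)) = 0" for x y w :: ennreal
          by (auto simp: mult_ac)
        then show ?thesis by (simp only:)
      qed
    qed
    finally show "height_weight d q * ennreal ((1 - q) powr (real m / 2) / sqrt (q - s)) * indicator {s<..<1} q = \<dots>" .
  qed
  also have "\<dots> = (\<integral>\<^sup>+t. \<integral>\<^sup>+q. ennreal (1 / pi) * (ennreal (abel_slope d t) * indicator {s<..<z} t * (ennreal (1 / (sqrt (q - s) * sqrt (t - q))) * indicator {s<..<t} q)) \<partial>lborel \<partial>lborel)"
    by (rule lborel_pair.Fubini') measurable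
  also have "\<dots> = (\<integral>\<^sup>+t. ennreal (abel_slope d t) * indicator {s<..<z} t \<partial>lborel)"
  proof (rule nn_integral_cong)
    fix t :: real
    have "(\<integral>\<^sup>+q. ennreal (1 / pi) * (ennreal (abel_slope d t) * indicator {s<..<z} t * (ennreal (1 / (sqrt (q - s) * sqrt (t - q))) * indicator {s<..<t} q)) \<partial>lborel) =
      (\<integral>\<^sup>+q. (ennreal (1 / pi) * (ennreal (abel_slope d t) * indicator {s<..<z} t)) * (ennreal (1 / (sqrt (q - s) * sqrt (t - q))) * indicator {s<..<t} q) \<partial>lborel)"
      by (simp only: mult.assoc)
    also have "\<dots> = (ennreal (1 / pi) * (ennreal (abel_slope d t) * indicator {s<..<z} t)) * (\<integral>\<^sup>+q\<in>{s<..<t}. ennreal (1 / (sqrt (q - s) * sqrt (t - q))) \<partial>lborel)"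
      by (rule nn_integral_cmult) measurable
    also have "\<dots> = ennreal (abel_slope d t) * indicator {s<..<z} t"
    proof (cases "t \<in> {s<..<z}")
      case True
      have "ennreal (1 / pi) * x * ennreal pi = x" for x
      proof -
        have "ennreal (1 / pi) * ennreal pi = 1" by (subst ennreal_mult[symmetric]) auto
        then show ?thesis by (metis mult.commute mult.left_commute mult_1_right)
      qed
      then show ?thesis using True nn_integral_arcsine[of s t] by simp
    next
      case False
      then have "indicator {s<..<z} t = (0::ennreal)" by simp
      then show ?thesis by (simp only: mult_zero_right mult_zero_left)
    qed
    finally show "(\<integral>\<^sup>+q. ennreal (1 / pi) * (ennreal (abel_slope d t) * indicator {s<..<z} t * (ennreal (1 / (sqrt (q - s) * sqrt (t - q))) * indicator {s<..<t} q)) \<partial>lborel) = \<dots>" .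
  qed
  also have "\<dots> = ennreal (abel_datum d s)"
  proof (cases "s < z")
    case True
    then show ?thesis using nn_integral_abel_slope[OF d3 s(1)] by (simp add: z_def)
  next
    case False
    \<comment> \<open>Above the cap the interval s < t < z is empty and the datum is nonpositive,
      hence 0 in \<open>ennreal\<close>.\<close>
    then have "z\<^sup>2 \<le> s\<^sup>2" using a0 by (intro power_mono) (auto simp: z_def)
    then have "abel_datum d s \<le> 0"
      unfolding abel_datum_def z_def[symmetric] using density_const_pos[OF d3] by (intro mult_nonneg_nonpos) auto
    moreover have "indicator {s<..<z} t = (0::ennreal)" for t using False by simp
    ultimately show ?thesis by (simp add: ennreal_neg)
  qed
  finally show ?thesis .
qed

text \<open>The duplication formula in Beta form. It identifies the integral of (1 - v^2) powr k
  over (-1, 1) with Beta (k + 1) (1/2).\<close>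

lemma Beta_half_duplication:
  assumes "x > (0::real)"
  shows "2 powr (2 * x - 1) * Beta x x = Beta x (1/2)"
proof -
  have G: "Gamma (2 * x) > 0" "Gamma (x + 1/2) > 0" "Gamma x > 0" using assms by (auto intro!: Gamma_real_pos)
  have "2 powr (2 * x - 1) * (Gamma x * Gamma (x + 1/2)) = sqrt pi * Gamma (2 * x) * (2 powr (2 * x - 1) * 2 powr (1 - 2 * x))"
    unfolding Gamma_duplication_real[OF assms] by simp
  also have "2 powr (2 * x - 1) * 2 powr (1 - 2 * x) = (1::real)" unfolding powr_add[symmetric] by simp
  finally have "2 powr (2 * x - 1) * (Gamma x * Gamma (x + 1/2)) = sqrt pi * Gamma (2 * x)" by simp
  then have "2 powr (2 * x - 1) * Gamma x / Gamma (2 * x) = sqrt pi / Gamma (x + 1/2)"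
    using G by (simp add: field_simps)
  then have "(2 powr (2 * x - 1) * Gamma x / Gamma (2 * x)) * Gamma x = (sqrt pi / Gamma (x + 1/2)) * Gamma x" by (simp only:)
  moreover have "x + x = 2 * x" by simp
  ultimately show ?thesis unfolding Beta_def Gamma_one_half_real by (simp add: mult_ac)
qed

text \<open>The zonal factor q powr (m / 2) times Beta (k + 1) (1/2), the value of the integral over
  v, is itself the Abel integral of t powr k over 0 < t < q. Writing it so and exchanging q and t
  makes the known transform \<open>abel_datum\<close> appear, and \<open>angle_function\<close> at
  \<open>cap_height\<close> remains.\<close>

lemma nn_integral_height_weight_mass:
  fixes e :: "'a::euclidean_space"
  assumes e: "e \<in> Basis" and D: "DIM('a) = d" and d: "d = m + 3"
  shows "(\<integral>\<^sup>+y. height_weight d ((1 + y \<bullet> e) / 2) \<partial>(sphere_measure :: 'a measure)) = 1"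
proof -
  have d3: "d \<ge> 3" using d by simp
  note [measurable] = height_weight_measurable[OF d3]
  note a0 = alpha0_props[OF d3]
  define k where "k = (real m - 1) / 2"
  have "k + 1 = (real m + 1) / 2" by (simp add: k_def field_simps)
  then have k: "k + 1 > 0" by simp
  have "card (Basis - {e}) \<noteq> 0" using e D d by simp
  then obtain w where w: "w \<in> Basis" "e \<noteq> w"
    by (metis Diff_iff card.empty ex_in_conv insertI1)
  then have ew: "norm w = 1" "e \<bullet> w = 0" using e by (auto simp: inner_Basis)
  have D': "DIM('a) = m + 3" using D d by simp
  let ?\<phi> = "height_weight d"
  define \<beta> where "\<beta> = Beta (k + 1) (1/2)"
  have \<beta>: "\<beta> > 0" unfolding \<beta>_def Beta_def using k by (intro divide_pos_pos mult_pos_pos Gamma_real_pos) auto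
  have Iv: "(\<integral>\<^sup>+v\<in>{-1<..<1}. ennreal ((1 - v\<^sup>2) powr k) \<partial>lborel) = ennreal \<beta>"
  proof -
    have "(\<integral>\<^sup>+v\<in>{-1<..<1}. ennreal ((1 - v\<^sup>2) powr k) \<partial>lborel) =
      (\<integral>\<^sup>+v\<in>{-1<..<1}. ennreal ((v - -1) powr (k + 1 - 1) * (1 - v) powr (k + 1 - 1)) \<partial>lborel)"
    proof (rule nn_integral_cong)
      fix v :: real
      have "(1 - v\<^sup>2) powr k = (v - -1) powr (k + 1 - 1) * (1 - v) powr (k + 1 - 1)" if "v \<in> {-1<..<1}"
      proof -
        have "1 - v\<^sup>2 = (v - -1) * (1 - v)" by (simp add: power2_eq_square algebra_simps)
        then show ?thesis using that by (simp add: powr_mult)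
      qed
      then show "ennreal ((1 - v\<^sup>2) powr k) * indicator {-1<..<1} v =
        ennreal ((v - -1) powr (k + 1 - 1) * (1 - v) powr (k + 1 - 1)) * indicator {-1<..<1} v"
        by (cases "v \<in> {-1<..<1}") (simp_all only: indicator_simps mult_zero_right simp_thms)
    qed
    also have "\<dots> = ennreal ((1 - -1) powr (k + 1 + (k + 1) - 1) * Beta (k + 1) (k + 1))"
      by (rule nn_integral_Beta_interval[OF k k]) simp
    also have "(1 - -1 :: real) powr (k + 1 + (k + 1) - 1) * Beta (k + 1) (k + 1) = \<beta>"
    proof -
      have "(1 - -1 :: real) = 2" "k + 1 + (k + 1) - 1 = 2 * (k + 1) - 1" by simp_all
      then show ?thesis unfolding \<beta>_def Beta_half_duplication[OF k, symmetric] by (simp only:)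
    qed
    finally show ?thesis .
  qed
  have "(\<integral>\<^sup>+y. ?\<phi> ((1 + y \<bullet> e) / 2) \<partial>(sphere_measure :: 'a measure)) = ennreal (surface_const (m + 3)) *
     (\<integral>\<^sup>+q\<in>{0<..<1}. ennreal (2 * (4 * (q * (1 - q))) powr (real m / 2)) *
       (\<integral>\<^sup>+v\<in>{-1<..<1}. ennreal ((1 - v\<^sup>2) powr ((real m - 1) / 2)) * ?\<phi> ((1 + (2 * q - 1)) / 2) \<partial>lborel) \<partial>lborel)"
    by (rule nn_integral_sphere_height[OF e ew D', where G="\<lambda>u s. ?\<phi> ((1 + u) / 2)"]) measurable
  also have "(\<integral>\<^sup>+q\<in>{0<..<1}. ennreal (2 * (4 * (q * (1 - q))) powr (real m / 2)) *
       (\<integral>\<^sup>+v\<in>{-1<..<1}. ennreal ((1 - v\<^sup>2) powr ((real m - 1) / 2)) * ?\<phi> ((1 + (2 * q - 1)) / 2) \<partial>lborel) \<partial>lborel) =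
    (\<integral>\<^sup>+q. \<integral>\<^sup>+t. ennreal (2 ^ (m + 1)) * (ennreal (t powr k) * indicator {0<..<1} t * (?\<phi> q * ennreal ((1 - q) powr (real m / 2) / sqrt (q - t)) * indicator {t<..<1} q)) \<partial>lborel \<partial>lborel)"
  proof (rule nn_integral_cong)
    fix q :: real
    have "(\<integral>\<^sup>+v\<in>{-1<..<1}. ennreal ((1 - v\<^sup>2) powr ((real m - 1) / 2)) * ?\<phi> ((1 + (2 * q - 1)) / 2) \<partial>lborel) =
      (\<integral>\<^sup>+v. ?\<phi> q * (ennreal ((1 - v\<^sup>2) powr k) * indicator {-1<..<1} v) \<partial>lborel)"
      by (simp add: k_def mult_ac)
    also have "\<dots> = ?\<phi> q * ennreal \<beta>" by (subst nn_integral_cmult) (simp_all only: Iv, measurable)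
    finally have v: "(\<integral>\<^sup>+v\<in>{-1<..<1}. ennreal ((1 - v\<^sup>2) powr ((real m - 1) / 2)) * ?\<phi> ((1 + (2 * q - 1)) / 2) \<partial>lborel) = ?\<phi> q * ennreal \<beta>" .
    show "ennreal (2 * (4 * (q * (1 - q))) powr (real m / 2)) *
       (\<integral>\<^sup>+v\<in>{-1<..<1}. ennreal ((1 - v\<^sup>2) powr ((real m - 1) / 2)) * ?\<phi> ((1 + (2 * q - 1)) / 2) \<partial>lborel) * indicator {0<..<1} q =
      (\<integral>\<^sup>+t. ennreal (2 ^ (m + 1)) * (ennreal (t powr k) * indicator {0<..<1} t * (?\<phi> q * ennreal ((1 - q) powr (real m / 2) / sqrt (q - t)) * indicator {t<..<1} q)) \<partial>lborel)"
    proof (cases "q \<in> {0<..<1}")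
      case False
      then have "indicator {0<..<1} t * indicator {t<..<1} q = (0::ennreal)" for t by (auto simp: indicator_def)
      then have "x * (y * indicator {0<..<1} t * (w * indicator {t<..<1} q)) = 0" for x y w :: ennreal and t
        by (auto simp: mult_ac)
      moreover have "indicator {0<..<1} q = (0::ennreal)" using False by simp
      ultimately show ?thesis by (simp only: mult_zero_right nn_integral_0_iff_AE nn_integral_const mult_zero_left)
    next
      case q: True
      let ?c = "ennreal (2 ^ (m + 1)) * ?\<phi> q * ennreal ((1 - q) powr (real m / 2))"
      have "(\<integral>\<^sup>+t. ennreal (2 ^ (m + 1)) * (ennreal (t powr k) * indicator {0<..<1} t * (?\<phi> q * ennreal ((1 - q) powr (real m / 2) / sqrt (q - t)) * indicator {t<..<1} q)) \<partial>lborel) =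
        (\<integral>\<^sup>+t. ?c * (ennreal ((t - 0) powr (k + 1 - 1) * (q - t) powr (1/2 - 1)) * indicator {0<..<q} t) \<partial>lborel)"
      proof (rule nn_integral_cong)
        fix t :: real
        have ind: "indicator {0<..<1} t * indicator {t<..<1} q = (indicator {0<..<q} t :: ennreal)"
          using q by (auto simp: indicator_def)
        have "(1 - q) powr (real m / 2) / sqrt (q - t) = (1 - q) powr (real m / 2) * (q - t) powr (1/2 - 1)" if "t < q"
        proof -
          have "(q - t) powr (- (1/2)) = 1 / sqrt (q - t)" using that by (simp only: powr_minus_divide) (simp add: powr_half_sqrt)
          then show ?thesis by simp
        qed
        then have e2: "ennreal (t powr k) * ennreal ((1 - q) powr (real m / 2) / sqrt (q - t)) =
          ennreal ((1 - q) powr (real m / 2)) * ennreal ((t - 0) powr (k + 1 - 1) * (q - t) powr (1/2 - 1))" if "t < q"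
          using that by (simp add: ennreal_mult mult_ac)
        have "ennreal (2 ^ (m + 1)) * (ennreal (t powr k) * indicator {0<..<1} t * (?\<phi> q * ennreal ((1 - q) powr (real m / 2) / sqrt (q - t)) * indicator {t<..<1} q)) =
          ennreal (2 ^ (m + 1)) * ?\<phi> q * (ennreal (t powr k) * ennreal ((1 - q) powr (real m / 2) / sqrt (q - t))) * (indicator {0<..<1} t * indicator {t<..<1} q)"
          by (simp only: mult_ac)
        also have "\<dots> = ennreal (2 ^ (m + 1)) * ?\<phi> q * (ennreal ((1 - q) powr (real m / 2)) * ennreal ((t - 0) powr (k + 1 - 1) * (q - t) powr (1/2 - 1))) * indicator {0<..<q} t"
        proof (cases "t < q")
          case True show ?thesis unfolding ind e2[OF True] ..
        next
          case False
          then have "indicator {0<..<q} t = (0::ennreal)" by simp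
          then show ?thesis unfolding ind by (simp only: mult_zero_right)
        qed
        finally show "ennreal (2 ^ (m + 1)) * (ennreal (t powr k) * indicator {0<..<1} t * (?\<phi> q * ennreal ((1 - q) powr (real m / 2) / sqrt (q - t)) * indicator {t<..<1} q)) =
          ?c * (ennreal ((t - 0) powr (k + 1 - 1) * (q - t) powr (1/2 - 1)) * indicator {0<..<q} t)"
          by (simp only: mult.assoc)
      qed
      also have "\<dots> = ?c * (\<integral>\<^sup>+t\<in>{0<..<q}. ennreal ((t - 0) powr (k + 1 - 1) * (q - t) powr (1/2 - 1)) \<partial>lborel)"
        by (rule nn_integral_cmult) measurable
      also have "(\<integral>\<^sup>+t\<in>{0<..<q}. ennreal ((t - 0) powr (k + 1 - 1) * (q - t) powr (1/2 - 1)) \<partial>lborel) = ennreal ((q - 0) powr (k + 1 + 1/2 - 1) * Beta (k + 1) (1/2))"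
        by (rule nn_integral_Beta_interval) (use k q in auto)
      also have "(q - 0) powr (k + 1 + 1/2 - 1) = q powr (real m / 2)"
        by (simp add: k_def) (rule arg_cong[where f="(powr) q"], simp add: field_simps)
      also have "?c * ennreal (q powr (real m / 2) * Beta (k + 1) (1/2)) =
        ennreal (2 * (4 * (q * (1 - q))) powr (real m / 2)) * (?\<phi> q * ennreal \<beta>)"
      proof -
        have "(4::real) powr (real m / 2) = 2 powr (2 * (real m / 2))"
          using powr_powr[of 2 2 "real m / 2"] by simp
        also have "\<dots> = 2 ^ m" by (simp add: powr_realpow)
        finally have "2 * (4 * (q * (1 - q))) powr (real m / 2) = 2 ^ (m + 1) * (q powr (real m / 2) * (1 - q) powr (real m / 2))"
          using q by (simp add: powr_mult)
        then have "ennreal (2 * (4 * (q * (1 - q))) powr (real m / 2)) = ennreal (2 ^ (m + 1)) * (ennreal (q powr (real m / 2)) * ennreal ((1 - q) powr (real m / 2)))"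
          by (simp add: ennreal_mult mult.assoc)
        moreover have "ennreal (q powr (real m / 2) * Beta (k + 1) (1/2)) = ennreal (q powr (real m / 2)) * ennreal \<beta>"
          unfolding \<beta>_def[symmetric] using \<beta> by (simp add: ennreal_mult)
        ultimately show ?thesis by (simp only: mult_ac)
      qed
      finally show ?thesis unfolding v using q by simp
    qed
  qed
  also have "\<dots> = (\<integral>\<^sup>+t. \<integral>\<^sup>+q. ennreal (2 ^ (m + 1)) * (ennreal (t powr k) * indicator {0<..<1} t * (?\<phi> q * ennreal ((1 - q) powr (real m / 2) / sqrt (q - t)) * indicator {t<..<1} q)) \<partial>lborel \<partial>lborel)"
    by (rule lborel_pair.Fubini') measurable
  also have "\<dots> = (\<integral>\<^sup>+t. ennreal (2 ^ (m + 1) * (pi * density_const d)) * (ennreal (((cap_height d)\<^sup>2 - t\<^sup>2) * (t powr (d / 2 - 2) * (1 - t) powr (d / 2 - 1))) * indicator {0<..<cap_height d} t) \<partial>lborel)"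
  proof (rule nn_integral_cong)
    fix t :: real
    have "(\<integral>\<^sup>+q. ennreal (2 ^ (m + 1)) * (ennreal (t powr k) * indicator {0<..<1} t * (?\<phi> q * ennreal ((1 - q) powr (real m / 2) / sqrt (q - t)) * indicator {t<..<1} q)) \<partial>lborel) =
      ennreal (2 ^ (m + 1)) * (\<integral>\<^sup>+q. (ennreal (t powr k) * indicator {0<..<1} t * (?\<phi> q * ennreal ((1 - q) powr (real m / 2) / sqrt (q - t)) * indicator {t<..<1} q)) \<partial>lborel)"
      by (rule nn_integral_cmult) measurable
    also have "(\<integral>\<^sup>+q. (ennreal (t powr k) * indicator {0<..<1} t * (?\<phi> q * ennreal ((1 - q) powr (real m / 2) / sqrt (q - t)) * indicator {t<..<1} q)) \<partial>lborel) =
      ennreal (t powr k) * indicator {0<..<1} t * (\<integral>\<^sup>+q\<in>{t<..<1}. ?\<phi> q * ennreal ((1 - q) powr (real m / 2) / sqrt (q - t)) \<partial>lborel)"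
      by (rule nn_integral_cmult) measurable
    finally have 1: "(\<integral>\<^sup>+q. ennreal (2 ^ (m + 1)) * (ennreal (t powr k) * indicator {0<..<1} t * (?\<phi> q * ennreal ((1 - q) powr (real m / 2) / sqrt (q - t)) * indicator {t<..<1} q)) \<partial>lborel) =
      ennreal (2 ^ (m + 1)) * (ennreal (t powr k) * indicator {0<..<1} t * (\<integral>\<^sup>+q\<in>{t<..<1}. ?\<phi> q * ennreal ((1 - q) powr (real m / 2) / sqrt (q - t)) \<partial>lborel))" .
    show "(\<integral>\<^sup>+q. ennreal (2 ^ (m + 1)) * (ennreal (t powr k) * indicator {0<..<1} t * (?\<phi> q * ennreal ((1 - q) powr (real m / 2) / sqrt (q - t)) * indicator {t<..<1} q)) \<partial>lborel) =
      ennreal (2 ^ (m + 1) * (pi * density_const d)) * (ennreal (((cap_height d)\<^sup>2 - t\<^sup>2) * (t powr (d / 2 - 2) * (1 - t) powr (d / 2 - 1))) * indicator {0<..<cap_height d} t)"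
    proof (cases "t \<in> {0<..<1}")
      case False
      then have "indicator {0<..<cap_height d} t = (0::ennreal)" "indicator {0<..<1} t = (0::ennreal)" using a0 by auto
      then show ?thesis unfolding 1 by (simp only: mult_zero_right mult_zero_left)
    next
      case t: True
      then have i: "indicator {0<..<1} t = (1::ennreal)" by simp
      have S: "(\<integral>\<^sup>+q\<in>{t<..<1}. ?\<phi> q * ennreal ((1 - q) powr (real m / 2) / sqrt (q - t)) \<partial>lborel) = ennreal (abel_datum d t)"
        by (rule abel_transform_height_weight[OF d]) (use t in auto)
      show ?thesis
      proof (cases "t < cap_height d")
        case True
        have kd: "k = d / 2 - 2" using d by (simp add: k_def field_simps)
        have "t\<^sup>2 \<le> (cap_height d)\<^sup>2" using True t by (intro power_mono) auto
        then have nn: "0 \<le> abel_datum d t" "0 \<le> ((cap_height d)\<^sup>2 - t\<^sup>2) * (t powr (d / 2 - 2) * (1 - t) powr (d / 2 - 1))"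
          unfolding abel_datum_def using density_const_pos[OF d3] by (auto intro!: mult_nonneg_nonneg)
        have "2 ^ (m + 1) * (t powr k * abel_datum d t) = 2 ^ (m + 1) * (pi * density_const d) * (((cap_height d)\<^sup>2 - t\<^sup>2) * (t powr (d / 2 - 2) * (1 - t) powr (d / 2 - 1)))"
          unfolding abel_datum_def kd by (simp add: mult_ac)
        then have "ennreal (2 ^ (m + 1) * (t powr k * abel_datum d t)) = ennreal (2 ^ (m + 1) * (pi * density_const d) * (((cap_height d)\<^sup>2 - t\<^sup>2) * (t powr (d / 2 - 2) * (1 - t) powr (d / 2 - 1))))"
          by (simp only:)
        then have "ennreal (2 ^ (m + 1)) * (ennreal (t powr k) * ennreal (abel_datum d t)) =
          ennreal (2 ^ (m + 1) * (pi * density_const d)) * ennreal (((cap_height d)\<^sup>2 - t\<^sup>2) * (t powr (d / 2 - 2) * (1 - t) powr (d / 2 - 1)))"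
          using nn density_const_pos[OF d3] by (simp add: ennreal_mult'' del: ennreal_mult)
        moreover have "indicator {0<..<cap_height d} t = (1::ennreal)" using True t by simp
        ultimately show ?thesis unfolding 1 unfolding S i by (simp only: mult_1_right)
      next
        case False
        then have "(cap_height d)\<^sup>2 \<le> t\<^sup>2" using a0 by (intro power_mono) auto
        then have "abel_datum d t \<le> 0"
          unfolding abel_datum_def using density_const_pos[OF d3] by (intro mult_nonneg_nonpos) auto
        then show ?thesis unfolding 1 S using False by (simp add: ennreal_neg)
      qed
    qed
  qed
  also have "\<dots> = ennreal (2 ^ (m + 1) * (pi * density_const d)) * (\<integral>\<^sup>+t\<in>{0<..<cap_height d}. ennreal (((cap_height d)\<^sup>2 - t\<^sup>2) * (t powr (d / 2 - 2) * (1 - t) powr (d / 2 - 1))) \<partial>lborel)"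
    by (rule nn_integral_cmult) measurable
  also have "(\<integral>\<^sup>+t\<in>{0<..<cap_height d}. ennreal (((cap_height d)\<^sup>2 - t\<^sup>2) * (t powr (d / 2 - 2) * (1 - t) powr (d / 2 - 1))) \<partial>lborel) = ennreal (angle_function d (cap_height d))"
    unfolding angle_function_def
  proof (rule nn_integral_Ioo_has_integral[OF has_integral_angle_function])
    fix t assume "0 < t" "t < cap_height d"
    then show "0 \<le> ((cap_height d)\<^sup>2 - t\<^sup>2) * (t powr (d / 2 - 2) * (1 - t) powr (d / 2 - 1))"
      using power_mono[of t "cap_height d" 2] by (intro mult_nonneg_nonneg) auto
  qed (use a0 d3 in auto)
  also have "ennreal (surface_const (m + 3)) * (ennreal (2 ^ (m + 1) * (pi * density_const d)) * ennreal (angle_function d (cap_height d))) = 1"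
  proof -
    define \<beta>' where "\<beta>' = Beta (d / 2 + 1) (1/2)"
    have b': "\<beta>' > 0" unfolding \<beta>'_def Beta_def using d3 by (intro divide_pos_pos mult_pos_pos Gamma_real_pos) auto
    \<comment> \<open>2 ^ (m + 1) from the zonal measure against 2 ^ d in the angle equation leaves
      1/4, which meets the 4 of \<open>surface_density_const\<close>.\<close>
    have p2: "(2::real) ^ d = 2 ^ (m + 1) * 4" by (simp add: d power_add)
    have "surface_const d * (2 ^ (m + 1) * (pi * density_const d) * angle_function d (cap_height d)) =
      (surface_const d * (pi * density_const d) * \<beta>') / 4"
      unfolding a0(6) \<beta>'_def[symmetric] p2 by simp
    also have "\<dots> = 1" using surface_density_const[OF d3] by (simp add: \<beta>'_def)
    finally have "ennreal (surface_const d * (2 ^ (m + 1) * (pi * density_const d) * angle_function d (cap_height d))) = 1"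
      by simp
    moreover have "angle_function d (cap_height d) \<ge> 0" unfolding a0(6) \<beta>'_def[symmetric] using b' by simp
    ultimately show ?thesis
      using surface_const_pos[OF d3] density_const_pos[OF d3] unfolding d[symmetric]
      by (simp only: ennreal_mult mult_nonneg_nonneg less_imp_le pi_gt_zero zero_le_power zero_le_numeral)
  qed
  finally show ?thesis .
qed

text \<open>Adding the field makes both sides nonnegative, so that the variational inequality can be
  stated and proved in \<open>ennreal\<close>.\<close>

lemma potential_plus_field:
  fixes e x :: "'a::euclidean_space"
  assumes e: "e \<in> Basis" and D: "DIM('a) = d" and d: "d = m + 3"
    and x: "norm x = 1" "x \<bullet> e = 2 * p - 1" and p: "0 < p" "p < 1"
  defines "F \<equiv> surface_const d * (pi * density_const d) * (cap_height d)\<^sup>2 * Beta (d / 2 - 1) (1/2)"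
    and "U \<equiv> \<integral>\<^sup>+y. height_weight d ((1 + y \<bullet> e) / 2) * inverse (ennreal (norm (x - y) ^ (DIM('a) - 2))) \<partial>sphere_measure"
  shows "ennreal F \<le> U + ennreal (4 * p\<^sup>2)"
    and "p \<le> cap_height d \<Longrightarrow> U + ennreal (4 * p\<^sup>2) = ennreal F"
proof -
  have d3: "d \<ge> 3" using d by simp
  note [measurable] = height_weight_measurable[OF d3]
  note a0 = alpha0_props[OF d3]
  define z where "z = cap_height d"
  define k where "k = real d / 2 - 2"
  have D': "DIM('a) = m + 3" using D d by simp
  have km: "(real m - 1) / 2 = k" "(real m + 1) / 2 = real d / 2 - 1" "real m / 2 = k + 1/2"
    using d by (simp_all add: k_def field_simps)
  have k: "k + 1 > 0" using d3 by (simp add: k_def)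
  define C where "C = surface_const d * (pi * density_const d) * p powr (- (k + 1/2))"
  have C: "C > 0" unfolding C_def using surface_const_pos[OF d3] density_const_pos[OF d3] p by simp
  let ?f = "\<lambda>t. t powr k * (p - t) powr (1/2 - 1)"
  \<comment> \<open>\<open>ennreal\<close> takes the positive part of z^2 - t^2; the powers of 1 - t
    from the kernel and from the datum have cancelled.\<close>
  define X where "X = (\<integral>\<^sup>+t. ennreal (?f t) * ennreal (z\<^sup>2 - t\<^sup>2) * indicator {0<..<p} t \<partial>lborel)"
  have U: "U = ennreal C * X"
  proof -
    have "U = ennreal (surface_const (m + 3) * p powr (- (real m / 2))) *
     (\<integral>\<^sup>+t\<in>{0<..<p}. ennreal (t powr ((real m - 1) / 2) * (1 - t) powr (- ((real m + 1) / 2)) / sqrt (p - t)) *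
       (\<integral>\<^sup>+q\<in>{t<..<1}. height_weight d q * ennreal ((1 - q) powr (real m / 2) / sqrt (q - t)) \<partial>lborel) \<partial>lborel)"
      unfolding U_def by (rule zonal_potential[OF e x p D']) measurable
    also have "(\<integral>\<^sup>+t\<in>{0<..<p}. ennreal (t powr ((real m - 1) / 2) * (1 - t) powr (- ((real m + 1) / 2)) / sqrt (p - t)) *
       (\<integral>\<^sup>+q\<in>{t<..<1}. height_weight d q * ennreal ((1 - q) powr (real m / 2) / sqrt (q - t)) \<partial>lborel) \<partial>lborel) =
      (\<integral>\<^sup>+t. ennreal (pi * density_const d) * (ennreal (?f t) * ennreal (z\<^sup>2 - t\<^sup>2) * indicator {0<..<p} t) \<partial>lborel)"
    proof (rule nn_integral_cong)
      fix t :: real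
      show "ennreal (t powr ((real m - 1) / 2) * (1 - t) powr (- ((real m + 1) / 2)) / sqrt (p - t)) *
       (\<integral>\<^sup>+q\<in>{t<..<1}. height_weight d q * ennreal ((1 - q) powr (real m / 2) / sqrt (q - t)) \<partial>lborel) * indicator {0<..<p} t =
       ennreal (pi * density_const d) * (ennreal (?f t) * ennreal (z\<^sup>2 - t\<^sup>2) * indicator {0<..<p} t)"
      proof (cases "t \<in> {0<..<p}")
        case t: True
        then have t1: "0 < t" "t < 1" "t < p" using p by auto
        have S: "(\<integral>\<^sup>+q\<in>{t<..<1}. height_weight d q * ennreal ((1 - q) powr (real m / 2) / sqrt (q - t)) \<partial>lborel) = ennreal (abel_datum d t)"
          by (rule abel_transform_height_weight[OF d t1(1,2)])
        have r: "1 / sqrt (p - t) = (p - t) powr (1/2 - 1)"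
        proof -
          have "(p - t) powr (- (1/2)) = 1 / sqrt (p - t)" using t1 by (simp only: powr_minus_divide) (simp add: powr_half_sqrt)
          then show ?thesis by simp
        qed
        have o: "(1 - t) powr (- (real d / 2 - 1)) * (1 - t) powr (real d / 2 - 1) = 1"
          unfolding powr_add[symmetric] using t1 by simp
        let ?A = "t powr k * (1 - t) powr (- (real d / 2 - 1)) * (1 / sqrt (p - t))"
        have "?A * abel_datum d t = pi * density_const d * ?f t * (z\<^sup>2 - t\<^sup>2) * ((1 - t) powr (- (real d / 2 - 1)) * (1 - t) powr (real d / 2 - 1))"
          unfolding abel_datum_def r z_def[symmetric] by (simp only: mult_ac)
        then have "ennreal (?A * abel_datum d t) = ennreal (pi * density_const d * ?f t * (z\<^sup>2 - t\<^sup>2))"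
          unfolding o by (simp only: mult_1_right)
        moreover have "ennreal (?A * abel_datum d t) = ennreal ?A * ennreal (abel_datum d t)"
          by (rule ennreal_mult') (use t1 in simp)
        moreover have "ennreal (pi * density_const d * ?f t * (z\<^sup>2 - t\<^sup>2)) = ennreal (pi * density_const d * ?f t) * ennreal (z\<^sup>2 - t\<^sup>2)"
          by (rule ennreal_mult') (use density_const_pos[OF d3] in simp)
        moreover have "ennreal (pi * density_const d * ?f t) = ennreal (pi * density_const d) * ennreal (?f t)"
          by (rule ennreal_mult') (use density_const_pos[OF d3] in simp)
        ultimately have "ennreal ?A * ennreal (abel_datum d t) = ennreal (pi * density_const d) * (ennreal (?f t) * ennreal (z\<^sup>2 - t\<^sup>2))"
          by (simp only: mult.assoc)
        moreover have "t powr k * (1 - t) powr (- (real d / 2 - 1)) / sqrt (p - t) = ?A" by simp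
        moreover have "indicator {0<..<p} t = (1::ennreal)" using t by simp
        ultimately show ?thesis unfolding S unfolding km by (simp only: mult_1_right)
      next
        case False
        then have "indicator {0<..<p} t = (0::ennreal)" by simp
        then show ?thesis by (simp only: mult_zero_right)
      qed
    qed
    also have "\<dots> = ennreal (pi * density_const d) * X"
      unfolding X_def by (rule nn_integral_cmult) measurable
    also have "ennreal (surface_const (m + 3) * p powr (- (real m / 2))) * (ennreal (pi * density_const d) * X) = ennreal C * X"
      unfolding C_def km d[symmetric] using surface_const_pos[OF d3] density_const_pos[OF d3]
      by (simp add: ennreal_mult[symmetric] mult.assoc[symmetric]) (simp add: mult_ac)
    finally show ?thesis .
  qed
  \<comment> \<open>The Abel integrals of t powr k and of t powr (k + 2). Multiplied by
    \<open>C\<close>, the first becomes independent of p and the second becomes 4 * p^2.\<close>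
  define b1 b2 where "b1 = p powr (k + 1/2) * Beta (k + 1) (1/2)" and "b2 = p powr (k + 1/2 + 2) * Beta (k + 3) (1/2)"
  have b1: "(\<integral>\<^sup>+t. ennreal (?f t) * indicator {0<..<p} t \<partial>lborel) = ennreal b1"
  proof -
    have "(\<integral>\<^sup>+t\<in>{0<..<p}. ennreal ((t - 0) powr (k + 1 - 1) * (p - t) powr (1/2 - 1)) \<partial>lborel) = ennreal ((p - 0) powr (k + 1 + 1/2 - 1) * Beta (k + 1) (1/2))"
      by (rule nn_integral_Beta_interval) (use k p in auto)
    moreover have "k + 1 + 1/2 - 1 = k + 1/2" "k + 1 - 1 = k" by simp_all
    ultimately show ?thesis unfolding b1_def by (simp only: diff_zero)
  qed
  have b2: "(\<integral>\<^sup>+t. ennreal (t\<^sup>2 * ?f t) * indicator {0<..<p} t \<partial>lborel) = ennreal b2"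
  proof -
    have "(\<integral>\<^sup>+t\<in>{0<..<p}. ennreal ((t - 0) powr (k + 3 - 1) * (p - t) powr (1/2 - 1)) \<partial>lborel) = ennreal ((p - 0) powr (k + 3 + 1/2 - 1) * Beta (k + 3) (1/2))"
      by (rule nn_integral_Beta_interval) (use k p in auto)
    moreover have "k + 3 + 1/2 - 1 = k + 1/2 + 2" by simp
    moreover have "(\<integral>\<^sup>+t\<in>{0<..<p}. ennreal ((t - 0) powr (k + 3 - 1) * (p - t) powr (1/2 - 1)) \<partial>lborel) =
      (\<integral>\<^sup>+t. ennreal (t\<^sup>2 * ?f t) * indicator {0<..<p} t \<partial>lborel)"
    proof (rule nn_integral_cong)
      fix t :: real
      have "(t - 0) powr (k + 3 - 1) * (p - t) powr (1/2 - 1) = t\<^sup>2 * ?f t" if "t \<in> {0<..<p}"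
      proof -
        have "t powr (2 + k) = t\<^sup>2 * t powr k" unfolding powr_add using that by simp
        moreover have "k + 3 - 1 = 2 + k" by simp
        ultimately show ?thesis by (simp only: diff_zero mult.assoc)
      qed
      then show "ennreal ((t - 0) powr (k + 3 - 1) * (p - t) powr (1/2 - 1)) * indicator {0<..<p} t = ennreal (t\<^sup>2 * ?f t) * indicator {0<..<p} t"
        by (cases "t \<in> {0<..<p}") (simp_all only: indicator_simps mult_zero_right simp_thms)
    qed
    ultimately show ?thesis unfolding b2_def by (simp only: diff_zero)
  qed
  have add: "(\<integral>\<^sup>+t. ennreal (?f t) * ennreal (z\<^sup>2 - t\<^sup>2) * indicator {0<..<p} t + ennreal (t\<^sup>2 * ?f t) * indicator {0<..<p} t \<partial>lborel) = X + ennreal b2"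
    unfolding X_def b2[symmetric] by (rule nn_integral_add) measurable
  have z2: "(\<integral>\<^sup>+t. ennreal (z\<^sup>2) * (ennreal (?f t) * indicator {0<..<p} t) \<partial>lborel) = ennreal (z\<^sup>2) * ennreal b1"
    unfolding b1[symmetric] by (rule nn_integral_cmult) measurable
  have split: "ennreal (?f t) * ennreal (z\<^sup>2 - t\<^sup>2) + ennreal (t\<^sup>2 * ?f t) = ennreal (?f t) * (ennreal (z\<^sup>2 - t\<^sup>2) + ennreal (t\<^sup>2))" for t
    by (simp add: ennreal_mult distrib_left mult_ac)
  have le: "ennreal (z\<^sup>2) * ennreal b1 \<le> X + ennreal b2"
    unfolding add[symmetric] z2[symmetric]
  proof (rule nn_integral_mono)
    fix t :: real
    \<comment> \<open>z^2 is at most t^2 plus the positive part of z^2 - t^2, with equality for t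
      \<le> z. Integrated, this gives the inequality everywhere and the equality on the cap.\<close>
    have "ennreal (z\<^sup>2) \<le> ennreal (z\<^sup>2 - t\<^sup>2) + ennreal (t\<^sup>2)"
    proof (cases "t\<^sup>2 \<le> z\<^sup>2")
      case True then show ?thesis by (subst ennreal_plus[symmetric]) auto
    next
      case False
      then have "ennreal (z\<^sup>2) \<le> ennreal (t\<^sup>2)" by (intro ennreal_leI) simp
      then show ?thesis by (simp add: add_increasing)
    qed
    then have "ennreal (?f t) * ennreal (z\<^sup>2) \<le> ennreal (?f t) * ennreal (z\<^sup>2 - t\<^sup>2) + ennreal (t\<^sup>2 * ?f t)"
      unfolding split by (rule mult_left_mono) simp
    then have "ennreal (?f t) * ennreal (z\<^sup>2) * indicator {0<..<p} t \<le> (ennreal (?f t) * ennreal (z\<^sup>2 - t\<^sup>2) + ennreal (t\<^sup>2 * ?f t)) * indicator {0<..<p} t"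
      by (rule mult_right_mono) simp
    from this[unfolded distrib_right]
    show "ennreal (z\<^sup>2) * (ennreal (?f t) * indicator {0<..<p} t) \<le>
      ennreal (?f t) * ennreal (z\<^sup>2 - t\<^sup>2) * indicator {0<..<p} t + ennreal (t\<^sup>2 * ?f t) * indicator {0<..<p} t"
      by (simp only: mult_ac)
  qed
  have eq: "ennreal (z\<^sup>2) * ennreal b1 = X + ennreal b2" if pz: "p \<le> z"
    unfolding add[symmetric] z2[symmetric]
  proof (rule nn_integral_cong)
    fix t :: real
    have "ennreal (?f t) * ennreal (z\<^sup>2) = ennreal (?f t) * ennreal (z\<^sup>2 - t\<^sup>2) + ennreal (t\<^sup>2 * ?f t)" if t: "t \<in> {0<..<p}"
    proof -
      have "t\<^sup>2 \<le> z\<^sup>2" using t pz by (intro power_mono) auto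
      then have "ennreal (z\<^sup>2 - t\<^sup>2) + ennreal (t\<^sup>2) = ennreal (z\<^sup>2)" by (subst ennreal_plus[symmetric]) auto
      then show ?thesis unfolding split by simp
    qed
    then have "ennreal (?f t) * ennreal (z\<^sup>2) * indicator {0<..<p} t = (ennreal (?f t) * ennreal (z\<^sup>2 - t\<^sup>2) + ennreal (t\<^sup>2 * ?f t)) * indicator {0<..<p} t"
      by (cases "t \<in> {0<..<p}") (simp_all only: indicator_simps mult_zero_right simp_thms)
    from this[unfolded distrib_right]
    show "ennreal (z\<^sup>2) * (ennreal (?f t) * indicator {0<..<p} t) =
      ennreal (?f t) * ennreal (z\<^sup>2 - t\<^sup>2) * indicator {0<..<p} t + ennreal (t\<^sup>2 * ?f t) * indicator {0<..<p} t"
      by (simp only: mult_ac)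
  qed
  have P0: "p powr (- (k + 1/2)) * p powr (k + 1/2) = 1" unfolding powr_add[symmetric] using p by simp
  have bpos: "Beta (k + 1) (1/2) > 0" "Beta (k + 3) (1/2) > 0"
    unfolding Beta_def using k by (auto intro!: divide_pos_pos mult_pos_pos Gamma_real_pos)
  have FC: "ennreal C * (ennreal (z\<^sup>2) * ennreal b1) = ennreal F"
  proof -
    have "k + 1 = real d / 2 - 1" by (simp add: k_def)
    then have "C * (z\<^sup>2 * b1) = F * (p powr (- (k + 1/2)) * p powr (k + 1/2))"
      unfolding C_def b1_def F_def z_def by (simp only: mult_ac)
    then have "C * (z\<^sup>2 * b1) = F" unfolding P0 by simp
    moreover have "b1 \<ge> 0" unfolding b1_def using bpos by simp
    ultimately show ?thesis using C by (simp add: ennreal_mult[symmetric])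
  qed
  have QC: "ennreal C * ennreal b2 = ennreal (4 * p\<^sup>2)"
  proof -
    have k3: "k + 3 = real d / 2 + 1" by (simp add: k_def)
    have "p powr (k + 1/2 + 2) = p powr (k + 1/2) * p\<^sup>2" unfolding powr_add[of p "k + 1/2"] using p by simp
    then have "C * b2 = surface_const d * (pi * density_const d) * Beta (k + 3) (1/2) * p\<^sup>2 * (p powr (- (k + 1/2)) * p powr (k + 1/2))"
      unfolding C_def b2_def by (simp only: mult_ac)
    then have "C * b2 = 4 * p\<^sup>2" unfolding P0 k3 surface_density_const[OF d3] by simp
    moreover have "b2 \<ge> 0" unfolding b2_def using bpos by simp
    ultimately show ?thesis using C by (simp add: ennreal_mult[symmetric])
  qed
  have UQ: "U + ennreal (4 * p\<^sup>2) = ennreal C * (X + ennreal b2)"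
    unfolding U QC[symmetric] by (simp only: distrib_left)
  show "ennreal F \<le> U + ennreal (4 * p\<^sup>2)"
    unfolding UQ FC[symmetric] by (rule mult_left_mono[OF le]) simp
  show "U + ennreal (4 * p\<^sup>2) = ennreal F" if "p \<le> cap_height d"
    unfolding UQ FC[symmetric] using eq that by (simp only: z_def)
qed

section \<open>Minimality, uniqueness and support\<close>

lemma sets_sphere_measure [simp]: "sets sphere_measure = sets (restrict_space borel (sphere 0 1))"
  by (simp add: sphere_measure_def)

lemma space_sphere_measure [simp]: "space (sphere_measure :: 'a::euclidean_space measure) = sphere 0 1"
  by (simp add: sphere_measure_def space_restrict_space space_scale_measure)

lemma measurable_sphere_measure:
  "f \<in> borel_measurable borel \<Longrightarrow> f \<in> borel_measurable (sphere_measure :: 'a::euclidean_space measure)"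
  unfolding measurable_cong_sets[OF sets_sphere_measure refl] by (rule measurable_restrict_space1)

text \<open>In the zonal formula a single height is a null set; this disposes of the South Pole and
  of the rim.\<close>

lemma AE_sphere_height_neq:
  fixes e :: "'a::euclidean_space"
  assumes e: "e \<in> Basis" and D: "DIM('a) = m + 3"
  shows "AE y in sphere_measure. (1 + y \<bullet> e) / 2 \<noteq> c"
proof -
  have "card (Basis - {e}) \<noteq> 0" using e D by simp
  then obtain w where w: "w \<in> Basis" "e \<noteq> w"
    by (metis Diff_iff card.empty ex_in_conv insertI1)
  then have ew: "norm w = 1" "e \<bullet> w = 0" using e by (auto simp: inner_Basis)
  have "(\<integral>\<^sup>+y. indicator {c} ((1 + y \<bullet> e) / 2) \<partial>(sphere_measure :: 'a measure)) = ennreal (surface_const (m + 3)) *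
     (\<integral>\<^sup>+q\<in>{0<..<1}. ennreal (2 * (4 * (q * (1 - q))) powr (real m / 2)) *
       (\<integral>\<^sup>+v\<in>{-1<..<1}. ennreal ((1 - v\<^sup>2) powr ((real m - 1) / 2)) * indicator {c} ((1 + (2 * q - 1)) / 2) \<partial>lborel) \<partial>lborel)"
    by (rule nn_integral_sphere_height[OF e ew D, where G="\<lambda>u s. indicator {c} ((1 + u) / 2)"]) measurable
  also have "(\<integral>\<^sup>+q\<in>{0<..<1}. ennreal (2 * (4 * (q * (1 - q))) powr (real m / 2)) *
       (\<integral>\<^sup>+v\<in>{-1<..<1}. ennreal ((1 - v\<^sup>2) powr ((real m - 1) / 2)) * indicator {c} ((1 + (2 * q - 1)) / 2) \<partial>lborel) \<partial>lborel) =
    (\<integral>\<^sup>+q. 0 \<partial>(lborel :: real measure))"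
  proof (rule nn_integral_cong_AE, rule AE_mp[OF AE_lborel_singleton[of c]], rule AE_I2, rule impI)
    fix q :: real assume "q \<noteq> c"
    then have "indicator {c} ((1 + (2 * q - 1)) / 2) = (0::ennreal)" by simp
    then show "ennreal (2 * (4 * (q * (1 - q))) powr (real m / 2)) *
       (\<integral>\<^sup>+v\<in>{-1<..<1}. ennreal ((1 - v\<^sup>2) powr ((real m - 1) / 2)) * indicator {c} ((1 + (2 * q - 1)) / 2) \<partial>lborel) * indicator {0<..<1} q = 0"
      by (simp only: mult_zero_right mult_zero_left nn_integral_const)
  qed
  finally have zero: "(\<integral>\<^sup>+y. indicator {c} ((1 + y \<bullet> e) / 2) \<partial>(sphere_measure :: 'a measure)) = 0" by simp
  have "(\<lambda>y. indicator {c} ((1 + y \<bullet> e) / 2) :: ennreal) \<in> borel_measurable (sphere_measure :: 'a measure)"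
    by (rule measurable_sphere_measure) measurable
  from nn_integral_0_iff_AE[OF this] zero
  have "AE y in (sphere_measure :: 'a measure). (indicator {c} ((1 + y \<bullet> e) / 2) :: ennreal) = 0"
    by (rule iffD1)
  then show ?thesis
  proof (rule eventually_mono)
    fix y assume "(indicator {c} ((1 + y \<bullet> e) / 2) :: ennreal) = 0"
    then show "(1 + y \<bullet> e) / 2 \<noteq> c" unfolding indicator_eq_0_iff by blast
  qed
qed

text \<open>The part of the open ball lying radially over an open set is open, and it contains x /
  2; its Lebesgue measure is a lower bound.\<close>

lemma emeasure_sphere_measure_open_pos:
  fixes U :: "'a::euclidean_space set"
  assumes U: "open U" and x: "x \<in> U" "norm x = 1"
  shows "emeasure sphere_measure (U \<inter> sphere 0 1) > 0"
proof -
  define V where "V = {y \<in> ball 0 1 - {0}. sgn y \<in> U}"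
  have "continuous_on (ball 0 1 - {0::'a}) sgn"
    unfolding sgn_div_norm[abs_def] by (intro continuous_intros) auto
  then have oV: "open V"
    unfolding V_def using continuous_open_preimage[of "ball 0 1 - {0::'a}" sgn U] U
    by (simp add: vimage_def Int_def open_delete)
  have "sgn ((1/2) *\<^sub>R x) = x" using x by (simp add: sgn_div_norm)
  then have "(1/2) *\<^sub>R x \<in> V" using x by (auto simp: V_def)
  then obtain r where r: "r > 0" "ball ((1/2) *\<^sub>R x) r \<subseteq> V" using oV openE by blast
  have "0 < emeasure lborel (ball ((1/2) *\<^sub>R x) r)" using r(1) by (simp add: emeasure_ball)
  also have "\<dots> \<le> emeasure lborel V" using r(2) oV by (intro emeasure_mono) auto
  also have "\<dots> = (\<integral>\<^sup>+y. indicator V y \<partial>lborel)" using oV by simp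
  also have "\<dots> \<le> (\<integral>\<^sup>+y\<in>cball 0 1 - {0}. indicator U (sgn y) \<partial>lborel)"
    by (intro nn_integral_mono) (auto simp: V_def indicator_def)
  also have "\<dots> \<le> of_nat DIM('a) * (\<integral>\<^sup>+y\<in>cball 0 1 - {0}. indicator U (sgn y) \<partial>lborel)"
  proof -
    have "(1::ennreal) \<le> of_nat DIM('a)" by (metis DIM_positive One_nat_def Suc_leI of_nat_1 of_nat_mono)
    from mult_right_mono[OF this] show ?thesis by simp
  qed
  also have "\<dots> = (\<integral>\<^sup>+y. indicator U y \<partial>sphere_measure)"
    by (rule nn_integral_sphere_measure[symmetric]) (use U in simp)
  also have "\<dots> = (\<integral>\<^sup>+y. indicator (U \<inter> sphere 0 1) y \<partial>(sphere_measure :: 'a measure))"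
    by (rule nn_integral_cong) (simp add: indicator_def)
  also have "\<dots> = emeasure sphere_measure (U \<inter> sphere 0 1)"
    using U by (intro nn_integral_indicator) (auto simp: sets_restrict_space)
  finally show ?thesis .
qed

text \<open>An atom would put positive mass on the diagonal of the product, where the kernel is
  infinite.\<close>

lemma finite_energy_no_atom:
  fixes \<nu> :: "'a::euclidean_space measure"
  assumes \<nu>: "\<nu> \<in> unit_measures" and fin: "energy \<nu> < \<infinity>" and d: "DIM('a) \<ge> 3" and a: "norm a = 1"
  shows "emeasure \<nu> {a} = 0"
proof (rule ccontr)
  assume n: "emeasure \<nu> {a} \<noteq> 0"
  have sa: "{a} \<in> sets \<nu>"
  proof -
    have "{a} = {a} \<inter> sphere 0 1" using a by auto
    then show ?thesis unfolding unit_measuresD(3)[OF \<nu>] sets_restrict_space by (auto intro!: image_eqI[of _ _ "{a}"])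
  qed
  have "(\<integral>\<^sup>+x. \<infinity> * emeasure \<nu> {a} * indicator {a} x \<partial>\<nu>) \<le> energy \<nu>"
    unfolding energy_def
  proof (rule nn_integral_mono)
    fix x
    show "\<infinity> * emeasure \<nu> {a} * indicator {a} x \<le> (\<integral>\<^sup>+ y. inverse (ennreal (norm (x - y) ^ (DIM('a) - 2))) \<partial>\<nu>)"
    proof (cases "x = a")
      case True
      have "\<infinity> * emeasure \<nu> {a} = (\<integral>\<^sup>+y. \<infinity> * indicator {a} y \<partial>\<nu>)" using sa by (simp add: nn_integral_cmult)
      also have "\<dots> \<le> (\<integral>\<^sup>+ y. inverse (ennreal (norm (x - y) ^ (DIM('a) - 2))) \<partial>\<nu>)"
      proof (rule nn_integral_mono)
        show "\<infinity> * indicator {a} y \<le> inverse (ennreal (norm (x - y) ^ (DIM('a) - 2)))" for y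
          using True d by (cases "y = a") (simp_all add: power_0_left)
      qed
      finally show ?thesis using True by simp
    qed simp
  qed
  moreover have "(\<integral>\<^sup>+x. \<infinity> * emeasure \<nu> {a} * indicator {a} x \<partial>\<nu>) = \<infinity>"
  proof -
    have "\<infinity> * emeasure \<nu> {a} = (\<infinity>::ennreal)" using n by (simp add: ennreal_top_mult)
    then show ?thesis by (simp only: nn_integral_cmult_indicator[OF sa])
  qed
  ultimately show False using fin by simp
qed

section \<open>The candidate measure and the variational inequality\<close>

definition cap_equilibrium :: "'a::euclidean_space \<Rightarrow> 'a measure" where
  "cap_equilibrium e = density sphere_measure (\<lambda>y. height_weight DIM('a) ((1 + y \<bullet> e) / 2))"

context
  fixes e :: "'a::euclidean_space"
  assumes e: "e \<in> Basis" and D3: "DIM('a) \<ge> 3"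
begin

lemma DIM_eq: "DIM('a) = (DIM('a) - 3) + 3"
  using D3 by simp

lemma inner_bounds:
  assumes "norm x = 1" shows "-1 \<le> x \<bullet> e" "x \<bullet> e \<le> 1"
  using Cauchy_Schwarz_ineq2[of x e] assms e by auto

lemma height_weight_borel: "(\<lambda>y::'a. height_weight DIM('a) ((1 + y \<bullet> e) / 2)) \<in> borel_measurable borel"
  using measurable_compose[OF _ height_weight_measurable[OF D3], of "\<lambda>y::'a. (1 + y \<bullet> e) / 2" borel] by simp

lemma cap_equilibrium_unit: "cap_equilibrium e \<in> unit_measures"
proof -
  have "emeasure (cap_equilibrium e) (space (cap_equilibrium e)) = (\<integral>\<^sup>+y. 1 \<partial>cap_equilibrium e)"
    by simp
  also have "\<dots> = (\<integral>\<^sup>+y. height_weight DIM('a) ((1 + y \<bullet> e) / 2) \<partial>sphere_measure)"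
    unfolding cap_equilibrium_def
    by (subst nn_integral_density[OF measurable_sphere_measure[OF height_weight_borel]]) simp_all
  also have "\<dots> = 1" by (rule nn_integral_height_weight_mass[OF e refl DIM_eq])
  finally show ?thesis unfolding unit_measures_def by (auto simp: cap_equilibrium_def intro: prob_spaceI)
qed

text \<open>The value of potential plus field on the cap; the powers of p have cancelled, so it is
  the same at all points.\<close>

definition cap_constant :: real where
  "cap_constant = surface_const DIM('a) * (pi * density_const DIM('a)) * (cap_height DIM('a))\<^sup>2 * Beta (DIM('a) / 2 - 1) (1/2)"

definition cap_potential :: "'a \<Rightarrow> ennreal" where
  "cap_potential x = (\<integral>\<^sup>+ y. inverse (ennreal (norm (x - y) ^ (DIM('a) - 2))) \<partial>cap_equilibrium e)"

text \<open>The zonal formula requires a height strictly between 0 and 1, and among unit vectors x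
  \<bullet> e = 1 or x \<bullet> e = -1 occurs only at the poles.\<close>

lemma cap_potential_variational:
  assumes x: "norm x = 1" "x \<noteq> e" "x \<noteq> - e"
  shows "ennreal cap_constant \<le> cap_potential x + ennreal ((1 + x \<bullet> e)\<^sup>2)"
    and "(1 + x \<bullet> e) / 2 \<le> cap_height DIM('a) \<Longrightarrow> cap_potential x + ennreal ((1 + x \<bullet> e)\<^sup>2) = ennreal cap_constant"
proof -
  define p where "p = (1 + x \<bullet> e) / 2"
  have xp: "x \<bullet> e = 2 * p - 1" by (simp add: p_def field_simps)
  have q: "4 * p\<^sup>2 = (1 + x \<bullet> e)\<^sup>2" by (simp add: p_def power_divide)
  have ee: "e \<bullet> e = 1" "x \<bullet> x = 1" using e x by (simp_all add: norm_eq_1)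
  have "x \<bullet> e \<noteq> 1"
  proof
    assume "x \<bullet> e = 1"
    then have "(x - e) \<bullet> (x - e) = 0" using ee by (simp add: inner_diff inner_commute)
    then show False using x by simp
  qed
  moreover have "x \<bullet> e \<noteq> - 1"
  proof
    assume "x \<bullet> e = - 1"
    then have "(x + e) \<bullet> (x + e) = 0" using ee by (simp add: inner_add inner_commute)
    then show False using x by (simp add: eq_neg_iff_add_eq_0)
  qed
  ultimately have p: "0 < p" "p < 1" using inner_bounds[OF x(1)] by (auto simp: p_def)
  have U: "cap_potential x = (\<integral>\<^sup>+y. height_weight DIM('a) ((1 + y \<bullet> e) / 2) * inverse (ennreal (norm (x - y) ^ (DIM('a) - 2))) \<partial>sphere_measure)"
    unfolding cap_potential_def cap_equilibrium_def
    by (rule nn_integral_density; rule measurable_sphere_measure) (rule height_weight_borel, measurable)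
  note P = potential_plus_field[OF e refl DIM_eq x(1) xp p, folded U cap_constant_def, unfolded q]
  show "ennreal cap_constant \<le> cap_potential x + ennreal ((1 + x \<bullet> e)\<^sup>2)" by (rule P(1))
  show "cap_potential x + ennreal ((1 + x \<bullet> e)\<^sup>2) = ennreal cap_constant" if "(1 + x \<bullet> e) / 2 \<le> cap_height DIM('a)"
    by (rule P(2)) (use that in \<open>simp add: p_def\<close>)
qed

lemma cap_potential_measurable:
  assumes \<nu>: "\<nu> \<in> unit_measures"
  shows "cap_potential \<in> borel_measurable \<nu>"
proof -
  interpret prob_space "cap_equilibrium e" using unit_measuresD(1)[OF cap_equilibrium_unit] .
  have m1: "(\<lambda>x. x) \<in> measurable \<nu> borel" and m2: "(\<lambda>x. x) \<in> measurable (cap_equilibrium e) borel"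
    by (rule unit_measures_measurable[OF \<nu>], simp) (rule unit_measures_measurable[OF cap_equilibrium_unit], simp)
  have "(\<lambda>z. fst z) \<in> borel_measurable (\<nu> \<Otimes>\<^sub>M cap_equilibrium e)"
    by (rule measurable_compose[OF measurable_fst m1])
  moreover have "(\<lambda>z. snd z) \<in> borel_measurable (\<nu> \<Otimes>\<^sub>M cap_equilibrium e)"
    by (rule measurable_compose[OF measurable_snd m2])
  ultimately have "(\<lambda>z. inverse (ennreal (norm (fst z - snd z) ^ (DIM('a) - 2)))) \<in> borel_measurable (\<nu> \<Otimes>\<^sub>M cap_equilibrium e)"
    by measurable
  then show ?thesis
    unfolding cap_potential_def[abs_def] by (intro borel_measurable_nn_integral) (simp add: case_prod_unfold)
qed

text \<open>This allows the variational inequality, known away from the poles, to be integrated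
  against any competitor of finite energy.\<close>

lemma AE_not_pole:
  assumes \<nu>: "\<nu> \<in> unit_measures" and fin: "energy \<nu> < \<infinity>"
  shows "AE x in \<nu>. norm x = 1 \<and> x \<noteq> e \<and> x \<noteq> - e"
proof -
  have ne: "norm e = 1" using e by simp
  have n: "AE x in \<nu>. x \<noteq> a" if "norm a = 1" for a
  proof (rule AE_I[of _ _ "{a}"])
    show "emeasure \<nu> {a} = 0" by (rule finite_energy_no_atom[OF \<nu> fin D3 that])
    show "{a} \<in> sets \<nu>"
      unfolding unit_measuresD(3)[OF \<nu>] sets_restrict_space using that by (auto intro!: image_eqI[of _ _ "{a}"])
  qed auto
  have "AE x in \<nu>. norm x = 1" by (rule AE_I2) (simp add: unit_measuresD(2)[OF \<nu>])
  with n[OF ne] n[of "- e"] ne show ?thesis by auto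
qed

lemma field_integral:
  assumes \<nu>: "\<nu> \<in> unit_measures"
  shows "(\<integral>\<^sup>+x. ennreal ((1 + x \<bullet> e)\<^sup>2) \<partial>\<nu>) = ennreal (\<integral>x. (1 + x \<bullet> e)\<^sup>2 \<partial>\<nu>)" "0 \<le> (\<integral>x. (1 + x \<bullet> e)\<^sup>2 \<partial>\<nu>)"
proof -
  have "integrable \<nu> (\<lambda>x. (1 + x \<bullet> e)\<^sup>2)"
    by (rule unit_measures_integrable[OF \<nu>]) (intro continuous_intros)
  then show "(\<integral>\<^sup>+x. ennreal ((1 + x \<bullet> e)\<^sup>2) \<partial>\<nu>) = ennreal (\<integral>x. (1 + x \<bullet> e)\<^sup>2 \<partial>\<nu>)"
    by (rule nn_integral_eq_integral) auto
qed (auto intro: integral_nonneg_AE)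

lemma mutual_plus_field:
  assumes \<nu>: "\<nu> \<in> unit_measures"
  shows "(\<integral>\<^sup>+x. cap_potential x + ennreal ((1 + x \<bullet> e)\<^sup>2) \<partial>\<nu>) =
    mutual_energy \<nu> (cap_equilibrium e) + ennreal (\<integral>x. (1 + x \<bullet> e)\<^sup>2 \<partial>\<nu>)"
proof -
  have "(\<lambda>x. ennreal ((1 + x \<bullet> e)\<^sup>2)) \<in> borel_measurable \<nu>"
    by (rule unit_measures_measurable[OF \<nu>]) measurable
  then show ?thesis
    unfolding field_integral(1)[OF \<nu>, symmetric] mutual_energy_def cap_potential_def[symmetric]
    by (rule nn_integral_add[OF cap_potential_measurable[OF \<nu>]])
qed

text \<open>Potential plus field is integrated against the measure itself, which charges only
  heights strictly between 0 and \<open>cap_height\<close>, where the sum is constant.\<close>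

lemma cap_equilibrium_energy:
  "energy (cap_equilibrium e) + ennreal (\<integral>x. (1 + x \<bullet> e)\<^sup>2 \<partial>cap_equilibrium e) = ennreal cap_constant"
proof -
  interpret prob_space "cap_equilibrium e" using unit_measuresD(1)[OF cap_equilibrium_unit] .
  have ae: "AE x in sphere_measure. 0 < height_weight DIM('a) ((1 + x \<bullet> e) / 2) \<longrightarrow>
    cap_potential x + ennreal ((1 + x \<bullet> e)\<^sup>2) = ennreal cap_constant"
  proof (rule AE_I2)
    fix x :: 'a assume "x \<in> space sphere_measure"
    then have x: "norm x = 1" by simp
    show "0 < height_weight DIM('a) ((1 + x \<bullet> e) / 2) \<longrightarrow> cap_potential x + ennreal ((1 + x \<bullet> e)\<^sup>2) = ennreal cap_constant"
    proof
      assume hw: "0 < height_weight DIM('a) ((1 + x \<bullet> e) / 2)"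
      have "(1 + x \<bullet> e) / 2 \<in> {0<..<cap_height DIM('a)}"
      proof (rule ccontr)
        assume "(1 + x \<bullet> e) / 2 \<notin> {0<..<cap_height DIM('a)}"
        then have "indicator {0<..<cap_height DIM('a)} ((1 + x \<bullet> e) / 2) = (0::ennreal)" by (rule indicator_simps(2))
        then have "height_weight DIM('a) ((1 + x \<bullet> e) / 2) = 0" unfolding height_weight_def by (simp only: mult_zero_right)
        with hw show False by (simp only: less_irrefl)
      qed
      then have p: "0 < (1 + x \<bullet> e) / 2" "(1 + x \<bullet> e) / 2 < cap_height DIM('a)"
        by (simp_all only: greaterThanLessThan_iff)
      have "x \<noteq> e" "x \<noteq> - e" using p alpha0_props(4)[OF D3] e by auto
      with x p show "cap_potential x + ennreal ((1 + x \<bullet> e)\<^sup>2) = ennreal cap_constant"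
        by (intro cap_potential_variational(2)) auto
    qed
  qed
  have "energy (cap_equilibrium e) + ennreal (\<integral>x. (1 + x \<bullet> e)\<^sup>2 \<partial>cap_equilibrium e) =
    (\<integral>\<^sup>+x. cap_potential x + ennreal ((1 + x \<bullet> e)\<^sup>2) \<partial>cap_equilibrium e)"
    by (simp only: mutual_plus_field[OF cap_equilibrium_unit] energy_eq_mutual)
  also have "\<dots> = (\<integral>\<^sup>+x. ennreal cap_constant \<partial>cap_equilibrium e)"
  proof (rule nn_integral_cong_AE)
    show "AE x in cap_equilibrium e. cap_potential x + ennreal ((1 + x \<bullet> e)\<^sup>2) = ennreal cap_constant"
      unfolding cap_equilibrium_def using ae
      by (subst AE_density[OF measurable_sphere_measure[OF height_weight_borel]])
         (simp add: cap_potential_def cap_equilibrium_def)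
  qed
  also have "\<dots> = ennreal cap_constant" by (simp add: emeasure_space_1)
  finally show ?thesis .
qed

lemma weighted_energy_eq:
  assumes Q: "\<And>x. norm x = 1 \<Longrightarrow> Q x = (1 + x \<bullet> e)\<^sup>2" and \<nu>: "\<nu> \<in> unit_measures"
  shows "weighted_energy Q \<nu> = enn2ereal (energy \<nu>) + ereal (2 * (\<integral>x. (1 + x \<bullet> e)\<^sup>2 \<partial>\<nu>))"
proof -
  have "(\<integral>x. Q x \<partial>\<nu>) = (\<integral>x. (1 + x \<bullet> e)\<^sup>2 \<partial>\<nu>)"
    by (rule Bochner_Integration.integral_cong) (auto simp: unit_measuresD(2)[OF \<nu>] Q)
  then show ?thesis by (simp add: weighted_energy_def)
qed

text \<open>Let e0, q0 be energy and field integral of the candidate, en, q those of the competitor,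
  M the mutual energy. The variational inequality integrates to e0 + q0 \<le> M + q and positive
  definiteness gives 2 * M \<le> en + e0; together e0 + 2 * q0 \<le> en + 2 * q. Equality forces 2 *
  M = en + e0, hence equal measures. A competitor of infinite energy has infinite weighted
  energy.\<close>

lemma cap_equilibrium_minimal:
  assumes Q: "\<And>x. norm x = 1 \<Longrightarrow> Q x = (1 + x \<bullet> e)\<^sup>2" and \<nu>: "\<nu> \<in> unit_measures"
  shows "weighted_energy Q (cap_equilibrium e) \<le> weighted_energy Q \<nu>"
    and "weighted_energy Q \<nu> = weighted_energy Q (cap_equilibrium e) \<Longrightarrow> \<nu> = cap_equilibrium e"
proof -
  let ?\<mu> = "cap_equilibrium e"
  note \<mu> = cap_equilibrium_unit
  define q0 q where "q0 = (\<integral>x. (1 + x \<bullet> e)\<^sup>2 \<partial>?\<mu>)" and "q = (\<integral>x. (1 + x \<bullet> e)\<^sup>2 \<partial>\<nu>)"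
  have q0: "q0 \<ge> 0" "q \<ge> 0" using field_integral(2) \<mu> \<nu> by (auto simp: q0_def q_def)
  \<comment> \<open>The energy plus the field integral is the real \<open>cap_constant\<close>, so
    the energy is finite.\<close>
  have "energy ?\<mu> \<noteq> \<top>" using cap_equilibrium_energy by (auto simp: top_add)
  then obtain e0 where e0: "energy ?\<mu> = ennreal e0" "e0 \<ge> 0" by (cases "energy ?\<mu>") auto
  have c: "cap_constant = e0 + q0" "cap_constant \<ge> 0"
  proof -
    show c0: "cap_constant \<ge> 0"
      unfolding cap_constant_def Beta_def using surface_const_pos[OF D3] density_const_pos[OF D3] D3
      by (intro mult_nonneg_nonneg divide_nonneg_nonneg less_imp_le[OF Gamma_real_pos]) auto
    have "ennreal (e0 + q0) = ennreal cap_constant"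
      using cap_equilibrium_energy e0 q0 by (simp add: q0_def)
    then show "cap_constant = e0 + q0"
      by (subst (asm) ennreal_inj) (use e0 q0 c0 in auto)
  qed
  have w0: "weighted_energy Q ?\<mu> = ereal (e0 + 2 * q0)"
    using weighted_energy_eq[OF Q \<mu>] e0 by (simp add: q0_def)
  have "weighted_energy Q ?\<mu> \<le> weighted_energy Q \<nu> \<and> (weighted_energy Q \<nu> = weighted_energy Q ?\<mu> \<longrightarrow> \<nu> = ?\<mu>)"
  proof (cases "energy \<nu>")
    case top
    then have "weighted_energy Q \<nu> = \<infinity>" using weighted_energy_eq[OF Q \<nu>] by simp
    then show ?thesis using w0 by simp
  next
    case (real en)
    have fin: "energy \<nu> < \<infinity>" using real by simp
    have wn: "weighted_energy Q \<nu> = ereal (en + 2 * q)"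
      using weighted_energy_eq[OF Q \<nu>] real by (simp add: q_def)
    have le: "2 * mutual_energy \<nu> ?\<mu> \<le> ennreal en + ennreal e0"
      using mutual_energy_le(1)[OF \<nu> \<mu> D3] real e0 by simp
    then have "mutual_energy \<nu> ?\<mu> \<noteq> \<top>" using real e0
      by (auto simp: ennreal_mult_top ennreal_plus[symmetric] top_unique simp del: ennreal_plus)
    then obtain M where M: "mutual_energy \<nu> ?\<mu> = ennreal M" "M \<ge> 0" by (cases "mutual_energy \<nu> ?\<mu>") auto
    have M1: "2 * M \<le> en + e0"
    proof -
      have "ennreal (2 * M) \<le> ennreal (en + e0)" using le M real e0 by (simp add: ennreal_mult)
      then show ?thesis by (subst (asm) ennreal_le_iff) (use real e0 in auto)
    qed
    interpret \<nu>: prob_space \<nu> using unit_measuresD(1)[OF \<nu>] .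
    have "ennreal cap_constant = (\<integral>\<^sup>+x. ennreal cap_constant \<partial>\<nu>)" by (simp add: \<nu>.emeasure_space_1)
    also have "\<dots> \<le> (\<integral>\<^sup>+x. cap_potential x + ennreal ((1 + x \<bullet> e)\<^sup>2) \<partial>\<nu>)"
      using AE_not_pole[OF \<nu> fin] by (intro nn_integral_mono_AE) (auto intro!: cap_potential_variational(1))
    also have "\<dots> = ennreal (M + q)" using mutual_plus_field[OF \<nu>] M q0 by (simp add: q_def)
    finally have "ennreal (e0 + q0) \<le> ennreal (M + q)" unfolding c(1) .
    then have M2: "e0 + q0 \<le> M + q" by (subst (asm) ennreal_le_iff) (use M q0 in auto)
    have "\<nu> = ?\<mu>" if "en + 2 * q = e0 + 2 * q0"
    proof (rule mutual_energy_le(2)[OF \<nu> \<mu> D3 fin])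
      show "energy ?\<mu> < \<infinity>" using e0 by simp
      have "2 * M = en + e0" using that M1 M2 by linarith
      then have "ennreal (2 * M) = ennreal (en + e0)" by simp
      then show "2 * mutual_energy \<nu> ?\<mu> = energy \<nu> + energy ?\<mu>" using M real e0 by (simp add: ennreal_mult)
    qed
    then show ?thesis using M1 M2 unfolding w0 wn by auto
  qed
  then show "weighted_energy Q ?\<mu> \<le> weighted_energy Q \<nu>"
    "weighted_energy Q \<nu> = weighted_energy Q ?\<mu> \<Longrightarrow> \<nu> = ?\<mu>" by auto
qed

lemma is_extremal_iff:
  assumes Q: "\<And>x. norm x = 1 \<Longrightarrow> Q x = (1 + x \<bullet> e)\<^sup>2"
  shows "is_extremal Q \<nu> \<longleftrightarrow> \<nu> = cap_equilibrium e"
proof -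
  have "min_energy Q = weighted_energy Q (cap_equilibrium e)"
    unfolding min_energy_def
  proof (rule antisym)
    show "(INF \<mu>\<in>unit_measures. weighted_energy Q \<mu>) \<le> weighted_energy Q (cap_equilibrium e)"
      by (rule INF_lower[OF cap_equilibrium_unit])
    show "weighted_energy Q (cap_equilibrium e) \<le> (INF \<mu>\<in>unit_measures. weighted_energy Q \<mu>)"
      by (rule INF_greatest, rule cap_equilibrium_minimal(1)) (use Q in auto)
  qed
  then show ?thesis
    unfolding is_extremal_def using cap_equilibrium_minimal(2)[OF Q] cap_equilibrium_unit by auto
qed

section \<open>The support\<close>

text \<open>Positivity of the density is known only strictly between South Pole and rim. Every point
  of the cap is a limit of such points: move along its meridian, parametrized by the height s, into
  0 < s < z.\<close>

lemma near_point_of_height: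
  assumes U: "open U" "x \<in> U" and x: "norm x = 1" "(1 + x \<bullet> e) / 2 \<le> cap_height DIM('a)"
  obtains y where "y \<in> U" "norm y = 1" "0 < (1 + y \<bullet> e) / 2" "(1 + y \<bullet> e) / 2 < cap_height DIM('a)"
proof -
  define p where "p = (1 + x \<bullet> e) / 2"
  define z where "z = cap_height DIM('a)"
  have z: "0 < z" "z < 1" using alpha0_props[OF D3] by (auto simp: z_def)
  have p: "0 \<le> p" "p \<le> z" using inner_bounds[OF x(1)] x(2) by (auto simp: p_def z_def)
  have ee: "e \<bullet> e = 1" "x \<bullet> x = 1" using e x by (simp_all add: norm_eq_1)
  have xe: "x \<bullet> e = 2 * p - 1" by (simp add: p_def field_simps)
  define v where "v = x - (2 * p - 1) *\<^sub>R e"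
  have ve: "v \<bullet> e = 0" using ee xe by (simp add: v_def inner_diff_left)
  have vv: "v \<bullet> v = 4 * (p * (1 - p))"
  proof -
    have "(x - a *\<^sub>R e) \<bullet> (x - a *\<^sub>R e) = 1 - a\<^sup>2" if "x \<bullet> e = a" for a
      using that ee inner_commute[of e x] by (simp add: inner_diff_left inner_diff_right power2_eq_square)
    from this[OF xe] show ?thesis unfolding v_def by (simp add: power2_eq_square algebra_simps)
  qed
  \<comment> \<open>The horizontal direction of the meridian. At the South Pole v = 0, and any unit
    vector orthogonal to \<open>e\<close> serves.\<close>
  obtain w where w: "norm w = 1" "w \<bullet> e = 0" "v = sqrt (4 * (p * (1 - p))) *\<^sub>R w"
  proof (cases "v = 0")
    case True
    have "card (Basis - {e}) \<noteq> 0" using e D3 by simp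
    then obtain w where "w \<in> Basis" "e \<noteq> w"
      by (metis Diff_iff card.empty ex_in_conv insertI1)
    then show ?thesis using that[of w] e True vv by (auto simp: inner_Basis)
  next
    case False
    then have n: "norm v > 0" by simp
    have nv: "norm v = sqrt (4 * (p * (1 - p)))" unfolding vv[symmetric] by (rule norm_eq_sqrt_inner)
    show ?thesis
    proof (rule that)
      show "norm ((1 / norm v) *\<^sub>R v) = 1" using n by simp
      show "((1 / norm v) *\<^sub>R v) \<bullet> e = 0" using ve by simp
      show "v = sqrt (4 * (p * (1 - p))) *\<^sub>R ((1 / norm v) *\<^sub>R v)" unfolding nv[symmetric] using n by simp
    qed
  qed
  define g where "g s = (2 * s - 1) *\<^sub>R e + sqrt (4 * (s * (1 - s))) *\<^sub>R w" for s
  have gp: "g p = x" unfolding g_def w(3)[symmetric] v_def by simp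
  have ge: "g s \<bullet> e = 2 * s - 1" for s using ee w by (simp add: g_def inner_add_left)
  have gn: "norm (g s) = 1" if "0 \<le> s" "s \<le> 1" for s
  proof -
    have ww: "w \<bullet> w = 1" "e \<bullet> w = 0" using w by (simp_all add: norm_eq_1 inner_commute)
    have "g s \<bullet> g s = (2 * s - 1)\<^sup>2 + (sqrt (4 * (s * (1 - s))))\<^sup>2"
      using ee w(2) ww by (simp add: g_def inner_add_left inner_add_right power2_eq_square)
    also have "(sqrt (4 * (s * (1 - s))))\<^sup>2 = 4 * (s * (1 - s))" using that by simp
    also have "(2 * s - 1)\<^sup>2 + 4 * (s * (1 - s)) = 1" by (simp add: power2_eq_square algebra_simps)
    finally show ?thesis by (simp add: norm_eq_1)
  qed
  have "continuous_on UNIV g" unfolding g_def[abs_def] by (intro continuous_intros)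
  then have "open (g -` U)" using U(1) by (simp add: open_vimage continuous_on_eq_continuous_at continuous_on_open_vimage)
  moreover have "p \<in> g -` U" using gp U(2) by simp
  moreover have "p \<in> closure {0<..<z}" using p z by simp
  ultimately obtain s where "s \<in> g -` U" "s \<in> {0<..<z}"
    by (meson closure_iff_nhds_not_empty disjoint_iff order_refl)
  then show ?thesis using that[of "g s"] gn[of s] ge[of s] z by (auto simp: z_def)
qed

text \<open>Off the cap the weight is 0 on an open set. A neighbourhood of measure 0 of a point of
  the cap would meet the zone of positive density in a nonempty relatively open set, which would
  then be null for the surface measure.\<close>

lemma supp_cap_equilibrium:
  "supp (cap_equilibrium e) = {x. norm x = 1 \<and> (1 + x \<bullet> e) / 2 \<le> cap_height DIM('a)}"
proof -
  let ?\<mu> = "cap_equilibrium e"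
  let ?z = "cap_height DIM('a)"
  have sp: "space ?\<mu> = sphere 0 1" by (rule unit_measuresD(2)[OF cap_equilibrium_unit])
  have em: "emeasure ?\<mu> (U \<inter> sphere 0 1) = (\<integral>\<^sup>+y. height_weight DIM('a) ((1 + y \<bullet> e) / 2) * indicator (U \<inter> sphere 0 1) y \<partial>sphere_measure)"
    if "open U" for U
    unfolding cap_equilibrium_def
    by (rule emeasure_density[OF measurable_sphere_measure[OF height_weight_borel]])
       (use that in \<open>auto simp: sets_restrict_space\<close>)
  show ?thesis
  proof (intro equalityI subsetI)
    fix x assume "x \<in> supp ?\<mu>"
    then have x: "norm x = 1" "\<And>U. open U \<Longrightarrow> x \<in> U \<Longrightarrow> emeasure ?\<mu> (U \<inter> sphere 0 1) > 0"
      by (auto simp: supp_def sp)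
    have "\<not> ?z < (1 + x \<bullet> e) / 2"
    proof
      assume *: "?z < (1 + x \<bullet> e) / 2"
      define U where "U = {y::'a. ?z < (1 + y \<bullet> e) / 2}"
      have U: "open U" unfolding U_def by (intro open_Collect_less continuous_intros) auto
      have "emeasure ?\<mu> (U \<inter> sphere 0 1) = (\<integral>\<^sup>+y. 0 \<partial>(sphere_measure :: 'a measure))"
        unfolding em[OF U] by (rule nn_integral_cong) (auto simp: height_weight_def U_def indicator_def)
      then show False using x(2)[OF U] * by (simp add: U_def)
    qed
    with x(1) show "x \<in> {x. norm x = 1 \<and> (1 + x \<bullet> e) / 2 \<le> ?z}" by simp
  next
    fix x assume "x \<in> {x. norm x = 1 \<and> (1 + x \<bullet> e) / 2 \<le> ?z}"
    then have x: "norm x = 1" "(1 + x \<bullet> e) / 2 \<le> ?z" by auto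
    have "emeasure ?\<mu> (U \<inter> sphere 0 1) > 0" if U: "open U" "x \<in> U" for U
    proof (rule ccontr)
      assume "\<not> emeasure ?\<mu> (U \<inter> sphere 0 1) > 0"
      then have zero: "(\<integral>\<^sup>+y. height_weight DIM('a) ((1 + y \<bullet> e) / 2) * indicator (U \<inter> sphere 0 1) y \<partial>sphere_measure) = 0"
        using em[OF U(1)] by simp
      have "(\<lambda>y. height_weight DIM('a) ((1 + y \<bullet> e) / 2) * indicator (U \<inter> sphere 0 1) y) \<in> borel_measurable (sphere_measure :: 'a measure)"
        by (intro measurable_sphere_measure borel_measurable_times_ennreal height_weight_borel borel_measurable_indicator)
           (use U in auto)
      from nn_integral_0_iff_AE[OF this] zero
      have ae: "AE y in (sphere_measure :: 'a measure). height_weight DIM('a) ((1 + y \<bullet> e) / 2) * indicator (U \<inter> sphere 0 1) y = 0"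
        by (rule iffD1)
      define V where "V = U \<inter> {y. 0 < (1 + y \<bullet> e) / 2 \<and> (1 + y \<bullet> e) / 2 < ?z}"
      have V: "open V" unfolding V_def using U(1)
        by (intro open_Int open_Collect_conj open_Collect_less continuous_intros) auto
      obtain y where y: "y \<in> V" "norm y = 1"
        using near_point_of_height[OF U x] unfolding V_def by blast
      have ae': "AE y in (sphere_measure :: 'a measure). y \<notin> V \<inter> sphere 0 1"
        using ae
      proof (rule eventually_mono)
        fix y assume z: "height_weight DIM('a) ((1 + y \<bullet> e) / 2) * indicator (U \<inter> sphere 0 1) y = 0"
        show "y \<notin> V \<inter> sphere 0 1"
        proof
          assume "y \<in> V \<inter> sphere 0 1"
          then have y: "0 < (1 + y \<bullet> e) / 2" "(1 + y \<bullet> e) / 2 < ?z" "y \<in> U \<inter> sphere 0 1" by (auto simp: V_def)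
          have "ennreal (height_density DIM('a) ((1 + y \<bullet> e) / 2)) > 0"
            using height_density_pos[OF D3 y(1,2)] by simp
          moreover have "indicator {0<..<?z} ((1 + y \<bullet> e) / 2) = (1::ennreal)"
            by (rule indicator_simps(1)) (rule greaterThanLessThan_iff[THEN iffD2, OF conjI, OF y(1,2)])
          moreover have "indicator (U \<inter> sphere 0 1) y = (1::ennreal)" by (rule indicator_simps(1)[OF y(3)])
          ultimately show False using z unfolding height_weight_def by (simp only: mult_1_right less_irrefl)
        qed
      qed
      have eq: "{y \<in> space (sphere_measure :: 'a measure). \<not> y \<notin> V \<inter> sphere 0 1} = V \<inter> sphere 0 1"
        by auto
      have "V \<inter> sphere 0 1 \<in> sets (sphere_measure :: 'a measure)"
        using V by (auto simp: sets_restrict_space)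
      from AE_iff_measurable[OF this eq] ae' have "emeasure sphere_measure (V \<inter> sphere 0 1) = 0"
        by (rule iffD1)
      then show False using emeasure_sphere_measure_open_pos[OF V y] by simp
    qed
    with x(1) show "x \<in> supp ?\<mu>" by (auto simp: supp_def sp)
  qed
qed

end

section \<open>Return to the polar angle\<close>

lemma mem_south_cap_iff:
  fixes k :: "'n::finite"
  assumes d: "CARD('n) \<ge> 3" and x: "norm x = 1"
  shows "x \<in> south_cap k (alpha0 CARD('n)) \<longleftrightarrow> (1 + x \<bullet> axis k 1) / 2 \<le> cap_height CARD('n)"
proof -
  note a0 = alpha0_props[OF d]
  have b: "\<bar>x $ k\<bar> \<le> 1" using component_le_norm_cart[of x k] x by simp
  have "arccos (x $ k) \<ge> alpha0 CARD('n) \<longleftrightarrow> cos (arccos (x $ k)) \<le> cos (alpha0 CARD('n))"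
    using a0(1) b arccos_lbound[of "x $ k"] arccos_ubound[of "x $ k"]
    by (intro cos_mono_le_eq[symmetric]) auto
  also have "cos (arccos (x $ k)) = x $ k" by (rule cos_arccos) (use b in linarith)+
  finally show ?thesis
    using x b arccos_ubound[of "x $ k"] a0(5)
    by (auto simp: south_cap_def polar_angle_def inner_axis)
qed

text \<open>The formula in the polar angle agrees with \<open>height_weight\<close> except on the
  two parallels h = 0 and h = z; measurability and sign are taken over from the weight.\<close>

lemma has_density_cap_equilibrium:
  fixes k :: "'n::finite"
  assumes d: "CARD('n) \<ge> 3"
  shows "has_density (cap_equilibrium (axis k 1 :: real ^ 'n)) sphere_measure
    (\<lambda>x. if x \<in> south_cap k (alpha0 CARD('n)) then eq_density CARD('n) (polar_angle k x) else 0)"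
    (is "has_density _ _ ?f")
proof -
  let ?d = "CARD('n)"
  let ?e = "axis k 1 :: real ^ 'n"
  have D: "DIM(real ^ 'n) = ?d" by simp
  have e: "?e \<in> Basis" by (auto simp: Basis_vec_def)
  have D3: "DIM(real ^ 'n) \<ge> 3" using d by simp
  note a0 = alpha0_props[OF d]
  define z where "z = cap_height ?d"
  define h where "h x = (1 + x \<bullet> ?e) / 2" for x :: "real ^ 'n"
  \<comment> \<open>Equal to the density at every point of the sphere: \<open>height_weight\<close>
    is 0 at the South Pole and at the rim, and the indicator terms restore the values of
    \<open>eq_density\<close> there. At the rim that value rests on division by 0.\<close>
  define g where "g x = enn2real (height_weight ?d (h x)) + eq_density ?d pi * indicator {0} (h x)
    + eq_density ?d (alpha0 ?d) * indicator {z} (h x)" for x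
  have hw: "(\<lambda>x. height_weight ?d (h x)) \<in> borel_measurable borel"
    unfolding h_def using measurable_compose[OF _ height_weight_measurable[OF d], of "\<lambda>y. (1 + y \<bullet> ?e) / 2" borel] by simp
  have [measurable]: "h \<in> borel_measurable borel" unfolding h_def[abs_def] by measurable
  have gm: "g \<in> borel_measurable borel"
    unfolding g_def[abs_def] using hw by measurable
  have cosx: "cos (polar_angle k x) = 2 * h x - 1" "0 \<le> h x" "0 \<le> polar_angle k x" "polar_angle k x \<le> pi" if "norm x = 1" for x
  proof -
    have b: "\<bar>x $ k\<bar> \<le> 1" using component_le_norm_cart[of x k] that by simp
    have "cos (arccos (x $ k)) = x $ k" by (rule cos_arccos) (use b in linarith)+
    then show "cos (polar_angle k x) = 2 * h x - 1" by (simp add: polar_angle_def h_def inner_axis field_simps)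
    show "0 \<le> h x" "0 \<le> polar_angle k x" "polar_angle k x \<le> pi" using b by (auto simp: h_def inner_axis polar_angle_def arccos_lbound arccos_ubound)
  qed
  have fg: "?f x = g x" if x: "norm x = 1" for x
  proof -
    note c = cosx[OF x]
    have iff: "x \<in> south_cap k (alpha0 ?d) \<longleftrightarrow> h x \<le> z"
      using mem_south_cap_iff[OF d x] by (simp add: h_def z_def)
    have angle: "polar_angle k x = \<beta>" if b: "0 \<le> \<beta>" "\<beta> \<le> pi" "cos \<beta> = 2 * h x - 1" for \<beta>
      by (rule cos_inj_pi[OF c(3,4) b(1,2)]) (simp only: c(1) b(3))
    have z0: "0 < z" using a0(3) by (simp add: z_def)
    have hwx: "height_weight ?d (h x) = (if 0 < h x \<and> h x < z then ennreal (height_density ?d (h x)) else 0)"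
      by (simp add: height_weight_def z_def)
    have ind: "indicator {0} (h x) = (if h x = 0 then 1 else 0 :: real)"
      "indicator {z} (h x) = (if h x = z then 1 else 0 :: real)" by simp_all
    have gx: "g x = enn2real (if 0 < h x \<and> h x < z then ennreal (height_density ?d (h x)) else 0)
      + eq_density ?d pi * (if h x = 0 then 1 else 0) + eq_density ?d (alpha0 ?d) * (if h x = z then 1 else 0)"
      unfolding g_def hwx ind by (rule refl)
    have "h x = 0 \<or> (0 < h x \<and> h x < z) \<or> h x = z \<or> z < h x" using c(2) by argo
    then consider "h x = 0" | "0 < h x" "h x < z" | "h x = z" | "z < h x" by blast
    then show ?thesis
    proof cases
      case 1
      have "polar_angle k x = pi" by (rule angle) (simp_all add: 1)
      then show ?thesis using z0 unfolding gx iff 1 by simp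
    next
      case 2
      have "eq_density ?d (polar_angle k x) = height_density ?d (h x)"
        by (rule eq_density_eq[OF d c(1) c(2)]) (use 2 in \<open>simp add: z_def\<close>)
      moreover have "0 \<le> height_density ?d (h x)"
        using height_density_pos[OF d 2(1) 2(2)[unfolded z_def]] by (rule less_imp_le)
      ultimately show ?thesis using 2 unfolding gx iff by simp
    next
      case 3
      have "polar_angle k x = alpha0 ?d" by (rule angle) (use a0(1,5) in \<open>simp_all add: 3 z_def\<close>)
      then show ?thesis using z0 unfolding gx iff 3 by simp
    next
      case 4
      then show ?thesis using z0 unfolding gx iff by simp
    qed
  qed
  have fm: "?f \<in> borel_measurable sphere_measure"
  proof -
    have "g \<in> borel_measurable sphere_measure" by (rule measurable_sphere_measure[OF gm])
    then show ?thesis by (subst measurable_cong[of _ _ g]) (auto simp: fg)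
  qed
  have m3: "DIM(real ^ 'n) = (?d - 3) + 3" using d by simp
  have ae: "AE x in sphere_measure. height_weight ?d (h x) = ennreal (?f x) \<and> 0 \<le> ?f x"
  proof -
    have "AE x in sphere_measure. h x \<noteq> 0" "AE x in sphere_measure. h x \<noteq> z"
      unfolding h_def by (rule AE_sphere_height_neq[OF e m3])+
    moreover have "AE x :: real ^ 'n in sphere_measure. norm x = 1" by (rule AE_I2) simp
    ultimately show ?thesis
    proof eventually_elim
      case (elim x)
      have "indicator {0} (h x) = (0::real)" "indicator {z} (h x) = (0::real)" using elim(1,2) by simp_all
      then have "g x = enn2real (height_weight ?d (h x))" unfolding g_def by (simp only: mult_zero_right add_0_right)
      then have f: "?f x = enn2real (height_weight ?d (h x))" by (simp only: fg[OF elim(3)])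
      have fin: "height_weight ?d (h x) < \<top>"
        unfolding height_weight_def by (cases "h x \<in> {0<..<cap_height ?d}") simp_all
      show ?case unfolding f ennreal_enn2real[OF fin] by simp
    qed
  qed
  show ?thesis
    unfolding has_density_def
  proof (intro conjI)
    show "?f \<in> borel_measurable sphere_measure" by (rule fm)
    show "AE x in sphere_measure. 0 \<le> ?f x" using ae by (rule eventually_mono) simp
    have "density sphere_measure (\<lambda>y. height_weight ?d (h y)) = density sphere_measure (\<lambda>x. ennreal (?f x))"
    proof (rule density_cong)
      show "(\<lambda>y. height_weight ?d (h y)) \<in> borel_measurable sphere_measure"
        by (rule measurable_sphere_measure[OF hw])
      show "(\<lambda>x. ennreal (?f x)) \<in> borel_measurable sphere_measure"
        using fm by (rule measurable_compose) measurable
      show "AE x in sphere_measure. height_weight ?d (h x) = ennreal (?f x)"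
        using ae by (rule eventually_mono) simp
    qed
    then show "cap_equilibrium ?e = density sphere_measure (\<lambda>x. ennreal (?f x))"
      unfolding cap_equilibrium_def h_def by simp
  qed
qed

theorem theorem2p7:
  fixes k :: "'n::finite" and d :: nat and Q :: "real ^ 'n \<Rightarrow> real"
  assumes "d = CARD('n)" and "d \<ge> 3"
    and "\<And>x. x \<in> sphere 0 1 \<Longrightarrow> Q x = (1 + x $ k)\<^sup>2"
  shows "(\<exists>!\<alpha>. \<alpha> \<in> {0<..<pi} \<and> angle_equation d \<alpha>)
    \<and> (\<exists>!\<mu>. is_extremal Q \<mu>)
    \<and> supp (extremal_measure Q) = south_cap k (alpha0 d)
    \<and> has_density (extremal_measure Q) sphere_measure
        (\<lambda>x. if x \<in> south_cap k (alpha0 d) then eq_density d (polar_angle k x) else 0)"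
proof -
  let ?e = "axis k 1 :: real ^ 'n"
  have e: "?e \<in> Basis" by (auto simp: Basis_vec_def)
  have d: "CARD('n) \<ge> 3" "DIM(real ^ 'n) \<ge> 3" using assms(1,2) by simp_all
  have "Q x = (1 + x \<bullet> ?e)\<^sup>2" if "norm x = 1" for x
    using assms(3)[of x] that by (simp add: inner_axis)
  then have ext: "is_extremal Q \<mu> \<longleftrightarrow> \<mu> = cap_equilibrium ?e" for \<mu>
    by (rule is_extremal_iff[OF e d(2)])
  then have ext': "extremal_measure Q = cap_equilibrium ?e"
    by (simp add: extremal_measure_def)
  have "supp (cap_equilibrium ?e) = south_cap k (alpha0 CARD('n))"
    unfolding supp_cap_equilibrium[OF e d(2)] using mem_south_cap_iff[OF d(1)]
    by (auto simp: south_cap_def)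
  then show ?thesis
    unfolding ext' ext unfolding assms(1)
    using ex1_angle_equation[OF d(1)] has_density_cap_equilibrium[OF d(1), of k] by blast
qed

end
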